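(* Let $p:M(\mathbb{C})^g\to M(\mathbb{C})^g$ be a free polynomial mapping. Then $p$ is bijective if and only if the free polynomial mapping in $2g$ freely noncommuting variables $(h,x)\mapsto (Dp(x)[h],x)$ has a (free) polynomial inverse.
   Context: Let $x=(x_1,\dots,x_g)$ and $h=(h_1,\dots,h_g)$ be tuples of freely noncommuting indeterminates. A free polynomial mapping $p=(p^1,\dots,p^g):M(\mathbb{C})^g\to M(\mathbb{C})^g$ is a $g$-tuple of elements of the free associative algebra $\mathbb{C}\langle x_1,\dots,x_g\rangle$, inducing by evaluation maps $p[n]:M_n(\mathbb{C})^g\to M_n(\mathbb{C})^g$ for all $n\ge1$; $p$ is bijective if every $p[n]$ is bijective. The free derivative $D:\mathbb{C}\langle x\rangle\to\mathbb{C}\langle x, h\rangle$ is the $\mathbb{C}$-linear map with $D1=0$, $Dx_i(x)[h]=h_i$ and $D(\eta\mu)(x)[h]=D\eta(x)[h]\,\mu(x)+\eta(x)\,D\mu(x)[h]$; $Dp(x)[h]$ is the $g$-tuple $(Dp^1(x)[h],\dots,Dp^g(x)[h])$. A polynomial inverse of a $2g$-tuple of free polynomials in $2g$ variables is a $2g$-tuple of free polynomials in $2g$ variables that is a two-sided inverse under composition (substitution). *)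

theory Defs
  imports Complex_Main "HOL-Library.Poly_Mapping" "Jordan_Normal_Form.Matrix"
begin

text \<open>
  The free associative algebra on a set of letters is the monoid algebra of the free monoid of
  words. The type \<open>fword\<close> is a copy of \<open>list\<close> carrying this monoid structure
  (written additively, as required by \<^theory>\<open>HOL-Library.Poly_Mapping\<close>), so that the library
  provides the ring structure (convolution product) on finitely supported functions.
\<close>

datatype 'v fword = FWord (letters: "'v list")

instantiation fword :: (type) monoid_add
begin

definition zero_fword :: "'a fword" where
  "zero_fword = FWord []"

definition plus_fword :: "'a fword \<Rightarrow> 'a fword \<Rightarrow> 'a fword" where
  "plus_fword u v = FWord (letters u @ letters v)"

instance
  by standard (simp_all add: zero_fword_def plus_fword_def)

end

lemma letters_zero [simp]: "letters 0 = []"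
  by (simp add: zero_fword_def)

lemma letters_plus [simp]: "letters (u + v) = letters u @ letters v"
  by (simp add: plus_fword_def)

type_synonym 'v fpoly = "'v fword \<Rightarrow>\<^sub>0 complex"

lemma fpoly_induct [case_names single sum]:
  fixes p :: "'v fpoly"
  assumes single: "\<And>k v. P (Poly_Mapping.single k v)"
    and sum: "\<And>p q. P p \<Longrightarrow> P q \<Longrightarrow> P (p + q)"
  shows "P p"
proof (induction p rule: update_induct)
  case const
  then show ?case using single[of 0 0] by simp
next
  case (update f a b)
  have "Poly_Mapping.update a b f = f + Poly_Mapping.single a b"
    by (rule poly_mapping_eqI)
       (use update in \<open>auto simp: lookup_update lookup_add lookup_single when_def in_keys_iff\<close>)
  then show ?case using sum[OF update(3) single] by simp
qed

definition fconst :: "complex \<Rightarrow> 'v fpoly" where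
  "fconst c = Poly_Mapping.single 0 c"

definition fvar :: "'v \<Rightarrow> 'v fpoly" where
  "fvar v = Poly_Mapping.single (FWord [v]) 1"

lemma fconst_0 [simp]: "fconst 0 = 0"
  by (simp add: fconst_def)

lemma fconst_1 [simp]: "fconst 1 = 1"
  by (simp add: fconst_def)

lemma fconst_add: "fconst (a + b) = fconst a + fconst b"
  by (simp add: fconst_def single_add)

lemma fconst_mult: "fconst (a * b) = fconst a * fconst b"
  by (simp add: fconst_def mult_single)

lemma fconst_commute: "fconst a * p = p * fconst a"
proof (induction p rule: fpoly_induct)
  case (single k v)
  then show ?case by (simp add: fconst_def mult_single mult.commute)
next
  case (sum p q)
  then show ?case by (simp add: algebra_simps)
qed

text \<open>The linear extension of a map given on words.\<close>

definition linext :: "('v fword \<Rightarrow> 'u fpoly) \<Rightarrow> 'v fpoly \<Rightarrow> 'u fpoly" where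
  "linext f p = (\<Sum>w\<in>Poly_Mapping.keys p. fconst (Poly_Mapping.lookup p w) * f w)"

lemma linext_superset:
  assumes "finite S" "Poly_Mapping.keys p \<subseteq> S"
  shows "linext f p = (\<Sum>w\<in>S. fconst (Poly_Mapping.lookup p w) * f w)"
  unfolding linext_def
  by (rule sum.mono_neutral_left) (use assms in \<open>auto simp: in_keys_iff\<close>)

lemma linext_add: "linext f (p + q) = linext f p + linext f q"
proof -
  let ?S = "Poly_Mapping.keys p \<union> Poly_Mapping.keys q"
  have "linext f r = (\<Sum>w\<in>?S. fconst (Poly_Mapping.lookup r w) * f w)"
    if "r \<in> {p, q, p + q}" for r
    by (rule linext_superset) (use that Poly_Mapping.keys_add[of p q] in auto)
  then show ?thesis
    by (simp add: lookup_add fconst_add distrib_right sum.distrib)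
qed

lemma linext_single: "linext f (Poly_Mapping.single w c) = fconst c * f w"
  by (cases "c = 0") (simp_all add: linext_def)

lemma linext_fconst_mult: "linext f (fconst c * p) = fconst c * linext f p"
proof (induction p rule: fpoly_induct)
  case (single k v)
  then show ?case
    by (simp add: fconst_def mult_single linext_single[unfolded fconst_def] flip: mult.assoc)
next
  case (sum p q)
  then show ?case by (simp add: linext_add distrib_left)
qed


text \<open>Composition: \<open>fsubst q p\<close> replaces every variable \<open>v\<close> of \<open>p\<close> by \<open>q v\<close>.\<close>

definition fsubst :: "('v \<Rightarrow> 'u fpoly) \<Rightarrow> 'v fpoly \<Rightarrow> 'u fpoly" where
  "fsubst q = linext (\<lambda>w. prod_list (map q (letters w)))"

lemma fsubst_add: "fsubst q (a + b) = fsubst q a + fsubst q b"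
  by (simp add: fsubst_def linext_add)

lemma fsubst_fconst [simp]: "fsubst q (fconst c) = fconst c"
  unfolding fsubst_def fconst_def[of c] by (simp add: linext_single fconst_def)

lemma fsubst_fvar [simp]: "fsubst q (fvar v) = q v"
  by (simp add: fsubst_def fvar_def linext_single)

lemma fsubst_mult: "fsubst q (a * b) = fsubst q a * fsubst q b"
proof (induction a rule: fpoly_induct)
  case (single u c)
  show ?case
  proof (induction b rule: fpoly_induct)
    case (single v d)
    show ?case
      by (simp add: fsubst_def mult_single linext_single fconst_mult mult.assoc)
         (metis fconst_commute mult.assoc)
  next
    case (sum p q)
    then show ?case by (simp add: fsubst_add distrib_left)
  qed
next
  case (sum p q)
  then show ?case by (simp add: fsubst_add distrib_right)
qed


text \<open>
  The free derivative. The letters of the target algebra are the directions \<open>h\<^sub>i\<close>, encoded as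
  \<open>Inl i\<close>, and the variables \<open>x\<^sub>i\<close>, encoded as \<open>Inr i\<close>. On words it is computed by the product
  rule; \<open>fderiv_fvar\<close>, \<open>fderiv_mult\<close> etc. below are the defining properties.
\<close>

abbreviation hvar :: "'v \<Rightarrow> ('v + 'v) fpoly" where
  "hvar i \<equiv> fvar (Inl i)"

abbreviation xvar :: "'v \<Rightarrow> ('v + 'v) fpoly" where
  "xvar i \<equiv> fvar (Inr i)"

primrec word_deriv :: "'v list \<Rightarrow> ('v + 'v) fpoly" where
  "word_deriv [] = 0"
| "word_deriv (i # w) = hvar i * prod_list (map xvar w) + xvar i * word_deriv w"

definition fderiv :: "'v fpoly \<Rightarrow> ('v + 'v) fpoly" where
  "fderiv = linext (\<lambda>w. word_deriv (letters w))"

lemma word_deriv_append: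
  "word_deriv (u @ v) =
     word_deriv u * prod_list (map xvar v) + prod_list (map xvar u) * word_deriv v"
  by (induction u) (simp_all add: algebra_simps)

lemma fderiv_add: "fderiv (p + q) = fderiv p + fderiv q"
  by (simp add: fderiv_def linext_add)

lemma fderiv_fconst_mult: "fderiv (fconst c * p) = fconst c * fderiv p"
  by (simp add: fderiv_def linext_fconst_mult)

lemma fderiv_1: "fderiv 1 = 0"
  unfolding fderiv_def single_one[symmetric] by (simp only: linext_single) simp

lemma fderiv_fvar: "fderiv (fvar i) = hvar i"
  unfolding fderiv_def fvar_def[of i] by (simp add: linext_single)

lemma fderiv_mult:
  "fderiv (p * q) = fderiv p * fsubst xvar q + fsubst xvar p * fderiv q"
proof (induction p rule: fpoly_induct)
  case (single u c)
  show ?case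
  proof (induction q rule: fpoly_induct)
    case (single v d)
    have 1: "a * (fconst d * b) = fconst d * (a * b)" for a b :: "('a + 'a) fpoly"
      by (metis fconst_commute mult.assoc)
    show ?case
      by (simp add: fderiv_def fsubst_def mult_single linext_single fconst_mult
          word_deriv_append mult.assoc distrib_left 1)
  next
    case (sum p q)
    then show ?case by (simp add: fderiv_add fsubst_add algebra_simps)
  qed
next
  case (sum p q)
  then show ?case by (simp add: fderiv_add fsubst_add algebra_simps)
qed


text \<open>
  Evaluation at a tuple of \<open>n \<times> n\<close> matrices. Since matrices of JNF form no type class,
  the linear combination of the word values is written entrywise.
\<close>

definition mat_tuples :: "nat \<Rightarrow> ('v \<Rightarrow> complex mat) set" where
  "mat_tuples n = {X. \<forall>i. X i \<in> carrier_mat n n}"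

primrec word_eval :: "nat \<Rightarrow> ('v \<Rightarrow> complex mat) \<Rightarrow> 'v list \<Rightarrow> complex mat" where
  "word_eval n X [] = 1\<^sub>m n"
| "word_eval n X (i # w) = X i * word_eval n X w"

definition fpoly_eval :: "nat \<Rightarrow> ('v \<Rightarrow> complex mat) \<Rightarrow> 'v fpoly \<Rightarrow> complex mat" where
  "fpoly_eval n X p =
     mat n n (\<lambda>(r, s). \<Sum>w\<in>Poly_Mapping.keys p.
       Poly_Mapping.lookup p w * word_eval n X (letters w) $$ (r, s))"

lemma word_eval_carrier:
  "X \<in> mat_tuples n \<Longrightarrow> word_eval n X w \<in> carrier_mat n n"
  by (induction w) (auto simp: mat_tuples_def intro!: mult_carrier_mat)

lemma word_eval_append:
  assumes "X \<in> mat_tuples n"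
  shows "word_eval n X (u @ v) = word_eval n X u * word_eval n X v"
proof (induction u)
  case Nil
  show ?case using word_eval_carrier[OF assms, of v] by simp
next
  case (Cons i u)
  have "X i \<in> carrier_mat n n" using assms by (simp add: mat_tuples_def)
  then show ?case
    using Cons word_eval_carrier[OF assms] by (simp add: assoc_mult_mat[of _ n n _ n _ n])
qed

lemma fpoly_eval_carrier [simp]: "fpoly_eval n X p \<in> carrier_mat n n"
  by (simp add: fpoly_eval_def)

lemma fpoly_eval_superset:
  assumes "finite S" "Poly_Mapping.keys p \<subseteq> S"
  shows "fpoly_eval n X p =
     mat n n (\<lambda>(r, s). \<Sum>w\<in>S.
       Poly_Mapping.lookup p w * word_eval n X (letters w) $$ (r, s))"
  unfolding fpoly_eval_def
  by (intro cong_mat refl, simp, rule sum.mono_neutral_left)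
     (use assms in \<open>auto simp: in_keys_iff\<close>)

lemma fpoly_eval_add: "fpoly_eval n X (p + q) = fpoly_eval n X p + fpoly_eval n X q"
proof -
  let ?S = "Poly_Mapping.keys p \<union> Poly_Mapping.keys q"
  have "fpoly_eval n X t = mat n n (\<lambda>(r, s). \<Sum>w\<in>?S.
          Poly_Mapping.lookup t w * word_eval n X (letters w) $$ (r, s))"
    if "t \<in> {p, q, p + q}" for t
    by (rule fpoly_eval_superset) (use that Poly_Mapping.keys_add[of p q] in auto)
  then show ?thesis
    by (auto simp: lookup_add distrib_right sum.distrib)
qed

lemma fpoly_eval_single:
  assumes "X \<in> mat_tuples n"
  shows "fpoly_eval n X (Poly_Mapping.single w c) = c \<cdot>\<^sub>m word_eval n X (letters w)"
  using word_eval_carrier[OF assms, of "letters w"]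
  by (cases "c = 0") (auto simp: fpoly_eval_def)

lemma fpoly_eval_fconst: "X \<in> mat_tuples n \<Longrightarrow> fpoly_eval n X (fconst c) = c \<cdot>\<^sub>m 1\<^sub>m n"
  by (simp add: fconst_def fpoly_eval_single)

lemma fpoly_eval_fvar:
  assumes "X \<in> mat_tuples n"
  shows "fpoly_eval n X (fvar i) = X i"
proof -
  have "X i \<in> carrier_mat n n" using assms by (simp add: mat_tuples_def)
  then show ?thesis
    by (simp add: fvar_def fpoly_eval_single[OF assms]) auto
qed

lemma fpoly_eval_mult:
  assumes X: "X \<in> mat_tuples n"
  shows "fpoly_eval n X (p * q) = fpoly_eval n X p * fpoly_eval n X q"
proof (induction p rule: fpoly_induct)
  case (single u c)
  show ?case
  proof (induction q rule: fpoly_induct)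
    case (single v d)
    note C = word_eval_carrier[OF X]
    have 1: "(c * d) \<cdot>\<^sub>m A = d \<cdot>\<^sub>m (c \<cdot>\<^sub>m A)" for A :: "complex mat"
      by auto
    show ?case
      using C[of "letters u"] C[of "letters v"]
      by (simp add: fpoly_eval_single[OF X] mult_single word_eval_append[OF X]
          mult_smult_assoc_mat[of _ n n _ n] mult_smult_distrib[of _ n n _ n] 1)
  next
    case (sum p q)
    then show ?case
      by (simp add: fpoly_eval_add distrib_left mult_add_distrib_mat[of _ n n _ n])
  qed
next
  case (sum p q)
  then show ?case
    by (simp add: fpoly_eval_add distrib_right add_mult_distrib_mat[of _ n n _ _ n])
qed


text \<open>
  A free polynomial mapping in the variables \<open>'g\<close> is a family \<open>p :: 'g \<Rightarrow> 'g fpoly\<close>.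
\<close>

definition map_eval :: "('g \<Rightarrow> 'g fpoly) \<Rightarrow> nat \<Rightarrow> ('g \<Rightarrow> complex mat) \<Rightarrow> ('g \<Rightarrow> complex mat)" where
  "map_eval p n X = (\<lambda>i. fpoly_eval n X (p i))"

definition free_bijective :: "('g \<Rightarrow> 'g fpoly) \<Rightarrow> bool" where
  "free_bijective p \<longleftrightarrow> (\<forall>n\<ge>1. bij_betw (map_eval p n) (mat_tuples n) (mat_tuples n))"

definition has_polynomial_inverse :: "('g \<Rightarrow> 'g fpoly) \<Rightarrow> bool" where
  "has_polynomial_inverse F \<longleftrightarrow>
     (\<exists>Q :: 'g \<Rightarrow> 'g fpoly. (\<forall>v. fsubst Q (F v) = fvar v) \<and> (\<forall>v. fsubst F (Q v) = fvar v))"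

text \<open>The mapping \<open>(h, x) \<mapsto> (Dp(x)[h], x)\<close> in the \<open>2g\<close> variables \<open>'g + 'g\<close>.\<close>

definition deriv_map :: "('g \<Rightarrow> 'g fpoly) \<Rightarrow> ('g + 'g \<Rightarrow> ('g + 'g) fpoly)" where
  "deriv_map p = case_sum (\<lambda>i. fderiv (p i)) (\<lambda>i. xvar i)"

end

theory Submission
  imports Defs "Jordan_Normal_Form.Schur_Decomposition"
    "HOL-Computational_Algebra.Formal_Laurent_Series" "HOL-Computational_Algebra.Polynomial_FPS"
begin

text \<open>
  Let \<open>A\<close> be the free algebra in the letters \<open>x\<close>. A polynomial in \<open>h\<close> and \<open>x\<close> that is linear in \<open>h\<close>
  is a family of tensors in \<open>A \<otimes> A\<close>, one for each \<open>h\<^sub>j\<close>: the letters to the left of \<open>h\<^sub>j\<close> and those to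
  the right of it are independent of each other. Both directions rest on this two-sided view of \<open>Dp\<close>,
  and both end with the same question: when is the inverse of a noncommutative power series
  \<open>1 - \<Sum>\<^sub>i N\<^sub>i y\<^sub>i\<close> with square matrices \<open>N\<^sub>i\<close> as coefficients a polynomial? The inverse is
  \<open>\<Sum>\<^sub>w N\<^sub>w y\<^sub>w\<close>, a sum over words, so this holds iff all long products of the \<open>N\<^sub>i\<close> vanish. For complex
  matrices it is enough that \<open>H = \<Sum>\<^sub>i X\<^sub>i H N\<^sub>i\<close> has only the solution \<open>H = 0\<close>, for all matrices \<open>X\<close>
  (\<open>jointly_nilpotent_if_pencil_injective\<close>).

  \<^bold>\<open>From \<open>p\<close> to \<open>Dp\<close>.\<close> The upper right corner of \<open>p\<close> at the block matrices with diagonal blocks \<open>X\<^sub>j\<close>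
  and \<open>Z\<^sub>j\<close>, corner \<open>H\<^sub>j\<close> and \<open>0\<close> below is \<open>Dp(X, Z)[H]\<close>, where \<open>X\<close> is substituted to the left of \<open>h\<close>
  and \<open>Z\<close> to the right. As \<open>p\<close> is injective on the matrices of the size of the block matrix,
  \<open>H \<mapsto> Dp(X, Z)[H]\<close> is injective for all square \<open>X\<close> and \<open>Z\<close> of any two sizes (\<open>corner_kernel\<close>).
  Consider \<open>Dp\<close> as a polynomial in the left letters, whose coefficients are matrices over \<open>A\<close>, the
  algebra of the right letters. If its constant coefficient is \<open>1\<close>, it has a formal inverse, which a
  companion matrix turns into the inverse of a linear \<open>1 - \<Sum>\<^sub>i N\<^sub>i y\<^sub>i\<close> with \<open>N\<^sub>i\<close> over \<open>A\<close>. For each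
  matrix point \<open>Z\<close> the matrices \<open>N\<^sub>i(Z)\<close> are jointly nilpotent, but this only bounds their index in
  terms of the size of \<open>Z\<close>. The index is at most the number of rows over the ring of skew power series
  \<open>\<Sum>\<^sub>n f\<^sub>n(s) t\<^sup>n\<close> with \<open>t f(s) = f(q s) t\<close>, because there one of two elements always divides the other
  (\<open>nilpotency_index_le_card\<close>). When \<open>q\<close> is a root of unity, the homomorphisms \<open>x\<^sub>i \<mapsto> f\<^sub>i(s) t\<close> into this
  ring factor through matrices, and together they separate the points of \<open>A\<close>
  (\<open>ex_skew_hom_neq_0\<close>). So the \<open>N\<^sub>i\<close> are jointly nilpotent over \<open>A\<close>, and the formal inverse is a
  polynomial (\<open>left_inverse_if_pointwise_injective\<close>). This is applied twice: at \<open>X = 0\<close>, with \<open>Z\<close> in the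
  place of the left letters, to make the constant coefficient \<open>1\<close>, and then to \<open>Dp\<close> itself.

  \<^bold>\<open>From \<open>Dp\<close> to \<open>p\<close>.\<close> Let \<open>p(0) = 0\<close> and let \<open>Q\<close> be the inverse of the derivative mapping. Then
  \<open>\<delta> f = Df(x)[Q(h, x)]\<close> is a derivation from \<open>A\<close> to \<open>A \<otimes> A\<close> with \<open>\<delta> p\<^sub>i = h\<^sub>i\<close>: with respect to the
  elements \<open>p\<^sub>i\<close> it is what \<open>D\<close> is with respect to the letters. Setting the letters left of \<open>h\<^sub>j\<close> to \<open>0\<close>
  in \<open>\<delta> f\<close> gives operators \<open>shift j\<close> with \<open>f = f(0) + \<Sum>\<^sub>j p\<^sub>j (shift j f)\<close> (\<open>decomp\<close>). Repeated use of
  this identity expands \<open>x\<^sub>i\<close> into a power series in \<open>p\<close>, the inverse of \<open>p\<close>. All iterated shifts of \<open>x\<^sub>i\<close>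
  arise from the one tensor \<open>\<delta> x\<^sub>i = Q\<^sub>i\<close> by applying functionals to its left factor, so they span a
  finite-dimensional space (\<open>orbit_finite_dim\<close>). Let \<open>T\<^sub>j\<close> be the matrices of the shifts on that space;
  the inverse series is a polynomial once the \<open>T\<^sub>j\<close> are jointly nilpotent. Now \<open>1 - \<Sum>\<^sub>j T\<^sub>j p\<^sub>j\<close> has an
  inverse with entries in \<open>A\<close>, made of the contractions of \<open>\<delta>\<close> on the other side (\<open>pencil_inverse\<close>).
  Substituting the truncated inverse series for \<open>x\<close> and evaluating at \<open>t Y\<close>, for matrices \<open>Y\<close>, one finds
  for every \<open>K\<close> an invertible matrix over \<open>\<complex>[t]\<close> that is congruent to \<open>1 - t \<Sum>\<^sub>j T\<^sub>j \<otimes> Y\<^sub>j\<close> modulo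
  \<open>t\<^sup>K\<close>. Its determinant is a constant, so that of \<open>1 - t \<Sum>\<^sub>j T\<^sub>j \<otimes> Y\<^sub>j\<close> is \<open>1\<close>
  (\<open>pencil_injective_if_locally_invertible\<close>). Hence \<open>1 - \<Sum>\<^sub>j T\<^sub>j \<otimes> Y\<^sub>j\<close> is injective for all \<open>Y\<close>, and the
  \<open>T\<^sub>j\<close> are jointly nilpotent (\<open>T_nilpotent\<close>).
\<close>

section \<open>Complex matrices indexed by finite sets\<close>

lemma upper_triangular_zero_diag_pow:
  fixes B :: "'a :: comm_ring_1 mat"
  assumes B: "B \<in> carrier_mat k k" and ut: "upper_triangular B"
    and d: "\<And>i. i < k \<Longrightarrow> B $$ (i, i) = 0"
  shows "i < k \<Longrightarrow> j < k \<Longrightarrow> j < i + m \<Longrightarrow> (B ^\<^sub>m m) $$ (i, j) = 0"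
proof (induction m arbitrary: i j)
  case 0
  then show ?case using B by simp
next
  case (Suc m)
  have Bm: "B ^\<^sub>m m \<in> carrier_mat k k" using B by simp
  have "(B ^\<^sub>m Suc m) $$ (i, j) = (\<Sum>l\<in>{0..<k}. (B ^\<^sub>m m) $$ (i, l) * B $$ (l, j))"
    using B Bm Suc.prems by (simp add: scalar_prod_def)
  also have "\<dots> = 0"
  proof (rule sum.neutral, intro ballI)
    fix l assume l: "l \<in> {0..<k}"
    show "(B ^\<^sub>m m) $$ (i, l) * B $$ (l, j) = 0"
    proof (cases "l < i + m")
      case True
      then show ?thesis using Suc.IH[of i l] Suc.prems l by simp
    next
      case False
      then have "j \<le> l" using Suc.prems by simp
      then have "B $$ (l, j) = 0"
        using d[of l] ut B l unfolding upper_triangular_def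
        by (cases "j = l") auto
      then show ?thesis by simp
    qed
  qed
  finally show ?case .
qed

lemma pow_eq_0_if_no_nonzero_eigenvalue:
  fixes A :: "complex mat"
  assumes A: "A \<in> carrier_mat k k" and ev: "\<And>l. eigenvalue A l \<Longrightarrow> l = 0"
  shows "A ^\<^sub>m k = 0\<^sub>m k k"
proof -
  obtain as where as: "char_poly A = (\<Prod>a\<leftarrow>as. [:- a, 1:])"
    using char_poly_factorized[OF A] by blast
  obtain B where B: "B \<in> carrier_mat k k" and ut: "upper_triangular B" and sim: "similar_mat A B"
    using schur_decomposition_exists[OF A as] by blast
  have cp: "char_poly A = (\<Prod>a\<leftarrow>diag_mat B. [:- a, 1:])"
    using char_poly_similar[OF sim] char_poly_upper_triangular[OF B ut] by simp
  have d: "B $$ (i, i) = 0" if "i < k" for i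
  proof -
    have "B $$ (i, i) \<in> set (diag_mat B)" using that B by (auto simp: diag_mat_def)
    then have "poly (char_poly A) (B $$ (i, i)) = 0"
      unfolding cp by (auto simp: poly_prod_list prod_list_zero_iff)
    then show ?thesis using ev eigenvalue_root_char_poly[OF A] by blast
  qed
  have Bk: "B ^\<^sub>m k = 0\<^sub>m k k"
    using B upper_triangular_zero_diag_pow[OF B ut d] by (intro eq_matI) auto
  obtain P Q where w: "similar_mat_wit A B P Q" using sim unfolding similar_mat_def by blast
  then have PQ: "P \<in> carrier_mat k k" "Q \<in> carrier_mat k k"
    using A unfolding similar_mat_wit_def by (auto simp: Let_def)
  have "similar_mat_wit (A ^\<^sub>m k) (B ^\<^sub>m k) P Q" by (rule similar_mat_wit_pow[OF w])
  then have "A ^\<^sub>m k = P * B ^\<^sub>m k * Q" unfolding similar_mat_wit_def by (auto simp: Let_def)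
  then show ?thesis unfolding Bk using PQ by simp
qed

text \<open>
  Most matrices below are functions on a finite index set such as a set of tensors or of words;
  \<open>enum_mat\<close> transports them along an enumeration of that set to numbered rows and columns, where
  determinants and eigenvalues are available.
\<close>

definition enum_mat :: "nat \<Rightarrow> (nat \<Rightarrow> 's) \<Rightarrow> ('s \<Rightarrow> 's \<Rightarrow> 'a) \<Rightarrow> 'a mat" where
  "enum_mat k e M = mat k k (\<lambda>(r, s). M (e r) (e s))"

lemma enum_mat_carrier [simp]: "enum_mat k e M \<in> carrier_mat k k"
  by (simp add: enum_mat_def)

lemma enum_mat_index [simp]: "r < k \<Longrightarrow> s < k \<Longrightarrow> enum_mat k e M $$ (r, s) = M (e r) (e s)"
  by (simp add: enum_mat_def)

lemma enum_mat_dim [simp]: "dim_row (enum_mat k e M) = k" "dim_col (enum_mat k e M) = k"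
  by (simp_all add: enum_mat_def)

lemma enum_mat_mult:
  assumes e: "bij_betw e {0..<k} S"
  shows "enum_mat k e M * enum_mat k e N = enum_mat k e (\<lambda>a b. \<Sum>c\<in>S. M a c * N c b)"
proof (rule eq_matI)
  fix r s assume "r < dim_row (enum_mat k e (\<lambda>a b. \<Sum>c\<in>S. M a c * N c b))"
    "s < dim_col (enum_mat k e (\<lambda>a b. \<Sum>c\<in>S. M a c * N c b))"
  then have rs: "r < k" "s < k" by auto
  have "(enum_mat k e M * enum_mat k e N) $$ (r, s) = (\<Sum>c\<in>{0..<k}. M (e r) (e c) * N (e c) (e s))"
    using rs by (simp add: scalar_prod_def)
  also have "\<dots> = (\<Sum>c\<in>S. M (e r) c * N c (e s))"
    by (rule sum.reindex_bij_betw[OF e])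
  finally show "(enum_mat k e M * enum_mat k e N) $$ (r, s)
      = enum_mat k e (\<lambda>a b. \<Sum>c\<in>S. M a c * N c b) $$ (r, s)" using rs by simp
qed auto

lemma enum_mat_mult_vec:
  assumes e: "bij_betw e {0..<k} S"
  shows "enum_mat k e M *\<^sub>v vec k (\<lambda>r. h (e r)) = vec k (\<lambda>r. \<Sum>c\<in>S. M (e r) c * h c)"
proof (rule eq_vecI)
  fix r assume "r < dim_vec (vec k (\<lambda>r. \<Sum>c\<in>S. M (e r) c * h c))"
  then have r: "r < k" by simp
  have "(enum_mat k e M *\<^sub>v vec k (\<lambda>r. h (e r))) $ r = (\<Sum>c\<in>{0..<k}. M (e r) (e c) * h (e c))"
    using r by (simp add: scalar_prod_def)
  also have "\<dots> = (\<Sum>c\<in>S. M (e r) c * h c)"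
    by (rule sum.reindex_bij_betw[OF e])
  finally show "(enum_mat k e M *\<^sub>v vec k (\<lambda>r. h (e r))) $ r = vec k (\<lambda>r. \<Sum>c\<in>S. M (e r) c * h c) $ r"
    using r by simp
qed simp

lemma ex_enum: "finite S \<Longrightarrow> \<exists>e. bij_betw e {0..<card S} S"
  by (rule ex_bij_betw_nat_finite)

lemma vec_as_fun:
  assumes e: "bij_betw e {0..<k} S" and v: "v \<in> carrier_vec k"
  obtains h where "v = vec k (\<lambda>r. h (e r))"
proof -
  have "v = vec k (\<lambda>r. (\<lambda>s. v $ (inv_into {0..<k} e s)) (e r))"
    using v bij_betw_imp_inj_on[OF e] by (intro eq_vecI) (auto simp: inv_into_f_f)
  then show ?thesis by (rule that)
qed

lemma kernel_trivial_imp_right_inverse: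
  fixes M :: "'s \<Rightarrow> 's \<Rightarrow> complex"
  assumes S: "finite S"
    and inj: "\<And>h. (\<And>a. a \<in> S \<Longrightarrow> (\<Sum>b\<in>S. M a b * h b) = 0) \<Longrightarrow> (\<And>b. b \<in> S \<Longrightarrow> h b = 0)"
  obtains B where "\<And>a b. a \<in> S \<Longrightarrow> b \<in> S \<Longrightarrow> (\<Sum>c\<in>S. M a c * B c b) = (if a = b then 1 else 0)"
proof -
  define k where "k = card S"
  obtain e where e: "bij_betw e {0..<k} S" using ex_enum[OF S] k_def by blast
  let ?A = "enum_mat k e M"
  have "det ?A \<noteq> 0"
  proof
    assume "det ?A = 0"
    then obtain v where v: "v \<in> carrier_vec k" "v \<noteq> 0\<^sub>v k" "?A *\<^sub>v v = 0\<^sub>v k"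
      using det_0_iff_vec_prod_zero_field[of ?A k] by auto
    obtain h where h: "v = vec k (\<lambda>r. h (e r))" by (rule vec_as_fun[OF e v(1)])
    have z: "(\<Sum>c\<in>S. M (e r) c * h c) = 0" if "r < k" for r
      using v(3) that unfolding h enum_mat_mult_vec[OF e] by (auto dest!: arg_cong[where f="\<lambda>x. vec_index x r"])
    have "(\<Sum>c\<in>S. M a c * h c) = 0" if "a \<in> S" for a
      using z that e unfolding bij_betw_def by force
    then have "h b = 0" if "b \<in> S" for b using inj that by blast
    then have "v = 0\<^sub>v k" unfolding h using e unfolding bij_betw_def by (intro eq_vecI) auto
    with v(2) show False by simp
  qed
  then obtain d where d: "d * det ?A = 1" by (metis left_inverse)
  define B where "B = (\<lambda>a c. d * adj_mat ?A $$ (inv_into {0..<k} e a, inv_into {0..<k} e c))"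
  have inv: "inv_into {0..<k} e (e r) = r" if "r < k" for r
    using bij_betw_imp_inj_on[OF e] that by (simp add: inv_into_f_f)
  have adj: "adj_mat ?A \<in> carrier_mat k k" "?A * adj_mat ?A = det ?A \<cdot>\<^sub>m 1\<^sub>m k"
    using adj_mat[of ?A k] by auto
  show ?thesis
  proof (rule that)
    fix a b assume "a \<in> S" "b \<in> S"
    then obtain r s where rs: "r < k" "s < k" "a = e r" "b = e s"
      using e unfolding bij_betw_def by force
    have eq: "a = b \<longleftrightarrow> r = s" using rs e unfolding bij_betw_def by (auto dest: inj_onD)
    have "(\<Sum>c\<in>S. M a c * B c b) = (\<Sum>c\<in>{0..<k}. M a (e c) * B (e c) b)"
      by (rule sum.reindex_bij_betw[OF e, symmetric])
    also have "\<dots> = (\<Sum>c\<in>{0..<k}. d * (?A $$ (r, c) * adj_mat ?A $$ (c, s)))"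
      using rs by (intro sum.cong) (auto simp: B_def inv mult_ac)
    also have "\<dots> = d * (?A * adj_mat ?A) $$ (r, s)"
      using rs adj(1) by (simp add: scalar_prod_def sum_distrib_left del: enum_mat_index)
    also have "\<dots> = (if a = b then 1 else 0)"
      unfolding adj using rs d eq by (auto simp: one_mat_def)
    finally show "(\<Sum>c\<in>S. M a c * B c b) = (if a = b then 1 else 0)" .
  qed
qed

text \<open>
  The Schur form of such a matrix is strictly upper triangular.
\<close>

lemma no_eigenvalue_imp_nilpotent:
  fixes M :: "'s \<Rightarrow> 's \<Rightarrow> complex"
  assumes S: "finite S"
    and ev: "\<And>l h. l \<noteq> 0 \<Longrightarrow> (\<And>a. a \<in> S \<Longrightarrow> (\<Sum>b\<in>S. M a b * h b) = l * h a) \<Longrightarrow> (\<And>a. a \<in> S \<Longrightarrow> h a = 0)"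
    and a: "a \<in> S"
  shows "((\<lambda>h a. \<Sum>b\<in>S. M a b * h b) ^^ card S) h a = 0"
proof -
  define k where "k = card S"
  obtain e where e: "bij_betw e {0..<k} S" using ex_enum[OF S] k_def by blast
  let ?A = "enum_mat k e M"
  let ?v = "\<lambda>h. vec k (\<lambda>r. h (e r))"
  let ?op = "\<lambda>h a. \<Sum>b\<in>S. M a b * h b"
  have "?A ^\<^sub>m k = 0\<^sub>m k k"
  proof (rule pow_eq_0_if_no_nonzero_eigenvalue)
    fix l assume "eigenvalue ?A l"
    then obtain v where v: "v \<in> carrier_vec k" "v \<noteq> 0\<^sub>v k" "?A *\<^sub>v v = l \<cdot>\<^sub>v v"
      by (auto simp: eigenvalue_def eigenvector_def)
    obtain h where h: "v = ?v h" by (rule vec_as_fun[OF e v(1)])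
    show "l = 0"
    proof (rule ccontr)
      assume l: "l \<noteq> 0"
      have z: "(\<Sum>c\<in>S. M (e r) c * h c) = l * h (e r)" if "r < k" for r
        using v(3) that unfolding h enum_mat_mult_vec[OF e] by (auto dest!: arg_cong[where f="\<lambda>x. vec_index x r"])
      have "(\<Sum>c\<in>S. M a c * h c) = l * h a" if "a \<in> S" for a
        using z that e unfolding bij_betw_def by force
      then have "h b = 0" if "b \<in> S" for b using ev[OF l] that by blast
      then have "v = 0\<^sub>v k" unfolding h using e unfolding bij_betw_def by (intro eq_vecI) auto
      with v(2) show False by simp
    qed
  qed simp
  moreover have "?v ((?op ^^ m) h) = ?A ^\<^sub>m m *\<^sub>v ?v h" for m
  proof (induction m arbitrary: h)
    case 0
    then show ?case by simp
  next
    case (Suc m)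
    have "?v ((?op ^^ Suc m) h) = ?v ((?op ^^ m) (?op h))" by (simp only: funpow_Suc_right o_apply)
    also have "\<dots> = ?A ^\<^sub>m m *\<^sub>v (?A *\<^sub>v ?v h)" unfolding Suc enum_mat_mult_vec[OF e] ..
    also have "\<dots> = ?A ^\<^sub>m Suc m *\<^sub>v ?v h"
      by (simp add: assoc_mult_mat_vec[of _ k k _ k])
    finally show ?case .
  qed
  ultimately have "?v ((?op ^^ k) h) = 0\<^sub>v k" by (auto simp: scalar_prod_def)
  moreover obtain r where "r < k" "a = e r" using e a unfolding bij_betw_def by force
  ultimately have "(?op ^^ k) h a = 0" by (auto dest!: arg_cong[where f="\<lambda>x. vec_index x r"])
  then show ?thesis unfolding k_def .
qed

section \<open>Joint nilpotency of tuples of matrices\<close>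

text \<open>
  The product \<open>N\<^sub>w\<close> of the matrices \<open>N i\<close> along a word. Multiplication and unit are arguments because
  the same products are formed over skew power series, whose multiplication is not the one that their
  type carries.
\<close>

primrec gen_word_prod :: "('e \<Rightarrow> 'e \<Rightarrow> 'e) \<Rightarrow> 'e \<Rightarrow> 's set \<Rightarrow> ('l \<Rightarrow> 's \<Rightarrow> 's \<Rightarrow> 'e::comm_monoid_add)
    \<Rightarrow> 'l list \<Rightarrow> 's \<Rightarrow> 's \<Rightarrow> 'e" where
  "gen_word_prod mul u S N [] a b = (if a = b then u else 0)"
| "gen_word_prod mul u S N (i # w) a b = (\<Sum>c\<in>S. mul (N i a c) (gen_word_prod mul u S N w c b))"

abbreviation word_prod :: "'s set \<Rightarrow> ('l \<Rightarrow> 's \<Rightarrow> 's \<Rightarrow> 'e::semiring_1) \<Rightarrow> 'l list \<Rightarrow> 's \<Rightarrow> 's \<Rightarrow> 'e" where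
  "word_prod \<equiv> gen_word_prod (*) 1"

lemma sum_words_Suc:
  fixes f :: "'l::finite list \<Rightarrow> 'a::comm_monoid_add"
  shows "(\<Sum>w | length w = Suc k. f w) = (\<Sum>i\<in>UNIV. \<Sum>w | length w = k. f (i # w))"
proof -
  have "(\<Sum>w | length w = Suc k. f w) = (\<Sum>(i, w)\<in>UNIV \<times> {w. length w = k}. f (i # w))"
    by (rule sum.reindex_bij_witness[of _ "\<lambda>(i, w). i # w" "\<lambda>w. (hd w, tl w)"])
       (auto simp: length_Suc_conv)
  then show ?thesis by (simp add: sum.cartesian_product)
qed

lemma finite_words [simp]: "finite {w :: 'l::finite list. length w = k}"
  using finite_lists_length_eq[of "UNIV :: 'l set" k] by simp

text \<open>
  The linear map \<open>H \<mapsto> \<Sum>\<^sub>i N\<^sub>i\<^sup>* H N\<^sub>i\<close> on matrices, with \<open>*\<close> the adjoint, has \<open>H \<mapsto> \<Sum>\<^sub>w N\<^sub>w\<^sup>* H N\<^sub>w\<close>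
  as its powers, the sum being over the words of one length. It is nilpotent by the assumption, and at
  \<open>H = 1\<close> the terms are positive semidefinite, so that they vanish with their sum.
\<close>

lemma jointly_nilpotent_if_pencil_injective:
  fixes N :: "'l::finite \<Rightarrow> 's \<Rightarrow> 's \<Rightarrow> complex"
  assumes S: "finite S"
    and inj: "\<And>X H. (\<And>a b. a \<in> S \<Longrightarrow> b \<in> S \<Longrightarrow>
          H a b = (\<Sum>i\<in>UNIV. \<Sum>c\<in>S. \<Sum>d\<in>S. X i a c * H c d * N i d b))
        \<Longrightarrow> (\<And>a b. a \<in> S \<Longrightarrow> b \<in> S \<Longrightarrow> H a b = 0)"
    and w: "card S * card S \<le> length w" and ab: "a \<in> S" "b \<in> S"
  shows "word_prod S N w a b = 0"
proof -
  define M where "M = (\<lambda>(a, b) (c, d). \<Sum>i\<in>UNIV. cnj (N i c a) * N i d b)"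
  let ?op = "\<lambda>h x. \<Sum>y\<in>S \<times> S. M x y * h y"
  let ?k = "card S * card S"
  have op: "?op h (a, b) = (\<Sum>i\<in>UNIV. \<Sum>c\<in>S. \<Sum>d\<in>S. cnj (N i c a) * h (c, d) * N i d b)" for h a b
  proof -
    have "?op h (a, b) = (\<Sum>c\<in>S. \<Sum>d\<in>S. \<Sum>i\<in>UNIV. cnj (N i c a) * h (c, d) * N i d b)"
      by (simp add: sum.cartesian_product' M_def sum_distrib_left sum_distrib_right mult_ac)
    also have "\<dots> = (\<Sum>c\<in>S. \<Sum>i\<in>UNIV. \<Sum>d\<in>S. cnj (N i c a) * h (c, d) * N i d b)"
      by (rule sum.cong[OF refl], rule sum.swap)
    also have "\<dots> = (\<Sum>i\<in>UNIV. \<Sum>c\<in>S. \<Sum>d\<in>S. cnj (N i c a) * h (c, d) * N i d b)"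
      by (rule sum.swap)
    finally show ?thesis .
  qed
  \<comment> \<open>An eigenvector for an eigenvalue \<open>l \<noteq> 0\<close> contradicts the assumption for \<open>X\<^sub>i = N\<^sub>i\<^sup>* / l\<close>.\<close>
  have nil: "(?op ^^ card (S \<times> S)) h x = 0" if "x \<in> S \<times> S" for h x
  proof (rule no_eigenvalue_imp_nilpotent)
    fix l and h :: "'s \<times> 's \<Rightarrow> complex" and y
    assume l: "l \<noteq> 0" and h: "\<And>y. y \<in> S \<times> S \<Longrightarrow> ?op h y = l * h y" and y: "y \<in> S \<times> S"
    have "(\<lambda>a b. h (a, b)) (fst y) (snd y) = 0"
    proof (rule inj[of "\<lambda>a b. h (a, b)" "\<lambda>i a c. cnj (N i c a) / l"])
      fix a b assume "a \<in> S" "b \<in> S"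
      then have "l * h (a, b) = ?op h (a, b)" using h by simp
      then have "h (a, b) = ?op h (a, b) / l" using l by (simp add: field_simps)
      then show "h (a, b) = (\<Sum>i\<in>UNIV. \<Sum>c\<in>S. \<Sum>d\<in>S. cnj (N i c a) / l * h (c, d) * N i d b)"
        unfolding op by (simp add: sum_divide_distrib)
    qed (use y in auto)
    then show "h y = 0" by simp
  qed (use S that in auto)
  have iter: "(?op ^^ k) h (a, b)
      = (\<Sum>w | length w = k. \<Sum>c\<in>S. \<Sum>d\<in>S. cnj (word_prod S N w c a) * h (c, d) * word_prod S N w d b)"
    if "a \<in> S" "b \<in> S" for k h a b
  proof (induction k arbitrary: h)
    case 0
    have [simp]: "cnj (if P then 1 else 0) = (if P then 1 else 0)" for P by simp
    have "(\<Sum>c\<in>S. \<Sum>d\<in>S. (if c = a then 1 else 0) * h (c, d) * (if d = b then 1 else 0)) = h (a, b)"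
      using that S by (simp add: if_distrib[of "\<lambda>x. _ * x"] if_distrib[of "\<lambda>x. x * _"] sum.delta' cong: if_cong)
    then show ?case by simp
  next
    case (Suc k)
    let ?W = "word_prod S N"
    let ?F = "\<lambda>w c d i c' d'. cnj (?W w c a) * (cnj (N i c' c) * h (c', d') * N i d' d) * ?W w d b"
    have "(?op ^^ Suc k) h (a, b) = (?op ^^ k) (?op h) (a, b)" by (simp only: funpow_Suc_right o_apply)
    also have "\<dots> = (\<Sum>w | length w = k. \<Sum>c\<in>S. \<Sum>d\<in>S. \<Sum>i\<in>UNIV. \<Sum>c'\<in>S. \<Sum>d'\<in>S. ?F w c d i c' d')"
      unfolding Suc op by (simp add: sum_distrib_left sum_distrib_right mult.assoc)
    also have "\<dots> = (\<Sum>i\<in>UNIV. \<Sum>w | length w = k. \<Sum>c'\<in>S. \<Sum>d'\<in>S. \<Sum>c\<in>S. \<Sum>d\<in>S. ?F w c d i c' d')"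
      unfolding sum.cartesian_product
      by (rule sum.reindex_bij_witness[of _ "\<lambda>(i, w, c', d', c, d). (w, c, d, i, c', d')"
            "\<lambda>(w, c, d, i, c', d'). (i, w, c', d', c, d)"]) auto
    also have "\<dots> = (\<Sum>i\<in>UNIV. \<Sum>w | length w = k. \<Sum>c\<in>S. \<Sum>d\<in>S.
        cnj (?W (i # w) c a) * h (c, d) * ?W (i # w) d b)"
      by (simp add: sum_distrib_left sum_distrib_right mult_ac)
    finally show ?case unfolding sum_words_Suc .
  qed
  \<comment> \<open>The entry at \<open>(b, b)\<close> of \<open>\<Sum>\<^sub>w N\<^sub>w\<^sup>* N\<^sub>w = 0\<close> is the sum of all \<open>\<bar>N\<^sub>w(c, b)\<bar>\<^sup>2\<close>.\<close>
  have base: "word_prod S N w a b = 0" if w: "length w = ?k" and ab: "a \<in> S" "b \<in> S" for w a b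
  proof -
    let ?d = "\<lambda>(c, d). if c = d then 1 else 0 :: complex"
    have "0 = (?op ^^ ?k) ?d (b, b)" using nil[of "(b, b)"] ab by (simp add: card_cartesian_product)
    also have "\<dots> = (\<Sum>w | length w = ?k. \<Sum>c\<in>S. cnj (word_prod S N w c b) * word_prod S N w c b)"
      unfolding iter[OF ab(2) ab(2)]
      using S by (intro sum.cong refl) (simp add: if_distrib[of "\<lambda>x. _ * x"] if_distrib[of "\<lambda>x. x * _"] cong: if_cong)
    also have "\<dots> = of_real (\<Sum>w | length w = ?k. \<Sum>c\<in>S. (cmod (word_prod S N w c b))\<^sup>2)"
      by (simp only: of_real_sum complex_norm_square mult.commute)
    finally have "(\<Sum>w | length w = ?k. \<Sum>c\<in>S. (cmod (word_prod S N w c b))\<^sup>2) = 0"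
      unfolding eq_commute[of "0::complex"] of_real_eq_0_iff .
    then have "(\<Sum>c\<in>S. (cmod (word_prod S N w c b))\<^sup>2) = 0"
      using w by (subst (asm) sum_nonneg_eq_0_iff) (auto intro!: sum_nonneg)
    then show ?thesis
      using ab S by (subst (asm) sum_nonneg_eq_0_iff) auto
  qed
  show ?thesis using w ab
  proof (induction w arbitrary: a)
    case Nil
    then show ?case using base[of "[]" a b] by simp
  next
    case (Cons i w)
    show ?case
    proof (cases "?k \<le> length w")
      case True
      then show ?thesis using Cons by simp
    next
      case False
      then show ?thesis using base[of "i # w" a b] Cons by simp
    qed
  qed
qed

section \<open>Pencils with constant determinant\<close>

lemma dvd_prod_diff:
  fixes f g :: "'i \<Rightarrow> 'a::comm_ring_1"
  assumes "\<And>i. i \<in> A \<Longrightarrow> m dvd f i - g i"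
  shows "m dvd prod f A - prod g A"
  using assms
proof (induction A rule: infinite_finite_induct)
  case (insert x F)
  have "prod f (insert x F) - prod g (insert x F)
      = (f x - g x) * prod f F + g x * (prod f F - prod g F)"
    using insert.hyps by (simp add: algebra_simps)
  then show ?case using insert by (simp add: dvd_mult dvd_mult2)
qed auto

lemma dvd_det_diff:
  fixes A B :: "'a::comm_ring_1 mat"
  assumes A: "A \<in> carrier_mat k k" and B: "B \<in> carrier_mat k k"
    and d: "\<And>i j. i < k \<Longrightarrow> j < k \<Longrightarrow> m dvd A $$ (i, j) - B $$ (i, j)"
  shows "m dvd det A - det B"
proof -
  have "det A - det B = (\<Sum>p | p permutes {0..<k}.
      signof p * ((\<Prod>i = 0..<k. A $$ (i, p i)) - (\<Prod>i = 0..<k. B $$ (i, p i))))"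
    unfolding det_def'[OF A] det_def'[OF B] by (simp add: sum_subtractf right_diff_distrib)
  also have "m dvd \<dots>"
    by (intro dvd_sum dvd_mult dvd_prod_diff d) (auto simp: permutes_in_image[symmetric] intro: permutes_in_image[THEN iffD2])
  finally show ?thesis .
qed

text \<open>
  The determinant of \<open>1 - t N\<close> is a polynomial in \<open>t\<close> with value \<open>1\<close> at \<open>0\<close>. Modulo \<open>t\<^sup>K\<^sup>+\<^sup>1\<close> it
  agrees with the determinant of \<open>P\<close>, which is constant because \<open>P\<close> is invertible over the
  polynomials. As \<open>K\<close> is arbitrary, the determinant of \<open>1 - t N\<close> is \<open>1\<close>, also at \<open>t = 1\<close>.
\<close>

lemma pencil_injective_if_locally_invertible:
  fixes N :: "'s \<Rightarrow> 's \<Rightarrow> complex"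
  assumes S: "finite S"
    and loc: "\<And>K. \<exists>P R G. (\<forall>a\<in>S. \<forall>b\<in>S. (\<Sum>c\<in>S. P a c * R c b) = (if a = b then 1 else 0 :: complex poly)) \<and>
        (\<forall>a\<in>S. \<forall>b\<in>S. P a b = (if a = b then 1 else 0) - [:0, N a b:] + monom 1 (Suc K) * G a b)"
    and h: "\<And>a. a \<in> S \<Longrightarrow> h a = (\<Sum>b\<in>S. N a b * h b)"
    and a: "a \<in> S"
  shows "h a = 0"
proof -
  define k where "k = card S"
  obtain e where e: "bij_betw e {0..<k} S" using ex_enum[OF S] k_def by blast
  have eS: "e r \<in> S" if "r < k" for r using e that unfolding bij_betw_def by auto
  have ee: "e r = e s \<longleftrightarrow> r = s" if "r < k" "s < k" for r s
    using e that unfolding bij_betw_def by (auto dest: inj_onD)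
  define L where "L = (\<lambda>a b. (if a = b then 1 else 0) - [:0, N a b:])"
  define D where "D = det (enum_mat k e L)"
  have D0: "poly D 0 = 1"
  proof -
    have "poly D 0 = det (1\<^sub>m k)"
      unfolding D_def by (rule poly_det_cong[of _ k]) (auto simp: L_def ee)
    then show ?thesis by simp
  qed
  have dvd: "monom 1 (Suc K) dvd D - 1" for K
  proof -
    obtain P R G where PR: "\<And>a b. a \<in> S \<Longrightarrow> b \<in> S \<Longrightarrow> (\<Sum>c\<in>S. P a c * R c b) = (if a = b then 1 else 0 :: complex poly)"
      and PG: "\<And>a b. a \<in> S \<Longrightarrow> b \<in> S \<Longrightarrow> P a b = L a b + monom 1 (Suc K) * G a b"
      using loc[of K] unfolding L_def by blast
    have "enum_mat k e P * enum_mat k e R = 1\<^sub>m k"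
      unfolding enum_mat_mult[OF e] by (rule eq_matI) (auto simp: PR eS ee)
    then have "det (enum_mat k e P * enum_mat k e R) = 1" by simp
    then have "det (enum_mat k e P) * det (enum_mat k e R) = 1"
      by (simp add: det_mult[OF enum_mat_carrier enum_mat_carrier])
    then have "det (enum_mat k e P) dvd 1" by (rule dvdI[OF sym])
    then obtain c where c: "det (enum_mat k e P) = [:c:]" unfolding is_unit_poly_iff by blast
    have "monom 1 (Suc K) dvd det (enum_mat k e P) - D" unfolding D_def
      by (rule dvd_det_diff[where k=k]) (auto simp: PG eS)
    then have m: "monom 1 (Suc K) dvd [:c:] - D" unfolding c .
    then obtain q where "[:c:] - D = monom 1 (Suc K) * q" by (elim dvdE)
    then have "poly ([:c:] - D) 0 = 0" by (simp add: poly_monom)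
    then have "c = 1" using D0 by simp
    then have "[:c:] = 1" by (simp add: one_pCons)
    then show ?thesis using m dvd_minus_iff[of "monom 1 (Suc K)" "D - 1"] by simp
  qed
  have D1: "D = 1"
  proof (rule ccontr)
    assume "D \<noteq> 1"
    then have "D - 1 \<noteq> 0" by simp
    from dvd_imp_degree_le[OF dvd[of "degree (D - 1)"] this] show False by (simp add: degree_monom_eq)
  qed
  let ?A = "enum_mat k e (\<lambda>a b. (if a = b then 1 else 0) - N a b)"
  have "det ?A = poly D 1"
    unfolding D_def by (rule poly_det_cong[of _ k, symmetric]) (auto simp: L_def)
  then have det: "det ?A \<noteq> 0" using D1 by simp
  let ?v = "vec k (\<lambda>r. h (e r))"
  have "(\<Sum>b\<in>S. ((if a = b then 1 else 0) - N a b) * h b) = 0" if "a \<in> S" for a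
    using h[OF that] S that
    by (simp add: left_diff_distrib sum_subtractf if_distrib[of "\<lambda>x. x * _"] cong: if_cong)
  then have "?A *\<^sub>v ?v = 0\<^sub>v k"
    unfolding enum_mat_mult_vec[OF e] by (intro eq_vecI) (auto simp: eS)
  then have v: "?v = 0\<^sub>v k"
    using det det_0_iff_vec_prod_zero_field[of ?A k] vec_carrier[of k "\<lambda>r. h (e r)"] by fastforce
  obtain r where "r < k" "a = e r" using e a unfolding bij_betw_def by force
  then show ?thesis using v by (auto dest!: arg_cong[where f="\<lambda>x. vec_index x r"])
qed

section \<open>Nilpotency over noncommutative valuation rings\<close>

text \<open>
  A ring whose multiplication is a parameter, so that a type with a ring structure of its own can carry
  a second, twisted one.
\<close>

locale twisted_ring =
  fixes ml :: "'e::ab_group_add \<Rightarrow> 'e \<Rightarrow> 'e" (infixl "\<star>" 70) and u :: 'e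
  assumes ml_assoc: "(a \<star> b) \<star> c = a \<star> (b \<star> c)"
    and ml_distl: "a \<star> (b + c) = a \<star> b + a \<star> c"
    and ml_distr: "(a + b) \<star> c = a \<star> c + b \<star> c"
    and ml_ul [simp]: "u \<star> a = a" and ml_ur [simp]: "a \<star> u = a"
begin

lemma ml_0 [simp]: "0 \<star> a = 0" "a \<star> 0 = 0"
proof -
  have "0 \<star> a + 0 \<star> a = 0 + 0 \<star> a" "a \<star> 0 + a \<star> 0 = 0 + a \<star> 0"
    by (simp_all flip: ml_distr[of 0 0] ml_distl[of a 0 0])
  then show "0 \<star> a = 0" "a \<star> 0 = 0" by (simp_all only: add_right_cancel)
qed

lemma ml_minus: "(- a) \<star> b = - (a \<star> b)" "a \<star> (- b) = - (a \<star> b)"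
proof -
  have "a \<star> b + (- a) \<star> b = (a + - a) \<star> b" "a \<star> b + a \<star> (- b) = a \<star> (b + - b)"
    unfolding ml_distr ml_distl by simp_all
  then show "(- a) \<star> b = - (a \<star> b)" "a \<star> (- b) = - (a \<star> b)"
    using minus_unique[of "a \<star> b" "(- a) \<star> b"] minus_unique[of "a \<star> b" "a \<star> (- b)"]
    by simp_all
qed

lemma ml_diff: "(a - b) \<star> c = a \<star> c - b \<star> c" "a \<star> (b - c) = a \<star> b - a \<star> c"
  unfolding diff_conv_add_uminus ml_distr ml_distl ml_minus by (rule refl)+

lemma ml_sum: "sum f A \<star> c = (\<Sum>x\<in>A. f x \<star> c)" "c \<star> sum f A = (\<Sum>x\<in>A. c \<star> f x)"
  by (induction A rule: infinite_finite_induct) (simp_all add: ml_distl ml_distr)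

lemma gen_word_prod_append:
  assumes "finite S" "a \<in> S"
  shows "gen_word_prod ml u S N (v @ w) a b = (\<Sum>c\<in>S. gen_word_prod ml u S N v a c \<star> gen_word_prod ml u S N w c b)"
  using assms(2)
proof (induction v arbitrary: a)
  case Nil
  have "(\<Sum>c\<in>S. (if a = c then u else 0) \<star> gen_word_prod ml u S N w c b)
      = (\<Sum>c\<in>S. if a = c then gen_word_prod ml u S N w c b else 0)"
    by (rule sum.cong) auto
  then show ?case using assms(1) Nil by simp
next
  case (Cons i v)
  have "gen_word_prod ml u S N ((i # v) @ w) a b
      = (\<Sum>d\<in>S. N i a d \<star> (\<Sum>c\<in>S. gen_word_prod ml u S N v d c \<star> gen_word_prod ml u S N w c b))"
    using Cons by simp
  also have "\<dots> = (\<Sum>d\<in>S. \<Sum>c\<in>S. (N i a d \<star> gen_word_prod ml u S N v d c) \<star> gen_word_prod ml u S N w c b)"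
    by (simp add: ml_sum ml_assoc)
  also have "\<dots> = (\<Sum>c\<in>S. \<Sum>d\<in>S. (N i a d \<star> gen_word_prod ml u S N v d c) \<star> gen_word_prod ml u S N w c b)"
    by (rule sum.swap)
  finally show ?case by (simp add: ml_sum)
qed

end

text \<open>
  A right chain domain: its principal right ideals are linearly ordered by inclusion.
\<close>

locale valuation_ring = twisted_ring +
  assumes no_zero_div: "a \<star> b = 0 \<Longrightarrow> a = 0 \<or> b = 0"
    and left_total: "(\<exists>c. b = a \<star> c) \<or> (\<exists>c. a = b \<star> c)"
begin

lemma common_left_factor:
  assumes "finite S" "S \<noteq> {}"
  shows "\<exists>c\<in>S. \<exists>g. \<forall>b\<in>S. f b = f c \<star> g b"
  using assms
proof (induction S rule: finite_ne_induct)
  case (singleton x)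
  show ?case by (intro bexI[of _ x] exI[of _ "\<lambda>_. u"]) auto
next
  case (insert x S)
  then obtain c g where c: "c \<in> S" "\<And>b. b \<in> S \<Longrightarrow> f b = f c \<star> g b" by blast
  show ?case
  proof (cases "\<exists>d. f x = f c \<star> d")
    case True
    then obtain d where d: "f x = f c \<star> d" by blast
    have "f b = f c \<star> (g(x := d)) b" if "b \<in> insert x S" for b
    proof (cases "b = x")
      case True
      show ?thesis unfolding True fun_upd_same by (rule d)
    next
      case False
      then show ?thesis using c(2)[of b] that by simp
    qed
    then have "\<forall>b\<in>insert x S. f b = f c \<star> (g(x := d)) b" by (rule ballI)
    moreover have "c \<in> insert x S" using c(1) by (rule insertI2)
    ultimately show ?thesis by (intro bexI exI)
  next
    case False
    then obtain d where d: "f c = f x \<star> d" using left_total by blast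
    have "f b = f x \<star> (if b = x then u else d \<star> g b)" if "b \<in> insert x S" for b
    proof (cases "b = x")
      case False
      then have "f b = f c \<star> g b" using c that by blast
      also have "\<dots> = f x \<star> (d \<star> g b)" by (subst d) (rule ml_assoc)
      finally show ?thesis using False by simp
    qed simp
    then have "\<forall>b\<in>insert x S. f b = f x \<star> (\<lambda>b. if b = x then u else d \<star> g b) b"
      by (intro ballI)
    then show ?thesis by (intro bexI[OF _ insertI1] exI)
  qed
qed

text \<open>
  Over a field the kernels of a nilpotent tuple form a flag, so that the index is at most the
  dimension. The same induction works here: a nonzero row \<open>\<phi>\<close> that is killed by all \<open>N i\<close> is divided by
  one of its own entries, a common left factor of all others, and the resulting row \<open>\<gamma>\<close> with an entry
  \<open>1\<close> at some index \<open>c\<close> is still killed, as there are no zero divisors. Eliminating \<open>c\<close> reduces the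
  number of rows by one and the index by at most one.
\<close>

lemma nilpotency_index_le_card:
  fixes N :: "'l \<Rightarrow> 's \<Rightarrow> 's \<Rightarrow> 'a"
  assumes "finite S"
    and "\<And>w a b. k \<le> length w \<Longrightarrow> a \<in> S \<Longrightarrow> b \<in> S \<Longrightarrow> gen_word_prod ml u S N w a b = 0"
    and "card S \<le> length w" "a \<in> S" "b \<in> S"
  shows "gen_word_prod ml u S N w a b = 0"
  using assms
proof (induction "card S" arbitrary: S N w a b)
  case 0
  then show ?case by simp
next
  case (Suc n)
  show ?case
  proof (cases "(u :: 'a) = 0")
    case True
    then have "x = 0" for x :: 'a using ml_ul[of x] by simp
    then show ?thesis .
  next
    case u0: False
    let ?W = "gen_word_prod ml u S N"
    note fin = Suc.prems(1)
    define P where "P = (\<lambda>k. \<forall>w a b. k \<le> length w \<longrightarrow> a \<in> S \<longrightarrow> b \<in> S \<longrightarrow> ?W w a b = 0)"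
    have Pk: "P k" unfolding P_def using Suc.prems(2) by blast
    have "\<not> P 0" unfolding P_def using u0 Suc.prems(4)
      by (intro notI) (drule spec[of _ "[]"], drule spec[of _ a], drule spec[of _ a], simp)
    with Pk have "\<exists>l. P (Suc l) \<and> \<not> P l" by (induction k) auto
    then obtain l where l: "P (Suc l)" "\<not> P l" by blast
    \<comment> \<open>A nonzero row of a product of maximal length.\<close>
    obtain w0 r where w0: "l \<le> length w0" "r \<in> S" "\<exists>b\<in>S. ?W w0 r b \<noteq> 0"
      using l(2) unfolding P_def by blast
    define \<phi> where "\<phi> = (\<lambda>b. ?W w0 r b)"
    have \<phi>N: "(\<Sum>b\<in>S. \<phi> b \<star> N i b b') = 0" if "b' \<in> S" for i b'
    proof -
      have "?W (w0 @ [i]) r b' = 0"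
        using l(1) w0 that unfolding P_def by auto
      moreover have "?W (w0 @ [i]) r b' = (\<Sum>b\<in>S. \<phi> b \<star> ?W [i] b b')"
        unfolding \<phi>_def by (rule gen_word_prod_append[OF fin w0(2)])
      moreover have "?W [i] b b' = N i b b'" for b
      proof -
        have "?W [i] b b' = (\<Sum>c\<in>S. if c = b' then N i b c else 0)"
          by (simp, rule sum.cong) auto
        then show ?thesis using fin that by simp
      qed
      ultimately show ?thesis by simp
    qed
    obtain c \<gamma>0 where c: "c \<in> S" and \<gamma>0: "\<And>b. b \<in> S \<Longrightarrow> \<phi> b = \<phi> c \<star> \<gamma>0 b"
      using common_left_factor[OF fin, of \<phi>] w0(2) by blast
    have \<phi>c: "\<phi> c \<noteq> 0"
    proof
      assume z: "\<phi> c = 0"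
      obtain b where b: "b \<in> S" "\<phi> b \<noteq> 0" using w0(3) unfolding \<phi>_def by blast
      from \<gamma>0[OF b(1)] have "\<phi> b = 0 \<star> \<gamma>0 b" unfolding z .
      with b(2) show False by simp
    qed
    define \<gamma> where "\<gamma> = \<gamma>0(c := u)"
    have \<gamma>: "\<phi> b = \<phi> c \<star> \<gamma> b" if "b \<in> S" for b
      using \<gamma>0[OF that] by (cases "b = c") (simp_all add: \<gamma>_def)
    have \<gamma>c: "\<gamma> c = u" unfolding \<gamma>_def by simp
    have \<gamma>N: "(\<Sum>b\<in>S. \<gamma> b \<star> N i b b') = 0" if "b' \<in> S" for i b'
    proof -
      have "\<phi> c \<star> (\<Sum>b\<in>S. \<gamma> b \<star> N i b b') = (\<Sum>b\<in>S. \<phi> b \<star> N i b b')"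
        unfolding ml_sum by (rule sum.cong) (simp_all add: ml_assoc[symmetric] \<gamma>[symmetric])
      then show ?thesis using \<phi>N[OF that] \<phi>c no_zero_div[of "\<phi> c"] by simp
    qed
    let ?S = "S - {c}"
    have splitS: "(\<Sum>b\<in>S. f b) = f c + (\<Sum>b\<in>?S. f b)" for f :: "_ \<Rightarrow> 'a"
      using fin c by (simp add: sum.remove)
    have rowc: "(\<Sum>b\<in>?S. \<gamma> b \<star> N i b b') = - N i c b'" if "b' \<in> S" for i b'
      using \<gamma>N[OF that, of i] unfolding splitS \<gamma>c by (simp add: eq_neg_iff_add_eq_0 add.commute)
    \<comment> \<open>The action on row vectors modulo the multiples of \<open>\<gamma>\<close>, in the coordinates other than \<open>c\<close>.\<close>
    define N' where "N' = (\<lambda>i b b'. N i b b' - N i b c \<star> \<gamma> b')"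
    let ?W' = "gen_word_prod ml u ?S N'"
    have W': "?W' w b b' = ?W w b b' - ?W w b c \<star> \<gamma> b'" if "b \<in> ?S" "b' \<in> ?S" for w b b'
      using that
    proof (induction w arbitrary: b)
      case Nil
      then show ?case by auto
    next
      case (Cons i w)
      let ?X = "\<lambda>d. ?W w d b' - ?W w d c \<star> \<gamma> b'"
      have X: "(\<Sum>d\<in>?S. \<gamma> d \<star> ?X d) = - ?X c" if "w = j # v" for j v
      proof -
        have *: "(\<Sum>d\<in>S. \<gamma> d \<star> ?W (j # v) d x) = 0" for x
        proof -
          have "(\<Sum>d\<in>S. \<gamma> d \<star> ?W (j # v) d x) = (\<Sum>d\<in>S. \<Sum>e\<in>S. (\<gamma> d \<star> N j d e) \<star> ?W v e x)"
            by (simp add: ml_sum ml_assoc)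
          also have "\<dots> = (\<Sum>e\<in>S. (\<Sum>d\<in>S. \<gamma> d \<star> N j d e) \<star> ?W v e x)"
            by (subst sum.swap) (simp add: ml_sum)
          finally show ?thesis using \<gamma>N by simp
        qed
        have "(\<Sum>d\<in>S. \<gamma> d \<star> ?X d) = (\<Sum>d\<in>S. \<gamma> d \<star> ?W w d b') - (\<Sum>d\<in>S. \<gamma> d \<star> ?W w d c) \<star> \<gamma> b'"
          by (simp add: ml_sum ml_diff ml_assoc sum_subtractf)
        then have "(\<Sum>d\<in>S. \<gamma> d \<star> ?X d) = 0" unfolding that * by simp
        then have "?X c + (\<Sum>d\<in>?S. \<gamma> d \<star> ?X d) = 0" unfolding splitS \<gamma>c ml_ul .
        then show ?thesis by (rule minus_unique[symmetric])
      qed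
      have X2: "(\<Sum>d\<in>?S. \<gamma> d \<star> ?X d) = - ?X c"
      proof (cases w)
        case Nil
        have "(\<Sum>d\<in>?S. \<gamma> d \<star> ?X d) = (\<Sum>d\<in>?S. if d = b' then \<gamma> d else 0)"
          unfolding Nil by (rule sum.cong) auto
        also have "\<dots> = \<gamma> b'" using fin Cons.prems by simp
        finally show ?thesis using Nil Cons.prems by auto
      qed (rule X)
      have "?W' (i # w) b b' = (\<Sum>d\<in>?S. N i b d \<star> ?X d) - N i b c \<star> (\<Sum>d\<in>?S. \<gamma> d \<star> ?X d)"
        using Cons.IH Cons.prems(2)
        by (simp add: N'_def ml_diff ml_sum sum_subtractf ml_assoc)
      also have "\<dots> = (\<Sum>d\<in>S. N i b d \<star> ?X d)"
        unfolding X2 splitS[of "\<lambda>d. N i b d \<star> ?X d"] by (simp add: ml_minus ml_diff)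
      finally show ?case by (simp add: ml_diff ml_sum sum_subtractf ml_assoc)
    qed
    have card': "n = card ?S" using Suc.hyps(2) c fin by simp
    have W'0: "?W' w b b' = 0" if "n \<le> length w" "b \<in> ?S" "b' \<in> ?S" for w b b'
    proof (rule Suc.hyps(1)[OF card'])
      fix w :: "'l list" and a b assume "k \<le> length w" "a \<in> ?S" "b \<in> ?S"
      then show "gen_word_prod ml u ?S N' w a b = 0" using W'[of a b w] Suc.prems(2) c by simp
    qed (use fin that card' in auto)
    \<comment> \<open>By induction the rows of a product of \<open>n\<close> factors, except the one with index \<open>c\<close>, are multiples
        of \<open>\<gamma>\<close>, and one more factor kills them. As \<open>\<gamma>\<close> is killed, the remaining row is a combination of
        the others.\<close>
    have row: "?W w b b' = ?W w b c \<star> \<gamma> b'" if "n \<le> length w" "b \<in> ?S" "b' \<in> S" for w b b'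
    proof (cases "b' = c")
      case False
      then show ?thesis using W'0[of w b b'] W'[of b b' w] that by simp
    qed (simp add: \<gamma>c)
    have app: "?W (v @ [i]) b b' = (\<Sum>d\<in>S. ?W v b d \<star> N i d b')" if "b \<in> S" "b' \<in> S" for v i b b'
    proof -
      have "?W (v @ [i]) b b' = (\<Sum>d\<in>S. ?W v b d \<star> ?W [i] d b')"
        by (rule gen_word_prod_append[OF fin that(1)])
      moreover have "?W [i] d b' = N i d b'" for d
      proof -
        have "?W [i] d b' = (\<Sum>c\<in>S. if c = b' then N i d c else 0)"
          by (simp, rule sum.cong) auto
        then show ?thesis using fin that by simp
      qed
      ultimately show ?thesis by simp
    qed
    have other: "?W w b b' = 0" if w: "Suc n \<le> length w" and b: "b \<in> ?S" "b' \<in> S" for w b b'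
    proof -
      obtain v i where v: "w = v @ [i]" using w by (cases w rule: rev_cases) auto
      have "?W w b b' = (\<Sum>d\<in>S. ?W v b c \<star> (\<gamma> d \<star> N i d b'))"
      proof -
        have "?W v b d \<star> N i d b' = ?W v b c \<star> (\<gamma> d \<star> N i d b')" if "d \<in> S" for d
        proof -
          have "?W v b d = ?W v b c \<star> \<gamma> d" by (rule row) (use b w v that in auto)
          then show ?thesis by (simp only: ml_assoc)
        qed
        then show ?thesis unfolding v using b by (subst app) (auto intro!: sum.cong)
      qed
      then show ?thesis using \<gamma>N[OF b(2)] by (simp flip: ml_sum)
    qed
    show ?thesis
    proof (cases "a = c")
      case False
      then show ?thesis using other[of w a b] Suc.prems Suc.hyps(2) by simp
    next
      case True
      obtain i v where w: "w = i # v" using Suc.prems(3) Suc.hyps(2) by (cases w) auto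
      have "?W w c b = - (\<Sum>d\<in>S. (\<Sum>e\<in>?S. \<gamma> e \<star> N i e d) \<star> ?W v d b)"
        unfolding w using rowc by (simp add: ml_minus sum_negf)
      also have "\<dots> = - (\<Sum>e\<in>?S. \<gamma> e \<star> ?W w e b)"
        unfolding w by (simp add: ml_sum ml_assoc, subst sum.swap, simp)
      also have "\<dots> = 0"
        using other[of w _ b] Suc.prems Suc.hyps(2) by simp
      finally show ?thesis using True by simp
    qed
  qed
qed

end

section \<open>Skew power series\<close>

text \<open>
  The \<open>k\<close>-th power of the automorphism \<open>f(s) \<mapsto> f(q s)\<close> of the field of Laurent series in \<open>s\<close>.
\<close>

definition qshift :: "complex \<Rightarrow> nat \<Rightarrow> complex fls \<Rightarrow> complex fls" where
  "qshift q k f = fls_compose_fps f (fps_const (q ^ k) * fps_X)"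

text \<open>
  Multiplication of power series in \<open>t\<close> with coefficients on the left of \<open>t\<close>, under the rule
  \<open>t f(s) = f(q s) t\<close>.
\<close>

definition skew_mult :: "complex \<Rightarrow> complex fls fps \<Rightarrow> complex fls fps \<Rightarrow> complex fls fps" where
  "skew_mult q f g = Abs_fps (\<lambda>n. \<Sum>j=0..n. fps_nth f j * qshift q j (fps_nth g (n - j)))"

locale skew =
  fixes q :: complex
  assumes q0: "q \<noteq> 0"
begin

lemma nth_qshift: "fls_nth (qshift q k f) n = fls_nth f n * (q ^ k) powi n"
  unfolding qshift_def by (rule fls_nth_fls_compose_fps_linear) (use q0 in simp)

lemma qshift_0 [simp]: "qshift q k 0 = 0"
  by (simp add: qshift_def)

lemma qshift_1 [simp]: "qshift q k 1 = 1"
  by (simp add: qshift_def)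

lemma qshift_id [simp]: "qshift q 0 f = f"
  by (rule fls_eqI) (simp add: nth_qshift)

lemma qshift_add: "qshift q k (f + g) = qshift q k f + qshift q k g"
  by (rule fls_eqI) (simp add: nth_qshift algebra_simps)

lemma qshift_sum: "qshift q k (sum f A) = (\<Sum>x\<in>A. qshift q k (f x))"
  by (induction A rule: infinite_finite_induct) (simp_all add: qshift_add)

lemma qshift_mult: "qshift q k (f * g) = qshift q k f * qshift q k g"
  unfolding qshift_def by (rule fls_compose_fps_mult) (use q0 in simp_all)

lemma qshift_qshift: "qshift q j (qshift q k f) = qshift q (j + k) f"
  by (rule fls_eqI) (simp add: nth_qshift power_add power_int_mult_distrib)

lemma qshift_eq_0 [simp]: "qshift q k f = 0 \<longleftrightarrow> f = 0"
proof
  assume *: "qshift q k f = 0"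
  have "fls_nth f n * (q ^ k) powi n = 0" for n using nth_qshift[of k f n] * by simp
  then show "f = 0" using q0 by (intro fls_eqI) auto
qed simp

lemma qshift_surj: "\<exists>h. qshift q k h = f"
proof
  show "qshift q k (fls_compose_fps f (fps_const (inverse (q ^ k)) * fps_X)) = f"
    by (rule fls_eqI)
       (use q0 in \<open>simp add: nth_qshift fls_nth_fls_compose_fps_linear power_int_inverse\<close>)
qed

abbreviation sm :: "complex fls fps \<Rightarrow> complex fls fps \<Rightarrow> complex fls fps" (infixl "\<star>" 70) where
  "f \<star> g \<equiv> skew_mult q f g"

lemma nth_skew_mult: "fps_nth (f \<star> g) n = (\<Sum>j=0..n. fps_nth f j * qshift q j (fps_nth g (n - j)))"
  by (simp add: skew_mult_def)

sublocale twisted_ring "skew_mult q" 1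
proof
  fix f g h :: "complex fls fps"
  show "(f \<star> g) \<star> h = f \<star> (g \<star> h)"
  proof (rule fps_ext)
    fix n
    have "fps_nth ((f \<star> g) \<star> h) n = (\<Sum>j=0..n. \<Sum>i=0..j. fps_nth f i *
        qshift q i (fps_nth g (j - i)) * qshift q (i + (j - i)) (fps_nth h (n - j)))"
      by (simp add: nth_skew_mult sum_distrib_right)
    also have "\<dots> = (\<Sum>j=0..n. \<Sum>i=0..n - j. fps_nth f j *
        qshift q j (fps_nth g i) * qshift q (j + i) (fps_nth h (n - j - i)))"
      by (rule fps_mult_assoc_lemma)
    also have "\<dots> = fps_nth (f \<star> (g \<star> h)) n"
      by (simp add: nth_skew_mult qshift_sum qshift_mult qshift_qshift sum_distrib_left mult.assoc)
    finally show "fps_nth ((f \<star> g) \<star> h) n = fps_nth (f \<star> (g \<star> h)) n" .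
  qed
  show "f \<star> (g + h) = f \<star> g + f \<star> h"
    by (rule fps_ext) (simp add: nth_skew_mult qshift_add distrib_left sum.distrib)
  show "(f + g) \<star> h = f \<star> h + g \<star> h"
    by (rule fps_ext) (simp add: nth_skew_mult distrib_right sum.distrib)
  show "1 \<star> f = f"
  proof (rule fps_ext)
    fix n
    have "fps_nth (1 \<star> f) n = (\<Sum>j=0..n. if j = 0 then fps_nth f n else 0)"
      unfolding nth_skew_mult by (rule sum.cong) auto
    then show "fps_nth (1 \<star> f) n = fps_nth f n" by simp
  qed
  show "f \<star> 1 = f"
  proof (rule fps_ext)
    fix n
    have "fps_nth (f \<star> 1) n = (\<Sum>j=0..n. if j = n then fps_nth f n else 0)"
      unfolding nth_skew_mult by (rule sum.cong) auto
    then show "fps_nth (f \<star> 1) n = fps_nth f n" by simp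
  qed
qed

text \<open>
  The coefficients of the quotient \<open>h\<close> are found one after the other, because the leading coefficient
  of \<open>f\<close> lies in a field and the twist is surjective. So divisibility only depends on the orders of
  vanishing in \<open>t\<close>.
\<close>

lemma skew_divide:
  assumes f: "f \<noteq> 0" and fg: "\<And>n. n < subdegree f \<Longrightarrow> fps_nth g n = 0"
  shows "\<exists>h. g = f \<star> h"
proof -
  define k where "k = subdegree f"
  have fk: "fps_nth f k \<noteq> 0" unfolding k_def using f by (rule nth_subdegree_nonzero)
  have ex: "\<exists>y. fps_nth f k * qshift q k y = z" for z
  proof -
    obtain y where "qshift q k y = z / fps_nth f k" using qshift_surj by blast
    then show ?thesis using fk by (intro exI[of _ y]) simp
  qed
  \<comment> \<open>The equation that the coefficient of \<open>t\<^sup>k\<^sup>+\<^sup>i\<close> in \<open>f \<star> h\<close> imposes on the \<open>i\<close>-th coefficient of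
      \<open>h\<close>; it involves the earlier ones only.\<close>
  define step where "step = (\<lambda>h i. SOME y. fps_nth f k * qshift q k y =
    fps_nth g (k + i) - (\<Sum>j\<in>{Suc k..k + i}. fps_nth f j * qshift q j (h (k + i - j))))"
  have step_cong: "step h i = step h' i" if "\<And>j. j < i \<Longrightarrow> h j = h' j" for h h' i
  proof -
    have "(\<Sum>j\<in>{Suc k..k + i}. fps_nth f j * qshift q j (h (k + i - j)))
        = (\<Sum>j\<in>{Suc k..k + i}. fps_nth f j * qshift q j (h' (k + i - j)))"
      by (rule sum.cong) (use that in auto)
    then show ?thesis unfolding step_def by simp
  qed
  define h where "h = wfrec less_than step"
  have h: "h i = step h i" for i
    unfolding h_def by (subst wfrec[OF wf_less_than], rule step_cong) (simp add: cut_def)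
  have hk: "fps_nth f k * qshift q k (h i) =
    fps_nth g (k + i) - (\<Sum>j\<in>{Suc k..k + i}. fps_nth f j * qshift q j (h (k + i - j)))" for i
    unfolding h[of i] unfolding step_def by (rule someI_ex[OF ex])
  have f0: "fps_nth f j = 0" if "j < k" for j
    using that unfolding k_def by (rule nth_less_subdegree_zero)
  have "g = f \<star> Abs_fps h"
  proof (rule fps_ext)
    fix n
    show "fps_nth g n = fps_nth (f \<star> Abs_fps h) n"
    proof (cases "n < k")
      case True
      have "(\<Sum>j=0..n. fps_nth f j * qshift q j (h (n - j))) = 0"
        by (rule sum.neutral) (use True f0 in simp)
      then show ?thesis using fg[of n] True unfolding k_def[symmetric] by (simp add: nth_skew_mult)
    next
      case False
      then obtain i where n: "n = k + i" using le_Suc_ex by (auto simp: not_less)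
      have "(\<Sum>j=0..n. fps_nth f j * qshift q j (h (n - j)))
          = (\<Sum>j\<in>{k..k + i}. fps_nth f j * qshift q j (h (n - j)))"
        by (rule sum.mono_neutral_right) (use f0 in \<open>auto simp: n not_le\<close>)
      also have "\<dots> = fps_nth g n"
        using hk[of i] by (simp add: sum.atLeast_Suc_atMost n)
      finally show ?thesis by (simp add: nth_skew_mult)
    qed
  qed
  then show ?thesis by blast
qed

sublocale valuation_ring "skew_mult q" 1
proof
  fix f g :: "complex fls fps"
  show "(\<exists>c. g = f \<star> c) \<or> (\<exists>c. f = g \<star> c)"
  proof (cases "f = 0 \<or> g = 0")
    case True
    then have "g = f \<star> 0 \<or> f = g \<star> 0" by (auto simp: ml_0)
    then show ?thesis by blast
  next
    case False
    show ?thesis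
    proof (cases "subdegree f \<le> subdegree g")
      case True
      have "fps_nth g n = 0" if "n < subdegree f" for n
        by (rule nth_less_subdegree_zero) (use True that in linarith)
      then show ?thesis using skew_divide[of f g] False by blast
    next
      case le: False
      have "fps_nth f n = 0" if "n < subdegree g" for n
        by (rule nth_less_subdegree_zero) (use le that in linarith)
      then show ?thesis using skew_divide[of g f] False by blast
    qed
  qed
  assume *: "f \<star> g = 0"
  show "f = 0 \<or> g = 0"
  proof (rule ccontr)
    assume "\<not> ?thesis"
    then have nz: "f \<noteq> 0" "g \<noteq> 0" by auto
    define k l where "k = subdegree f" and "l = subdegree g"
    have f0: "fps_nth f j = 0" if "j < k" for j
      using that unfolding k_def by (rule nth_less_subdegree_zero)
    have g0: "fps_nth g j = 0" if "j < l" for j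
      using that unfolding l_def by (rule nth_less_subdegree_zero)
    have "fps_nth (f \<star> g) (k + l) = (\<Sum>j=0..k + l. if j = k then fps_nth f k * qshift q k (fps_nth g l) else 0)"
      unfolding nth_skew_mult
    proof (rule sum.cong[OF refl])
      fix j assume "j \<in> {0..k + l}"
      then show "fps_nth f j * qshift q j (fps_nth g (k + l - j)) =
          (if j = k then fps_nth f k * qshift q k (fps_nth g l) else 0)"
        by (cases j k rule: linorder_cases) (simp_all add: f0 g0)
    qed
    then have "fps_nth f k * qshift q k (fps_nth g l) = 0" using * by simp
    then show False using nz by (simp add: k_def l_def)
  qed
qed

end

section \<open>Specialising the free algebra to skew power series\<close>

text \<open>
  The polynomial \<open>f\<^sub>i(s) f\<^sub>j(q s) f\<^sub>k(q\<^sup>2 s) \<dots>\<close> for a word \<open>i j k \<dots>\<close>; together with a power of \<open>t\<close> this is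
  the image of the word under \<open>x\<^sub>i \<mapsto> f\<^sub>i(s) t\<close>. \<open>skew_hom\<close> extends that map to the free algebra.
\<close>

primrec shift_word :: "complex \<Rightarrow> ('v \<Rightarrow> complex poly) \<Rightarrow> 'v list \<Rightarrow> complex poly" where
  "shift_word q f [] = 1"
| "shift_word q f (i # w) = f i * pcompose (shift_word q f w) [:0, q:]"

definition skew_coeff :: "complex \<Rightarrow> ('v \<Rightarrow> complex poly) \<Rightarrow> 'v fpoly \<Rightarrow> nat \<Rightarrow> complex poly" where
  "skew_coeff q f a n = (\<Sum>w\<in>Poly_Mapping.keys a.
     (if length (letters w) = n then smult (Poly_Mapping.lookup a w) (shift_word q f (letters w)) else 0))"

lemma skew_coeff_add: "skew_coeff q f (a + b) n = skew_coeff q f a n + skew_coeff q f b n"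
  unfolding skew_coeff_def
  by (rule setsum_keys_plus_distrib[of "\<lambda>w c. if length (letters w) = n then smult c (shift_word q f (letters w)) else 0"])
     (auto simp: smult_add_left)

lemma skew_coeff_single:
  "skew_coeff q f (Poly_Mapping.single w c) n =
     (if length (letters w) = n then smult c (shift_word q f (letters w)) else 0)"
  by (cases "c = 0") (simp_all add: skew_coeff_def)

definition skew_hom :: "complex \<Rightarrow> ('v \<Rightarrow> complex poly) \<Rightarrow> 'v fpoly \<Rightarrow> complex fls fps" where
  "skew_hom q f a = Abs_fps (\<lambda>n. fps_to_fls (fps_of_poly (skew_coeff q f a n)))"

lemma skew_hom_add: "skew_hom q f (a + b) = skew_hom q f a + skew_hom q f b"
  by (rule fps_ext) (simp add: skew_hom_def skew_coeff_add fps_of_poly_add)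

lemma skew_hom_0 [simp]: "skew_hom q f 0 = 0"
  by (rule fps_ext) (simp add: skew_hom_def skew_coeff_def)

lemma skew_hom_1 [simp]: "skew_hom q f 1 = 1"
proof (rule fps_ext)
  fix n
  have "skew_coeff q f 1 n = (if n = 0 then 1 else 0)"
    using skew_coeff_single[of q f 0 1 n] by simp
  then show "fps_nth (skew_hom q f 1) n = fps_nth 1 n" by (simp add: skew_hom_def)
qed

lemma skew_hom_sum: "skew_hom q f (sum g A) = (\<Sum>x\<in>A. skew_hom q f (g x))"
  by (induction A rule: infinite_finite_induct) (simp_all add: skew_hom_add)

lemma shift_word_append:
  "shift_word q f (u @ v) = shift_word q f u * pcompose (shift_word q f v) [:0, q ^ length u:]"
proof (induction u)
  case Nil
  then show ?case by (simp add: pcompose_idR)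
next
  case (Cons i u)
  have "pcompose [:0, q ^ length u:] [:0, q:] = [:0, q ^ Suc (length u):]"
    by (simp add: pcompose_pCons mult.commute)
  then show ?case using Cons
    by (simp add: pcompose_mult pcompose_assoc[symmetric] mult.assoc mult.commute[of _ q])
qed

lemma (in skew) qshift_poly:
  "qshift q k (fps_to_fls (fps_of_poly p)) = fps_to_fls (fps_of_poly (pcompose p [:0, q ^ k:]))"
  using q0 by (simp add: qshift_def fps_of_poly_pcompose fps_of_poly_pCons fps_of_poly_linear)

lemma (in skew) skew_hom_mult:
  "skew_hom q f (a * b) = skew_mult q (skew_hom q f a) (skew_hom q f b)"
proof (induction a rule: fpoly_induct)
  case (single u c)
  show ?case
  proof (induction b rule: fpoly_induct)
    case (single v d)
    show ?case
    proof (rule fps_ext)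
      fix n
      let ?P = "\<lambda>p. fps_to_fls (fps_of_poly p)"
      let ?l = "length (letters u)" and ?m = "length (letters v)"
      let ?g = "skew_coeff q f (Poly_Mapping.single v d)"
      have "fps_nth (skew_mult q (skew_hom q f (Poly_Mapping.single u c)) (skew_hom q f (Poly_Mapping.single v d))) n
         = (\<Sum>j=0..n. if ?l = j then ?P (smult c (shift_word q f (letters u)) * pcompose (?g (n - j)) [:0, q ^ j:]) else 0)"
        unfolding nth_skew_mult
        by (rule sum.cong) (auto simp: skew_hom_def qshift_poly skew_coeff_single[of q f u]
            fls_times_fps_to_fls[symmetric] fps_of_poly_mult[symmetric] simp del: mult_smult_left)
      also have "\<dots> = (if ?l \<le> n then ?P (smult c (shift_word q f (letters u)) * pcompose (?g (n - ?l)) [:0, q ^ ?l:]) else 0)"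
        by (subst sum.delta') auto
      also have "\<dots> = ?P (skew_coeff q f (Poly_Mapping.single u c * Poly_Mapping.single v d) n)"
        by (auto simp: mult_single skew_coeff_single shift_word_append pcompose_smult mult_ac)
      finally show "fps_nth (skew_hom q f (Poly_Mapping.single u c * Poly_Mapping.single v d)) n = fps_nth
          (skew_mult q (skew_hom q f (Poly_Mapping.single u c)) (skew_hom q f (Poly_Mapping.single v d))) n"
        by (simp add: skew_hom_def)
    qed
  next
    case (sum p q)
    then show ?case by (simp add: skew_hom_add distrib_left ml_distl)
  qed
next
  case (sum p q)
  then show ?case by (simp add: skew_hom_add distrib_right ml_distr)
qed

lemma (in skew) skew_hom_wprod:
  "gen_word_prod (skew_mult q) 1 S (\<lambda>i a b. skew_hom q f (N i a b)) w a b = skew_hom q f (word_prod S N w a b)"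
  by (induction w arbitrary: a) (simp_all add: skew_hom_sum skew_hom_mult)

text \<open>
  When \<open>q\<^sup>m = 1\<close>, the relation \<open>t f(s) = f(q s) t\<close> is satisfied by the cyclic shift and a diagonal
  matrix of size \<open>m\<close>, up to the scalar \<open>t\<close>. In this way the skew series are reached by matrices.
\<close>

definition weighted_shift :: "nat \<Rightarrow> complex \<Rightarrow> ('v \<Rightarrow> complex poly) \<Rightarrow> complex \<Rightarrow> complex \<Rightarrow> 'v \<Rightarrow> complex mat" where
  "weighted_shift m q f s t i = mat m m (\<lambda>(r, c). if c = Suc r mod m then t * poly (f i) (q ^ r * s) else 0)"

lemma weighted_shift_tuple: "weighted_shift m q f s t \<in> mat_tuples m"
  by (simp add: mat_tuples_def weighted_shift_def)

lemma word_eval_weighted_shift: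
  assumes q: "q ^ m = 1" and rc: "r < m" "c < m"
  shows "word_eval m (weighted_shift m q f s t) w $$ (r, c) =
    (if c = (r + length w) mod m then t ^ length w * poly (shift_word q f w) (q ^ r * s) else 0)"
  using rc
proof (induction w arbitrary: r)
  case Nil
  then show ?case by auto
next
  case (Cons i w)
  let ?W = "word_eval m (weighted_shift m q f s t) w"
  have W: "?W \<in> carrier_mat m m" by (rule word_eval_carrier[OF weighted_shift_tuple])
  let ?r = "Suc r mod m"
  have r': "?r < m" using Cons.prems by simp
  have qr: "q ^ ?r = q ^ Suc r"
  proof -
    have "q ^ Suc r = q ^ (m * (Suc r div m) + ?r)" by simp
    also have "\<dots> = q ^ ?r" unfolding power_add power_mult q by simp
    finally show ?thesis by simp
  qed
  have "word_eval m (weighted_shift m q f s t) (i # w) $$ (r, c)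
      = (\<Sum>d\<in>{0..<m}. (if d = ?r then t * poly (f i) (q ^ r * s) else 0) * ?W $$ (d, c))"
    using Cons.prems W by (simp add: scalar_prod_def weighted_shift_def)
  also have "\<dots> = (\<Sum>d\<in>{0..<m}. if d = ?r then t * poly (f i) (q ^ r * s) * ?W $$ (?r, c) else 0)"
    by (rule sum.cong) auto
  also have "\<dots> = t * poly (f i) (q ^ r * s) * ?W $$ (?r, c)"
    using r' by simp
  also have "\<dots> = (if c = (?r + length w) mod m then t ^ Suc (length w) *
       (poly (f i) (q ^ r * s) * poly (shift_word q f w) (q ^ Suc r * s)) else 0)"
    unfolding Cons.IH[OF r' Cons.prems(2)] qr by simp
  also have "(?r + length w) mod m = (r + length (i # w)) mod m"
    by (simp add: mod_simps)
  finally show ?case by (simp add: poly_pcompose mult_ac)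
qed

text \<open>
  The entries in the first row of the value at weighted shifts collect the words by their length modulo
  \<open>m\<close>; as polynomials in the free parameter \<open>t\<close> they also separate the lengths.
\<close>

lemma skew_hom_eq_0_if_vanishing:
  assumes q: "q ^ m = 1" and m: "m \<ge> 1"
    and van: "\<And>Z. Z \<in> mat_tuples m \<Longrightarrow> fpoly_eval m Z a = 0\<^sub>m m m"
  shows "skew_hom q f a = 0"
proof -
  have "skew_coeff q f a n = 0" for n
  proof (rule poly_eq_poly_eq_iff[THEN iffD1], rule ext)
    fix s
    define R where "R = (\<Sum>w\<in>Poly_Mapping.keys a. if length (letters w) mod m = n mod m then
       monom (Poly_Mapping.lookup a w * poly (shift_word q f (letters w)) s) (length (letters w)) else 0)"
    have "poly R t = 0" for t
    proof -
      have "0 = fpoly_eval m (weighted_shift m q f s t) a $$ (0, n mod m)"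
        using van[OF weighted_shift_tuple] m by simp
      also have "\<dots> = poly R t"
        using m unfolding fpoly_eval_def R_def
        by (auto simp: word_eval_weighted_shift[OF q] poly_sum poly_monom intro!: sum.cong)
      finally show ?thesis by simp
    qed
    then have "R = 0" using poly_all_0_iff_0 by blast
    then have "0 = coeff R n" by simp
    also have "\<dots> = poly (skew_coeff q f a n) s"
      unfolding R_def skew_coeff_def coeff_sum poly_sum by (rule sum.cong) (auto simp: coeff_monom)
    finally show "poly (skew_coeff q f a n) s = poly 0 s" by simp
  qed
  then show ?thesis by (intro fps_ext) (simp add: skew_hom_def)
qed

lemma poly_shift_word:
  "poly (shift_word q f w) s = (\<Prod>k<length w. poly (f (w ! k)) (q ^ k * s))"
proof (induction w arbitrary: s)
  case (Cons i w)
  have "poly (shift_word q f (i # w)) s = poly (f i) s * (\<Prod>k<length w. poly (f (w ! k)) (q ^ k * (q * s)))"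
    using Cons[of "q * s"] by (simp add: poly_pcompose mult.commute)
  then show ?case by (simp add: prod.lessThan_Suc_shift mult_ac del: prod.lessThan_Suc)
qed simp

text \<open>
  For a word \<open>w\<close> of \<open>a\<close>, of length \<open>n\<close>, the polynomials \<open>f\<^sub>i\<close> can be chosen such that among all words of
  length \<open>n\<close> only \<open>w\<close> contributes at \<open>s = 1\<close>: \<open>f\<^sub>i\<close> vanishes at exactly those \<open>q\<^sup>k\<close> with \<open>k < n\<close> for
  which the \<open>k\<close>-th letter of \<open>w\<close> is not \<open>i\<close>. This requires that \<open>q\<^sup>0, \<dots>, q\<^sup>n\<^sup>-\<^sup>1\<close> are distinct.
\<close>

lemma ex_skew_hom_neq_0:
  fixes a :: "'v fpoly"
  assumes "a \<noteq> 0"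
  shows "\<exists>m q f. m \<ge> 1 \<and> q ^ m = 1 \<and> q \<noteq> 0 \<and> skew_hom q f a \<noteq> 0"
proof -
  obtain v where v: "v \<in> Poly_Mapping.keys a" using assms by fastforce
  define w n m q where "w = letters v" and "n = length w" and "m = Suc n" and "q = cis (2 * pi / real m)"
  have "real m * (2 * pi / real m) = 2 * pi" by (simp add: m_def)
  then have qm: "q ^ m = 1" by (simp only: q_def DeMoivre cis_2pi)
  have "inj_on (\<lambda>k. cis (2 * pi * real k / real m)) {..<m}"
    using bij_betw_roots_unity[of m] by (auto simp: bij_betw_def m_def)
  moreover have "cis (2 * pi * real k / real m) = q ^ k" for k
    by (simp add: q_def DeMoivre mult_ac)
  ultimately have inj: "inj_on (\<lambda>k. q ^ k) {..<m}" by simp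
  define f :: "'v \<Rightarrow> complex poly" where "f i = (\<Prod>k | k < n \<and> w ! k \<noteq> i. [:- (q ^ k), 1:])" for i
  have q_inj: "q ^ j = q ^ k \<longleftrightarrow> j = k" if "j < n" "k < n" for j k
    using inj_on_eq_iff[OF inj, of j k] that by (simp add: m_def)
  have f0: "poly (f i) (q ^ k) = 0 \<longleftrightarrow> w ! k \<noteq> i" if "k < n" for i k
    using that unfolding f_def by (auto simp: poly_prod q_inj)
  have sw: "poly (shift_word q f w') 1 = 0" if "length w' = n" "w' \<noteq> w" for w'
  proof -
    have "\<not> (\<forall>k<n. w' ! k = w ! k)"
    proof
      assume "\<forall>k<n. w' ! k = w ! k"
      then have "w' = w" using that(1) n_def by (intro nth_equalityI) simp_all
      with that(2) show False by contradiction
    qed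
    then obtain k where k: "k < n" "w' ! k \<noteq> w ! k" by blast
    have "poly (f (w' ! k)) (q ^ k * 1) = 0" using f0[OF k(1), of "w' ! k"] k(2) by simp
    then show ?thesis unfolding poly_shift_word using k(1) that(1) by (intro prod_zero) auto
  qed
  have sw1: "poly (shift_word q f w) 1 \<noteq> 0"
    unfolding poly_shift_word using f0 by (auto simp: n_def)
  have "poly (skew_coeff q f a n) 1 = (\<Sum>x\<in>Poly_Mapping.keys a.
      if x = v then Poly_Mapping.lookup a v * poly (shift_word q f w) 1 else 0)"
    unfolding skew_coeff_def poly_sum
  proof (rule sum.cong[OF refl])
    fix x assume "x \<in> Poly_Mapping.keys a"
    show "poly (if length (letters x) = n then smult (Poly_Mapping.lookup a x) (shift_word q f (letters x)) else 0) 1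
      = (if x = v then Poly_Mapping.lookup a v * poly (shift_word q f w) 1 else 0)"
      using sw[of "letters x"] by (cases "x = v") (auto simp: w_def n_def dest: fword.expand)
  qed
  then have "poly (skew_coeff q f a n) 1 \<noteq> 0" using v sw1 by (simp add: in_keys_iff)
  then have "skew_coeff q f a n \<noteq> 0" by auto
  then have "fps_nth (skew_hom q f a) n \<noteq> 0" by (simp add: skew_hom_def)
  then have "skew_hom q f a \<noteq> 0" by auto
  moreover have "m \<ge> 1" by (simp add: m_def)
  moreover have "q \<noteq> 0" by (simp add: q_def)
  ultimately show ?thesis using qm by blast
qed

lemma fpoly_eq_0_if_vanishing:
  assumes "\<And>n X. n \<ge> 1 \<Longrightarrow> X \<in> mat_tuples n \<Longrightarrow> fpoly_eval n X a = 0\<^sub>m n n"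
  shows "a = 0"
  using ex_skew_hom_neq_0[of a] skew_hom_eq_0_if_vanishing[where a=a] assms by metis

section \<open>Substitution and evaluation in the free algebra\<close>

lemma enum_surjD:
  fixes e :: "nat \<Rightarrow> 's"
  assumes "bij_betw e {0..<n} S" "x \<in> S"
  obtains r where "r < n" "x = e r"
  using assms bij_betw_imp_surj_on[OF assms(1)] by (metis atLeastLessThan_iff imageE)

lemma enum_in: fixes e :: "nat \<Rightarrow> 's" shows "bij_betw e {0..<n} S \<Longrightarrow> r < n \<Longrightarrow> e r \<in> S"
  using bij_betw_apply[of e "{0..<n}" S r] by simp

lemma single_FWord: "Poly_Mapping.single (FWord w) c = fconst c * prod_list (map fvar w)"
proof (induction w arbitrary: c)
  case Nil
  then show ?case by (simp add: fconst_def zero_fword_def)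
next
  case (Cons i w)
  have "fvar i * Poly_Mapping.single (FWord w) 1 = Poly_Mapping.single (FWord (i # w)) 1"
    by (simp add: fvar_def mult_single plus_fword_def)
  moreover have "fconst c * Poly_Mapping.single (FWord (i # w)) 1 = Poly_Mapping.single (FWord (i # w)) c"
    by (simp add: fconst_def mult_single)
  ultimately show ?case using Cons[of 1] by simp
qed

lemma fpoly_word_induct [case_names add scale one var]:
  fixes p :: "'v fpoly"
  assumes add: "\<And>p q. P p \<Longrightarrow> P q \<Longrightarrow> P (p + q)"
    and scale: "\<And>c p. P p \<Longrightarrow> P (fconst c * p)"
    and one: "P 1"
    and var: "\<And>v p. P p \<Longrightarrow> P (fvar v * p)"
  shows "P p"
proof (induction p rule: fpoly_induct)
  case (single k c)
  have "P (prod_list (map fvar w))" for w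
    by (induction w) (auto intro: one var)
  then show ?case using single_FWord[of "letters k" c] by (simp add: scale)
next
  case (sum p q)
  then show ?case by (rule add)
qed

lemma fsubst_1 [simp]: "fsubst q 1 = 1"
  using fsubst_fconst[of q 1] by simp

lemma fsubst_0 [simp]: "fsubst q 0 = 0"
  using fsubst_fconst[of q 0] by simp

lemma fsubst_sum: "fsubst q (sum f A) = (\<Sum>x\<in>A. fsubst q (f x))"
  by (induction A rule: infinite_finite_induct) (simp_all add: fsubst_add)

lemma fsubst_diff: "fsubst q (a - b) = fsubst q a - fsubst q b"
  using fsubst_add[of q "a - b" b] by simp

lemma fsubst_prod_list: "fsubst q (prod_list xs) = prod_list (map (fsubst q) xs)"
  by (induction xs) (simp_all add: fsubst_mult)

lemma fsubst_fsubst: "fsubst r (fsubst q p) = fsubst (\<lambda>v. fsubst r (q v)) p"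
  by (induction p rule: fpoly_word_induct) (simp_all add: fsubst_add fsubst_mult)

lemma fsubst_fvar_id [simp]: "fsubst fvar p = p"
  by (induction p rule: fpoly_word_induct) (simp_all add: fsubst_add fsubst_mult)

lemma fpoly_eval_1 [simp]: "X \<in> mat_tuples n \<Longrightarrow> fpoly_eval n X 1 = 1\<^sub>m n"
  using fpoly_eval_fconst[of X n 1] by (auto intro!: eq_matI)

lemma fpoly_eval_0 [simp]: "fpoly_eval n X 0 = 0\<^sub>m n n"
  by (auto simp: fpoly_eval_def)

lemma fpoly_eval_dim [simp]: "dim_row (fpoly_eval n X p) = n" "dim_col (fpoly_eval n X p) = n"
  by (simp_all add: fpoly_eval_def)

lemma fpoly_eval_add_index:
  "r < n \<Longrightarrow> s < n \<Longrightarrow> fpoly_eval n X (p + q) $$ (r, s) = fpoly_eval n X p $$ (r, s) + fpoly_eval n X q $$ (r, s)"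
  by (simp add: fpoly_eval_add)

lemma fpoly_eval_sum_index:
  "r < n \<Longrightarrow> s < n \<Longrightarrow> fpoly_eval n X (sum f A) $$ (r, s) = (\<Sum>x\<in>A. fpoly_eval n X (f x) $$ (r, s))"
  by (induction A rule: infinite_finite_induct) (simp_all add: fpoly_eval_add_index)

lemma fpoly_eval_mult_index:
  assumes "X \<in> mat_tuples n" "r < n" "s < n"
  shows "fpoly_eval n X (p * q) $$ (r, s) = (\<Sum>t<n. fpoly_eval n X p $$ (r, t) * fpoly_eval n X q $$ (t, s))"
  using assms(2,3) unfolding fpoly_eval_mult[OF assms(1)] by (simp add: scalar_prod_def lessThan_atLeast0)

lemma fpoly_eval_uminus_index:
  assumes "r < n" "s < n"
  shows "fpoly_eval n X (- p) $$ (r, s) = - fpoly_eval n X p $$ (r, s)"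
  using fpoly_eval_add_index[of r n s X p "- p"] assms by (simp add: eq_neg_iff_add_eq_0 add.commute)

lemma fpoly_eval_tuple: "X \<in> mat_tuples n \<Longrightarrow> (\<lambda>v. fpoly_eval n X (q v)) \<in> mat_tuples n"
  by (simp add: mat_tuples_def)

lemma fpoly_eval_fsubst:
  assumes X: "X \<in> mat_tuples n"
  shows "fpoly_eval n X (fsubst q p) = fpoly_eval n (\<lambda>v. fpoly_eval n X (q v)) p"
  by (induction p rule: fpoly_word_induct)
     (simp_all add: fsubst_add fsubst_mult fpoly_eval_add fpoly_eval_mult fpoly_eval_fconst
       fpoly_eval_fvar X fpoly_eval_tuple)

interpretation ordinary_ring: twisted_ring "(*) :: 'a::ring_1 \<Rightarrow> 'a \<Rightarrow> 'a" 1
  by unfold_locales (simp_all add: algebra_simps)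

lemma word_prod_snoc:
  fixes N :: "'l \<Rightarrow> 's \<Rightarrow> 's \<Rightarrow> 'a::ring_1"
  assumes "finite S" "a \<in> S" "b \<in> S"
  shows "word_prod S N (w @ [i]) a b = (\<Sum>c\<in>S. word_prod S N w a c * N i c b)"
proof -
  have "word_prod S N [i] c b = N i c b" for c
  proof -
    have "word_prod S N [i] c b = (\<Sum>d\<in>S. if d = b then N i c d else 0)"
      by (simp, rule sum.cong) auto
    then show ?thesis using assms by simp
  qed
  then show ?thesis using ordinary_ring.gen_word_prod_append[OF assms(1,2), of N w "[i]" b] by simp
qed

section \<open>Left inverses of matrix polynomials over the free algebra\<close>

text \<open>
  Evaluation at matrices of size \<open>m\<close> turns a matrix over the free algebra into a block matrix.
\<close>

lemma fpoly_eval_word_prod: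
  assumes Z: "Z \<in> mat_tuples m" and r: "r < m" "s < m"
  shows "word_prod (S \<times> {..<m}) (\<lambda>i (a, r) (b, s). fpoly_eval m Z (N i a b) $$ (r, s)) w (a, r) (b, s)
       = fpoly_eval m Z (word_prod S N w a b) $$ (r, s)"
  using r
proof (induction w arbitrary: a r)
  case Nil
  then show ?case using Z by auto
next
  case (Cons i w)
  let ?N = "\<lambda>i (a, r) (b, s). fpoly_eval m Z (N i a b) $$ (r, s)"
  have "word_prod (S \<times> {..<m}) ?N (i # w) (a, r) (b, s)
    = (\<Sum>c\<in>S. \<Sum>t<m. fpoly_eval m Z (N i a c) $$ (r, t) * word_prod (S \<times> {..<m}) ?N w (c, t) (b, s))"
    by (simp add: sum.cartesian_product')
  also have "\<dots> = (\<Sum>c\<in>S. \<Sum>t<m. fpoly_eval m Z (N i a c) $$ (r, t) * fpoly_eval m Z (word_prod S N w c b) $$ (t, s))"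
    by (intro sum.cong refl) (use Cons in auto)
  also have "\<dots> = fpoly_eval m Z (word_prod S N (i # w) a b) $$ (r, s)"
    using Z Cons.prems by (simp add: fpoly_eval_sum_index fpoly_eval_mult_index)
  finally show ?case .
qed

text \<open>
  At matrix points of size \<open>m\<close> the products vanish from the length \<open>(card S * m)\<^sup>2\<close> on. So do their
  images in the skew power series that are reached by such points, where the index then drops to
  \<open>card S\<close>, independently of \<open>m\<close>. A product of this length has image \<open>0\<close> for all \<open>m\<close>, and hence is \<open>0\<close>.
\<close>

lemma nilpotent_if_pencil_injective:
  fixes N :: "'l::finite \<Rightarrow> 's \<Rightarrow> 's \<Rightarrow> 'v fpoly"
  assumes S: "finite S"
    and inj: "\<And>n m X Z H. n \<ge> 1 \<Longrightarrow> m \<ge> 1 \<Longrightarrow> X \<in> mat_tuples n \<Longrightarrow> Z \<in> mat_tuples m \<Longrightarrow>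
        (\<And>r s b. r < n \<Longrightarrow> s < m \<Longrightarrow> b \<in> S \<Longrightarrow> H b r s =
          (\<Sum>i\<in>UNIV. \<Sum>a\<in>S. \<Sum>d<m. (\<Sum>c<n. X i $$ (r, c) * H a c d) * fpoly_eval m Z (N i a b) $$ (d, s))) \<Longrightarrow>
        (\<And>r s b. r < n \<Longrightarrow> s < m \<Longrightarrow> b \<in> S \<Longrightarrow> H b r s = 0)"
    and w: "card S \<le> length w" and ab: "a \<in> S" "b \<in> S"
  shows "word_prod S N w a b = 0"
proof -
  have lev: "fpoly_eval m Z (word_prod S N w a b) = 0\<^sub>m m m"
    if m: "m \<ge> 1" and Z: "Z \<in> mat_tuples m" and w: "card S * m * (card S * m) \<le> length w"
      and ab: "a \<in> S" "b \<in> S" for m Z w a b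
  proof -
    let ?S = "S \<times> {..<m}"
    let ?N = "\<lambda>i (a, r) (b, s). fpoly_eval m Z (N i a b) $$ (r, s)"
    have fin: "finite ?S" using S by simp
    define n where "n = card ?S"
    have n: "n \<ge> 1" using ab S m by (auto simp: n_def card_gt_0_iff Suc_le_eq)
    obtain e where e: "bij_betw e {0..<n} ?S" using ex_enum[OF fin] n_def by blast
    have "word_prod ?S ?N w x y = 0" if "x \<in> ?S" "y \<in> ?S" for x y
    proof (rule jointly_nilpotent_if_pencil_injective[OF fin _ _ that])
      fix X H x y
      assume eq: "\<And>x y. x \<in> ?S \<Longrightarrow> y \<in> ?S \<Longrightarrow>
          H x y = (\<Sum>i\<in>UNIV. \<Sum>c\<in>?S. \<Sum>d\<in>?S. X i x c * H c d * ?N i d y)"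
        and xy: "x \<in> ?S" "y \<in> ?S"
      obtain r where r: "r < n" "x = e r" by (rule enum_surjD[OF e xy(1)])
      have "(\<lambda>b r s. H (e r) (b, s)) (fst y) r (snd y) = 0"
      proof (rule inj[of n m "\<lambda>i. enum_mat n e (X i)" Z])
        show "(\<lambda>i. enum_mat n e (X i)) \<in> mat_tuples n" by (simp add: mat_tuples_def)
        fix r s b assume rsb: "r < n" "s < m" "b \<in> S"
        have er: "e r \<in> ?S" by (rule enum_in[OF e rsb(1)])
        have R: "(\<Sum>c\<in>?S. X i (e r) c * H c d) = (\<Sum>c<n. X i (e r) (e c) * H (e c) d)" for i d
          unfolding lessThan_atLeast0[of n] by (rule sum.reindex_bij_betw[OF e, symmetric])
        have "H (e r) (b, s) = (\<Sum>i\<in>UNIV. \<Sum>d\<in>?S. (\<Sum>c\<in>?S. X i (e r) c * H c d) * ?N i d (b, s))"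
          unfolding eq[of "e r" "(b, s)", OF er SigmaI[OF rsb(3), of s "\<lambda>_. {..<m}", unfolded lessThan_iff, OF rsb(2)]]
          by (rule sum.cong[OF refl], subst sum.swap, simp add: sum_distrib_right)
        also have "\<dots> = (\<Sum>i\<in>UNIV. \<Sum>d\<in>?S. (\<Sum>c<n. X i (e r) (e c) * H (e c) d) * ?N i d (b, s))"
          unfolding R ..
        also have "\<dots> = (\<Sum>i\<in>UNIV. \<Sum>a\<in>S. \<Sum>d<m. (\<Sum>c<n. X i (e r) (e c) * H (e c) (a, d)) *
            fpoly_eval m Z (N i a b) $$ (d, s))"
          by (simp add: sum.cartesian_product')
        finally show "H (e r) (b, s) = (\<Sum>i\<in>UNIV. \<Sum>a\<in>S. \<Sum>d<m. (\<Sum>c<n. enum_mat n e (X i) $$ (r, c) * H (e c) (a, d)) *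
            fpoly_eval m Z (N i a b) $$ (d, s))"
          using rsb by simp
      qed (use n m Z r xy in auto)
      then show "H x y = 0" using r by simp
    qed (use w in \<open>simp add: card_cartesian_product\<close>)
    then have "fpoly_eval m Z (word_prod S N w a b) $$ (r, s) = 0" if "r < m" "s < m" for r s
      using fpoly_eval_word_prod[OF Z that, of S N w a b] that ab by simp
    then show ?thesis by (intro eq_matI) auto
  qed
  show ?thesis
  proof (rule ccontr)
    assume "word_prod S N w a b \<noteq> 0"
    then obtain m q f where m: "m \<ge> 1" "q ^ m = 1" "q \<noteq> 0"
      and nz: "skew_hom q f (word_prod S N w a b) \<noteq> 0"
      using ex_skew_hom_neq_0 by blast
    interpret skew q by unfold_locales (rule m(3))
    have "gen_word_prod (skew_mult q) 1 S (\<lambda>i a b. skew_hom q f (N i a b)) w a b = 0"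
    proof (rule nilpotency_index_le_card[OF S _ w ab])
      fix w :: "'l list" and a b assume "card S * m * (card S * m) \<le> length w" "a \<in> S" "b \<in> S"
      then show "gen_word_prod (skew_mult q) 1 S (\<lambda>i a b. skew_hom q f (N i a b)) w a b = 0"
        unfolding skew_hom_wprod using skew_hom_eq_0_if_vanishing[OF m(2,1)] lev[OF m(1)] by blast
    qed
    then show False using nz unfolding skew_hom_wprod by simp
  qed
qed

definition words_upto :: "nat \<Rightarrow> 'l list set" where
  "words_upto e = {w. length w \<le> e}"

lemma finite_words_upto [simp]: "finite (words_upto e :: 'l::finite list set)"
  using finite_lists_length_le[of "UNIV :: 'l set" e] by (simp add: words_upto_def)

lemma sum_words_upto_Suc:
  fixes f :: "'l::finite list \<Rightarrow> 'a::comm_monoid_add"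
  shows "(\<Sum>w\<in>words_upto (Suc e). f w) = f [] + (\<Sum>i\<in>UNIV. \<Sum>w\<in>words_upto e. f (i # w))"
proof -
  have eq: "(words_upto (Suc e) :: 'l list set) = insert [] ((\<lambda>(i, w). i # w) ` (UNIV \<times> words_upto e))"
  proof (intro equalityI subsetI)
    fix w :: "'l list" assume "w \<in> words_upto (Suc e)"
    then show "w \<in> insert [] ((\<lambda>(i, w). i # w) ` (UNIV \<times> words_upto e))"
      by (cases w) (auto simp: words_upto_def image_iff)
  qed (auto simp: words_upto_def)
  have "(\<Sum>w\<in>(\<lambda>(i, w). i # w) ` (UNIV \<times> words_upto e). f w) = (\<Sum>(i, w)\<in>UNIV \<times> words_upto e. f (i # w))"
    by (subst sum.reindex) (auto simp: inj_on_def o_def case_prod_unfold)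
  then show ?thesis unfolding eq
    by (subst sum.insert) (auto simp: sum.cartesian_product)
qed

lemma sum_UNIV_pair:
  "(\<Sum>x\<in>UNIV \<times> A. f x) = (\<Sum>j\<in>UNIV. \<Sum>s\<in>A. f (j, s))"
  by (simp add: sum.cartesian_product')

lemma word_eval_Cons_index:
  assumes X: "X \<in> mat_tuples n" and r: "r < n" "s < n"
  shows "word_eval n X (i # w) $$ (r, s) = (\<Sum>t<n. X i $$ (r, t) * word_eval n X w $$ (t, s))"
proof -
  have "X i \<in> carrier_mat n n" using X by (simp add: mat_tuples_def)
  then show ?thesis using r word_eval_carrier[OF X, of w]
    by (simp add: scalar_prod_def lessThan_atLeast0)
qed

text \<open>
  Let \<open>U(y) = \<Sum>\<^sub>u U\<^sub>u y\<^sub>u\<close> have constant coefficient \<open>1\<close> and degree at most \<open>e + 1\<close>. The companion matrix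
  of \<open>U\<close> makes it linear: the states are pairs \<open>(j, s)\<close> of a row index and the word \<open>s\<close> of letters
  already read of the next monomial of \<open>U\<close>, and a step either reads one more letter or completes the
  monomial with the coefficient \<open>- U\<close>. The coefficients of the formal inverse are the sums over the
  paths from \<open>(j, [])\<close> to \<open>(i, [])\<close>. A solution \<open>H\<close> of the fixed point equation for the companion matrix is
  determined by its components at the states \<open>(j, [])\<close>, and these satisfy the equation that is assumed
  to have only the zero solution; so the companion matrices are jointly nilpotent.
\<close>

theorem left_inverse_if_pointwise_injective:
  fixes U :: "'l::finite list \<Rightarrow> 'i::finite \<Rightarrow> 'i \<Rightarrow> 'v fpoly"
  assumes U0: "\<And>j i. U [] j i = (if j = i then 1 else 0)"
    and Ue: "\<And>u j i. length u > Suc e \<Longrightarrow> U u j i = 0"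
    and inj: "\<And>n m X Z H. n \<ge> 1 \<Longrightarrow> m \<ge> 1 \<Longrightarrow> X \<in> mat_tuples n \<Longrightarrow> Z \<in> mat_tuples m \<Longrightarrow>
        (\<And>r s i. r < n \<Longrightarrow> s < m \<Longrightarrow> (\<Sum>u\<in>words_upto (Suc e). \<Sum>j\<in>UNIV. \<Sum>d<m.
            (\<Sum>c<n. word_eval n X u $$ (r, c) * H j c d) * fpoly_eval m Z (U u j i) $$ (d, s)) = 0) \<Longrightarrow>
        (\<And>r s j. r < n \<Longrightarrow> s < m \<Longrightarrow> H j r s = 0)"
  shows "\<exists>F k. (\<forall>w j i. length w \<ge> k \<longrightarrow> F w j i = 0) \<and>
    (\<forall>w j i. (\<Sum>t\<le>length w. \<Sum>l\<in>UNIV. F (drop t w) j l * U (take t w) l i) =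
        (if w = [] \<and> j = i then 1 else 0))"
proof -
  define S :: "('i \<times> 'l list) set" where "S = UNIV \<times> words_upto e"
  have S: "finite S" by (simp add: S_def)
  define N :: "'l \<Rightarrow> 'i \<times> 'l list \<Rightarrow> 'i \<times> 'l list \<Rightarrow> 'v fpoly" where
    "N = (\<lambda>i (j, s') (j', s). if s = [] then - U (i # s') j j'
        else if s = i # s' \<and> j = j' then 1 else 0)"
  have nil: "word_prod S N w a b = 0" if "card S \<le> length w" "a \<in> S" "b \<in> S" for w a b
  proof (rule nilpotent_if_pencil_injective[OF S _ that])
    fix n m X Z and H :: "'i \<times> 'l list \<Rightarrow> nat \<Rightarrow> nat \<Rightarrow> complex" and r s b
    assume nm: "n \<ge> 1" "m \<ge> 1" and X: "X \<in> mat_tuples n" and Z: "Z \<in> mat_tuples m"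
      and eq: "\<And>r s b. r < n \<Longrightarrow> s < m \<Longrightarrow> b \<in> S \<Longrightarrow> H b r s =
          (\<Sum>i\<in>UNIV. \<Sum>a\<in>S. \<Sum>d<m. (\<Sum>c<n. X i $$ (r, c) * H a c d) * fpoly_eval m Z (N i a b) $$ (d, s))"
      and rsb: "r < n" "s < m" "b \<in> S"
    \<comment> \<open>One more letter multiplies from the left, so the component at \<open>(j, v)\<close> is \<open>X\<^sub>v\<close> times the one at
        \<open>(j, [])\<close>.\<close>
    have push: "(\<Sum>c<n. X x $$ (r, c) * H (j, v) c s) = (\<Sum>c<n. word_eval n X (x # v) $$ (r, c) * H (j, []) c s)"
      if "r < n" "\<And>c. c < n \<Longrightarrow> H (j, v) c s = (\<Sum>c'<n. word_eval n X v $$ (c, c') * H (j, []) c' s)"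
      for x v j r s
    proof -
      have "(\<Sum>c<n. X x $$ (r, c) * H (j, v) c s)
          = (\<Sum>c'<n. \<Sum>c<n. X x $$ (r, c) * word_eval n X v $$ (c, c') * H (j, []) c' s)"
        by (subst sum.swap) (simp add: that sum_distrib_left mult.assoc)
      also have "\<dots> = (\<Sum>c'<n. word_eval n X (x # v) $$ (r, c') * H (j, []) c' s)"
        using that by (intro sum.cong refl) (simp add: word_eval_Cons_index[OF X] sum_distrib_right del: word_eval.simps)
      finally show ?thesis .
    qed
    have state: "H (j, v) r s = (\<Sum>c<n. word_eval n X v $$ (r, c) * H (j, []) c s)"
      if "r < n" "s < m" "length v \<le> e" for j v r s
      using that
    proof (induction v arbitrary: r s)
      case Nil
      have "(\<Sum>c<n. word_eval n X [] $$ (r, c) * H (j, []) c s) = (\<Sum>c<n. if c = r then H (j, []) r s else 0)"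
        by (rule sum.cong) (use Nil in auto)
      then show ?case using Nil by simp
    next
      case (Cons x v)
      have v: "(j, v) \<in> S" using Cons.prems by (simp add: S_def words_upto_def)
      have xv: "(j, x # v) \<in> S" using Cons.prems by (simp add: S_def words_upto_def)
      let ?t = "\<lambda>i a. \<Sum>d<m. (\<Sum>c<n. X i $$ (r, c) * H a c d) * fpoly_eval m Z (N i a (j, x # v)) $$ (d, s)"
      have z: "?t i a = (if a = (j, v) then if i = x then (\<Sum>c<n. X x $$ (r, c) * H (j, v) c s) else 0 else 0)" for i a
      proof (cases "a = (j, v) \<and> i = x")
        case True
        have "?t i a = (\<Sum>d<m. if d = s then (\<Sum>c<n. X x $$ (r, c) * H (j, v) c s) else 0)"
          by (rule sum.cong) (use True Z Cons.prems in \<open>auto simp: N_def\<close>)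
        then show ?thesis using True Cons.prems by simp
      next
        case False
        then have "N i a (j, x # v) = 0" by (cases a) (auto simp: N_def)
        then show ?thesis using False Cons.prems by auto
      qed
      have "H (j, x # v) r s = (\<Sum>i\<in>UNIV. \<Sum>a\<in>S. ?t i a)"
        by (rule eq) (use Cons.prems xv in auto)
      also have "\<dots> = (\<Sum>c<n. X x $$ (r, c) * H (j, v) c s)"
        unfolding z using v S by simp
      also have "\<dots> = (\<Sum>c<n. word_eval n X (x # v) $$ (r, c) * H (j, []) c s)"
        by (rule push) (use Cons in auto)
      finally show ?case .
    qed
    have H0: "H (j, []) r s = 0" if "r < n" "s < m" for j r s
    proof (rule inj[OF nm X Z _ that, of "\<lambda>j. H (j, [])"])
      fix r s i assume rs: "r < n" "s < m"
      let ?g = "\<lambda>u j. \<Sum>d<m. (\<Sum>c<n. word_eval n X u $$ (r, c) * H (j, []) c d) * fpoly_eval m Z (U u j i) $$ (d, s)"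
      have nil': "(\<Sum>j\<in>UNIV. ?g [] j) = H (i, []) r s"
      proof -
        have g: "?g [] j = (if j = i then H (i, []) r s else 0)" for j
        proof -
          have "?g [] j = (\<Sum>d<m. if d = s then (if j = i then H (j, []) r s else 0) else 0)"
          proof (rule sum.cong[OF refl])
            fix d assume d: "d \<in> {..<m}"
            have "(\<Sum>c<n. word_eval n X [] $$ (r, c) * H (j, []) c d) = H (j, []) r d"
              using state[of r d "[]" j] rs d by simp
            then show "(\<Sum>c<n. word_eval n X [] $$ (r, c) * H (j, []) c d) * fpoly_eval m Z (U [] j i) $$ (d, s)
                = (if d = s then (if j = i then H (j, []) r s else 0) else 0)"
              using d rs Z by (auto simp: U0)
          qed
          then show ?thesis using rs by simp
        qed
        show ?thesis unfolding g by simp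
      qed
      have inS: "(i, []) \<in> S" by (simp add: S_def words_upto_def)
      have cons: "(\<Sum>d<m. (\<Sum>c<n. X x $$ (r, c) * H (j, v) c d) * fpoly_eval m Z (N x (j, v) (i, [])) $$ (d, s))
          = - ?g (x # v) j" if v: "v \<in> words_upto e" for x j v
      proof -
        have "(\<Sum>c<n. X x $$ (r, c) * H (j, v) c d) = (\<Sum>c<n. word_eval n X (x # v) $$ (r, c) * H (j, []) c d)" if "d < m" for d
          by (rule push[OF rs(1) state]) (use that v in \<open>auto simp: words_upto_def\<close>)
        then show ?thesis using rs
          by (simp add: N_def fpoly_eval_uminus_index sum_negf del: word_eval.simps)
      qed
      have "H (i, []) r s = (\<Sum>x\<in>UNIV. \<Sum>a\<in>S. \<Sum>d<m. (\<Sum>c<n. X x $$ (r, c) * H a c d) * fpoly_eval m Z (N x a (i, [])) $$ (d, s))"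
        by (rule eq[OF rs inS])
      also have "\<dots> = (\<Sum>x\<in>UNIV. \<Sum>j\<in>UNIV. \<Sum>v\<in>words_upto e. - ?g (x # v) j)"
        unfolding S_def sum_UNIV_pair by (intro sum.cong refl cons)
      also have "\<dots> = - (\<Sum>x\<in>UNIV. \<Sum>v\<in>words_upto e. \<Sum>j\<in>UNIV. ?g (x # v) j)"
        unfolding sum_negf by (intro arg_cong[where f=uminus] sum.cong[OF refl] sum.swap)
      finally have "H (i, []) r s + (\<Sum>x\<in>UNIV. \<Sum>v\<in>words_upto e. \<Sum>j\<in>UNIV. ?g (x # v) j) = 0"
        by (simp add: eq_neg_iff_add_eq_0)
      then show "(\<Sum>u\<in>words_upto (Suc e). \<Sum>j\<in>UNIV. ?g u j) = 0"
        unfolding sum_words_upto_Suc nil' .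
    qed
    obtain j v where b: "b = (j, v)" "length v \<le> e" using rsb(3) by (auto simp: S_def words_upto_def)
    show "H b r s = 0" unfolding b(1) using state[OF rsb(1,2) b(2), of j] H0 rsb by simp
  qed
  \<comment> \<open>A word is consumed from its end, since the letters in a state grow to the left.\<close>
  define F where "F = (\<lambda>w j i. word_prod S N (rev w) (j, []) (i, []))"
  have inS: "(j, []) \<in> S" for j by (simp add: S_def words_upto_def)
  show ?thesis
  proof (intro exI[of _ F] exI[of _ "card S"] conjI allI impI)
    show "F w j i = 0" if "card S \<le> length w" for w j i
      unfolding F_def using nil[of "rev w"] that inS by simp
    \<comment> \<open>A path that ends in the state \<open>(i, v)\<close> has just read \<open>v\<close>.\<close>
    have state: "word_prod S N (rev w) (j, []) (i, v) = (if take (length v) w = v then F (drop (length v) w) j i else 0)"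
      if "length v \<le> e" for w v j i
      using that
    proof (induction w arbitrary: v)
      case Nil
      then show ?case by (auto simp: F_def)
    next
      case (Cons x w)
      show ?case
      proof (cases v)
        case Nil
        then show ?thesis by (simp add: F_def)
      next
        case v: (Cons y v')
        have vS: "(i, v) \<in> S" using Cons.prems by (simp add: S_def words_upto_def)
        have v'S: "(i, v') \<in> S" using Cons.prems v by (simp add: S_def words_upto_def)
        have "word_prod S N (rev (x # w)) (j, []) (i, v) = (\<Sum>c\<in>S. word_prod S N (rev w) (j, []) c * N x c (i, v))"
          by (simp only: rev.simps) (rule word_prod_snoc[OF S inS vS])
        also have "\<dots> = (\<Sum>c\<in>S. if c = (i, v') then (if x = y then word_prod S N (rev w) (j, []) (i, v') else 0) else 0)"
        proof (rule sum.cong[OF refl])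
          fix c
          have "N x c (i, v) = (if c = (i, v') \<and> x = y then 1 else 0)"
            by (cases c) (auto simp: N_def v)
          then show "word_prod S N (rev w) (j, []) c * N x c (i, v)
              = (if c = (i, v') then (if x = y then word_prod S N (rev w) (j, []) (i, v') else 0) else 0)"
            by simp
        qed
        also have "\<dots> = (if x = y then word_prod S N (rev w) (j, []) (i, v') else 0)"
          using S v'S by simp
        finally show ?thesis using Cons.IH[of v'] Cons.prems v by auto
      qed
    qed
    fix w j i
    show "(\<Sum>t\<le>length w. \<Sum>l\<in>UNIV. F (drop t w) j l * U (take t w) l i) = (if w = [] \<and> j = i then 1 else 0)"
    proof (cases w)
      case Nil
      have "(\<Sum>l\<in>UNIV. F [] j l * U [] l i) = (\<Sum>l\<in>UNIV. if l = i then (if j = i then 1 else 0) else 0)"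
        by (rule sum.cong) (auto simp: F_def U0)
      then show ?thesis using Nil by simp
    next
      case (Cons x v)
      have "F w j i = (\<Sum>c\<in>S. word_prod S N (rev v) (j, []) c * N x c (i, []))"
        unfolding F_def Cons by (simp only: rev.simps) (rule word_prod_snoc[OF S inS inS])
      also have "\<dots> = (\<Sum>l\<in>UNIV. \<Sum>s\<in>words_upto e. - (if take (length s) v = s then F (drop (length s) v) j l * U (x # s) l i else 0))"
        unfolding S_def sum_UNIV_pair
        by (intro sum.cong refl, subst state[unfolded S_def]) (auto simp: words_upto_def N_def)
      also have "\<dots> = - (\<Sum>l\<in>UNIV. \<Sum>s\<in>words_upto e. if take (length s) v = s then F (drop (length s) v) j l * U (x # s) l i else 0)"
        by (simp add: sum_negf)
      finally have E1: "F w j i = - (\<Sum>l\<in>UNIV. \<Sum>s\<in>words_upto e. if take (length s) v = s then F (drop (length s) v) j l * U (x # s) l i else 0)" .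
      have E2: "(\<Sum>s\<in>words_upto e. if take (length s) v = s then F (drop (length s) v) j l * U (x # s) l i else 0)
          = (\<Sum>t\<le>length v. F (drop t v) j l * U (x # take t v) l i)" for l
      proof -
        let ?A = "{s \<in> words_upto e. take (length s) v = s}"
        have "(\<Sum>s\<in>words_upto e. if take (length s) v = s then F (drop (length s) v) j l * U (x # s) l i else 0)
            = (\<Sum>s\<in>?A. F (drop (length s) v) j l * U (x # s) l i)"
          by (rule sum.inter_filter[symmetric]) simp
        also have "\<dots> = (\<Sum>t\<in>{t. t \<le> length v \<and> t \<le> e}. F (drop t v) j l * U (x # take t v) l i)"
          by (rule sum.reindex_bij_witness[of _ "\<lambda>t. take t v" length])
             (auto simp: words_upto_def, metis length_take min.cobounded1)
        also have "\<dots> = (\<Sum>t\<le>length v. F (drop t v) j l * U (x # take t v) l i)"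
        proof (rule sum.mono_neutral_left)
          have "U (x # take t v) l i = 0" if "t \<le> length v" "\<not> t \<le> e" for t
            by (rule Ue) (use that in simp)
          then show "\<forall>t\<in>{..length v} - {t. t \<le> length v \<and> t \<le> e}. F (drop t v) j l * U (x # take t v) l i = 0"
            by simp
        qed auto
        finally show ?thesis .
      qed
      have Fw: "F w j i = - (\<Sum>l\<in>UNIV. \<Sum>t\<le>length v. F (drop t v) j l * U (x # take t v) l i)"
        unfolding E1 E2 ..
      have "(\<Sum>l\<in>UNIV. F w j l * U [] l i) = (\<Sum>l\<in>UNIV. if l = i then F w j i else 0)"
        by (rule sum.cong) (auto simp: U0)
      then have z: "(\<Sum>l\<in>UNIV. F w j l * U [] l i) = F w j i" by simp
      have "(\<Sum>t\<le>length w. \<Sum>l\<in>UNIV. F (drop t w) j l * U (take t w) l i)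
          = F w j i + (\<Sum>t\<le>length v. \<Sum>l\<in>UNIV. F (drop t v) j l * U (x # take t v) l i)"
        unfolding Cons length_Cons sum.atMost_Suc_shift using z Cons by simp
      also have "\<dots> = 0" unfolding Fw by (subst sum.swap) simp
      finally show ?thesis using Cons by simp
    qed
  qed
qed

section \<open>The free difference-differential\<close>

text \<open>
  The sum of \<open>X\<^sub>u H\<^sub>i Z\<^sub>v\<close> over all factorisations \<open>u i v\<close> of a word: the derivative of the word in
  direction \<open>H\<close>, with different points on the two sides of \<open>H\<close>. As \<open>H\<close> may be rectangular, the sizes of
  the two points are unrelated. \<open>corner\<close> is its linear extension.
\<close>

primrec word_corner :: "nat \<Rightarrow> nat \<Rightarrow> ('v \<Rightarrow> complex mat) \<Rightarrow> ('v \<Rightarrow> complex mat) \<Rightarrow> ('v \<Rightarrow> complex mat) \<Rightarrow> 'v list \<Rightarrow> complex mat" where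
  "word_corner n m X Z H [] = 0\<^sub>m n m"
| "word_corner n m X Z H (i # w) = X i * word_corner n m X Z H w + H i * word_eval m Z w"

definition rect_tuples :: "nat \<Rightarrow> nat \<Rightarrow> ('v \<Rightarrow> complex mat) set" where
  "rect_tuples n m = {H. \<forall>i. H i \<in> carrier_mat n m}"

lemma mat_tuplesD: "X \<in> mat_tuples n \<Longrightarrow> X i \<in> carrier_mat n n"
  by (simp add: mat_tuples_def)

lemma rect_tuplesD: "H \<in> rect_tuples n m \<Longrightarrow> H i \<in> carrier_mat n m"
  by (simp add: rect_tuples_def)

lemma word_corner_carrier:
  assumes "X \<in> mat_tuples n" "Z \<in> mat_tuples m" "H \<in> rect_tuples n m"
  shows "word_corner n m X Z H w \<in> carrier_mat n m"
proof (induction w)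
  case (Cons i w)
  have "X i \<in> carrier_mat n n" "H i \<in> carrier_mat n m" "word_eval m Z w \<in> carrier_mat m m"
    using assms by (simp_all add: mat_tuplesD rect_tuplesD word_eval_carrier)
  then show ?case using Cons by simp
qed simp

definition corner :: "nat \<Rightarrow> nat \<Rightarrow> ('v \<Rightarrow> complex mat) \<Rightarrow> ('v \<Rightarrow> complex mat) \<Rightarrow> ('v \<Rightarrow> complex mat) \<Rightarrow> 'v fpoly \<Rightarrow> complex mat" where
  "corner n m X Z H p = mat n m (\<lambda>(r, s).
     \<Sum>w\<in>Poly_Mapping.keys p. Poly_Mapping.lookup p w * word_corner n m X Z H (letters w) $$ (r, s))"

lemma corner_carrier [simp]: "corner n m X Z H p \<in> carrier_mat n m"
  by (simp add: corner_def)

abbreviation block_tuple :: "nat \<Rightarrow> nat \<Rightarrow> ('v \<Rightarrow> complex mat) \<Rightarrow> ('v \<Rightarrow> complex mat) \<Rightarrow> ('v \<Rightarrow> complex mat) \<Rightarrow> 'v \<Rightarrow> complex mat" where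
  "block_tuple n m X Z H \<equiv> (\<lambda>i. four_block_mat (X i) (H i) (0\<^sub>m m n) (Z i))"

lemma block_tuple:
  assumes "X \<in> mat_tuples n" "Z \<in> mat_tuples m"
  shows "block_tuple n m X Z H \<in> mat_tuples (n + m)"
  using assms by (simp add: mat_tuples_def)

lemma word_eval_block:
  assumes X: "X \<in> mat_tuples n" and Z: "Z \<in> mat_tuples m" and H: "H \<in> rect_tuples n m"
  shows "word_eval (n + m) (block_tuple n m X Z H) w =
    four_block_mat (word_eval n X w) (word_corner n m X Z H w) (0\<^sub>m m n) (word_eval m Z w)"
proof (induction w)
  case Nil
  show ?case by simp
next
  case (Cons i w)
  note c = mat_tuplesD[OF X, of i] mat_tuplesD[OF Z, of i] rect_tuplesD[OF H, of i]
    word_eval_carrier[OF X, of w] word_eval_carrier[OF Z, of w] word_corner_carrier[OF assms, of w]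
  have "word_eval (n + m) (block_tuple n m X Z H) (i # w)
    = four_block_mat (X i) (H i) (0\<^sub>m m n) (Z i) *
      four_block_mat (word_eval n X w) (word_corner n m X Z H w) (0\<^sub>m m n) (word_eval m Z w)"
    using Cons by simp
  also have "\<dots> = four_block_mat (X i * word_eval n X w + H i * 0\<^sub>m m n)
      (X i * word_corner n m X Z H w + H i * word_eval m Z w)
      (0\<^sub>m m n * word_eval n X w + Z i * 0\<^sub>m m n) (0\<^sub>m m n * word_corner n m X Z H w + Z i * word_eval m Z w)"
    by (rule mult_four_block_mat) (use c in auto)
  also have "\<dots> = four_block_mat (word_eval n X (i # w)) (word_corner n m X Z H (i # w)) (0\<^sub>m m n) (word_eval m Z (i # w))"
    using c by (intro cong_four_block_mat) auto
  finally show ?case .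
qed

text \<open>
  Evaluation is multiplicative, and a product of block upper triangular matrices has the product rule in
  its corner.
\<close>

lemma fpoly_eval_block:
  assumes X: "X \<in> mat_tuples n" and Z: "Z \<in> mat_tuples m" and H: "H \<in> rect_tuples n m"
  shows "fpoly_eval (n + m) (block_tuple n m X Z H) p =
    four_block_mat (fpoly_eval n X p) (corner n m X Z H p) (0\<^sub>m m n) (fpoly_eval m Z p)"
proof (rule eq_matI)
  fix r s assume "r < dim_row (four_block_mat (fpoly_eval n X p) (corner n m X Z H p) (0\<^sub>m m n) (fpoly_eval m Z p))"
    "s < dim_col (four_block_mat (fpoly_eval n X p) (corner n m X Z H p) (0\<^sub>m m n) (fpoly_eval m Z p))"
  then have rs: "r < n + m" "s < n + m" by auto
  have d: "dim_row (word_eval n X w) = n" "dim_col (word_eval n X w) = n"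
    "dim_row (word_eval m Z w) = m" "dim_col (word_eval m Z w) = m" for w
    using word_eval_carrier[OF X, of w] word_eval_carrier[OF Z, of w] by auto
  show "fpoly_eval (n + m) (block_tuple n m X Z H) p $$ (r, s) =
    four_block_mat (fpoly_eval n X p) (corner n m X Z H p) (0\<^sub>m m n) (fpoly_eval m Z p) $$ (r, s)"
    using rs by (simp add: fpoly_eval_def corner_def word_eval_block[OF assms] d)
qed (simp_all add: corner_def)

lemma four_block_mat_eq_imp:
  assumes "four_block_mat A B C D = four_block_mat A B' C D"
    "A \<in> carrier_mat n n" "D \<in> carrier_mat m m" "B \<in> carrier_mat n m" "B' \<in> carrier_mat n m"
  shows "B = B'"
proof (rule eq_matI)
  fix r s assume "r < dim_row B'" "s < dim_col B'"
  then have rs: "r < n" "s < m" using assms by auto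
  have "four_block_mat A B C D $$ (r, n + s) = four_block_mat A B' C D $$ (r, n + s)"
    using assms(1) by simp
  then show "B $$ (r, s) = B' $$ (r, s)" using rs assms(2-) by simp
qed (use assms in auto)

lemma corner_injective:
  assumes p: "free_bijective p" and n: "n \<ge> 1"
    and X: "X \<in> mat_tuples n" and Z: "Z \<in> mat_tuples m"
    and H: "H \<in> rect_tuples n m" and H': "H' \<in> rect_tuples n m"
    and eq: "\<And>i. corner n m X Z H (p i) = corner n m X Z H' (p i)"
  shows "H = H'"
proof -
  have inj: "inj_on (map_eval p (n + m)) (mat_tuples (n + m))"
    using p n unfolding free_bijective_def bij_betw_def by (meson trans_le_add1)
  have same: "map_eval p (n + m) (block_tuple n m X Z H) = map_eval p (n + m) (block_tuple n m X Z H')"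
    unfolding map_eval_def fpoly_eval_block[OF X Z H] fpoly_eval_block[OF X Z H'] eq ..
  have "block_tuple n m X Z H = block_tuple n m X Z H'"
    by (rule inj_onD[OF inj same block_tuple[OF X Z] block_tuple[OF X Z]])
  then have "four_block_mat (X i) (H i) (0\<^sub>m m n) (Z i) = four_block_mat (X i) (H' i) (0\<^sub>m m n) (Z i)" for i
    by (rule fun_cong)
  then have "H i = H' i" for i
    by (rule four_block_mat_eq_imp[OF _ mat_tuplesD[OF X] mat_tuplesD[OF Z] rect_tuplesD[OF H] rect_tuplesD[OF H']])
  then show ?thesis by blast
qed

lemma word_corner_zero:
  assumes X: "X \<in> mat_tuples n" and Z: "Z \<in> mat_tuples m"
  shows "word_corner n m X Z (\<lambda>_. 0\<^sub>m n m) w = 0\<^sub>m n m"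
proof (induction w)
  case (Cons i w)
  then show ?case using mat_tuplesD[OF X, of i] word_eval_carrier[OF Z, of w] by simp
qed simp

lemma corner_kernel:
  assumes p: "free_bijective p" and n: "n \<ge> 1"
    and X: "X \<in> mat_tuples n" and Z: "Z \<in> mat_tuples m"
    and H: "H \<in> rect_tuples n m"
    and z: "\<And>i r s. r < n \<Longrightarrow> s < m \<Longrightarrow> corner n m X Z H (p i) $$ (r, s) = 0"
  shows "H i = 0\<^sub>m n m"
proof -
  have "H = (\<lambda>_. 0\<^sub>m n m)"
  proof (rule corner_injective[OF p n X Z H])
    show "corner n m X Z H (p i) = corner n m X Z (\<lambda>_. 0\<^sub>m n m) (p i)" for i
      using z[of _ _ i] by (intro eq_matI) (auto simp: corner_def word_corner_zero[OF X Z])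
  qed (simp add: rect_tuples_def)
  then show ?thesis by simp
qed

abbreviation fword_poly :: "'v list \<Rightarrow> 'v fpoly" where
  "fword_poly w \<equiv> prod_list (map fvar w)"

text \<open>
  The part of a polynomial whose words begin with \<open>u\<close>, with this prefix removed.
\<close>

definition left_quot :: "'v list \<Rightarrow> 'v fpoly \<Rightarrow> 'v fpoly" where
  "left_quot u = linext (\<lambda>w. if take (length u) (letters w) = u then fword_poly (drop (length u) (letters w)) else 0)"

lemma fpoly_eval_fword_poly: "X \<in> mat_tuples n \<Longrightarrow> fpoly_eval n X (fword_poly w) = word_eval n X w"
  by (induction w) (simp_all add: fpoly_eval_mult fpoly_eval_fvar)

lemma word_corner_expand:
  assumes X: "X \<in> mat_tuples n" and Z: "Z \<in> mat_tuples m" and H: "H \<in> rect_tuples n m"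
    and r: "r < n" "s < m"
  shows "word_corner n m X Z H w $$ (r, s) = (\<Sum>t<length w. \<Sum>d<m.
     (\<Sum>c<n. word_eval n X (take t w) $$ (r, c) * H (w ! t) $$ (c, d)) * word_eval m Z (drop (Suc t) w) $$ (d, s))"
  using r(1)
proof (induction w arbitrary: r)
  case Nil
  then show ?case using r by simp
next
  case (Cons i w)
  note c = mat_tuplesD[OF X, of i] rect_tuplesD[OF H, of i] word_eval_carrier[OF Z, of w] word_corner_carrier[OF X Z H, of w]
  have one: "(\<Sum>c<n. word_eval n X [] $$ (r, c) * H i $$ (c, d)) = H i $$ (r, d)" for d
  proof -
    have "(\<Sum>c<n. word_eval n X [] $$ (r, c) * H i $$ (c, d)) = (\<Sum>c<n. if c = r then H i $$ (r, d) else 0)"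
      by (rule sum.cong) (use Cons.prems in auto)
    then show ?thesis using Cons.prems by simp
  qed
  have "(X i * word_corner n m X Z H w) $$ (r, s) = (\<Sum>a<n. X i $$ (r, a) * word_corner n m X Z H w $$ (a, s))"
    using c Cons.prems r by (simp add: scalar_prod_def lessThan_atLeast0)
  also have "\<dots> = (\<Sum>a<n. \<Sum>t<length w. \<Sum>d<m. \<Sum>c<n. X i $$ (r, a) * (word_eval n X (take t w) $$ (a, c) * H (w ! t) $$ (c, d)) * word_eval m Z (drop (Suc t) w) $$ (d, s))"
    by (simp add: Cons.IH sum_distrib_left sum_distrib_right mult.assoc)
  also have "\<dots> = (\<Sum>t<length w. \<Sum>d<m. \<Sum>c<n. \<Sum>a<n. X i $$ (r, a) * (word_eval n X (take t w) $$ (a, c) * H (w ! t) $$ (c, d)) * word_eval m Z (drop (Suc t) w) $$ (d, s))"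
    by (subst sum.swap, rule sum.cong[OF refl], subst sum.swap, rule sum.cong[OF refl], subst sum.swap, rule refl)
  also have "\<dots> = (\<Sum>t<length w. \<Sum>d<m. (\<Sum>c<n. word_eval n X (i # take t w) $$ (r, c) * H (w ! t) $$ (c, d)) * word_eval m Z (drop (Suc t) w) $$ (d, s))"
    using Cons.prems by (simp add: word_eval_Cons_index[OF X] sum_distrib_right mult.assoc del: word_eval.simps)
  finally have 1: "(X i * word_corner n m X Z H w) $$ (r, s) = \<dots>" .
  have "word_corner n m X Z H (i # w) $$ (r, s) = (X i * word_corner n m X Z H w) $$ (r, s) + (\<Sum>d<m. H i $$ (r, d) * word_eval m Z w $$ (d, s))"
    using c Cons.prems r by (simp add: scalar_prod_def lessThan_atLeast0)
  then show ?case unfolding 1 length_Cons sum.lessThan_Suc_shift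
    by (simp add: one del: word_eval.simps)
qed

lemma sum_positions:
  fixes g :: "'v::finite list \<Rightarrow> 'v \<Rightarrow> 'v list \<Rightarrow> 'a::comm_monoid_add"
  assumes "length w \<le> Suc e"
  shows "(\<Sum>t<length w. g (take t w) (w ! t) (drop (Suc t) w)) =
    (\<Sum>u\<in>words_upto e. \<Sum>j\<in>UNIV. if take (Suc (length u)) w = u @ [j] then g u j (drop (Suc (length u)) w) else 0)"
proof -
  have "(\<Sum>u\<in>words_upto e. \<Sum>j\<in>UNIV. if take (Suc (length u)) w = u @ [j] then g u j (drop (Suc (length u)) w) else 0)
    = (\<Sum>x\<in>words_upto e \<times> UNIV. if take (Suc (length (fst x))) w = fst x @ [snd x] then g (fst x) (snd x) (drop (Suc (length (fst x))) w) else 0)"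
    by (simp add: sum.cartesian_product case_prod_unfold)
  also have "\<dots> = (\<Sum>x\<in>{x \<in> words_upto e \<times> UNIV. take (Suc (length (fst x))) w = fst x @ [snd x]}.
      g (fst x) (snd x) (drop (Suc (length (fst x))) w))"
    by (rule sum.inter_filter[symmetric]) simp
  also have "\<dots> = (\<Sum>t<length w. g (take t w) (w ! t) (drop (Suc t) w))"
  proof (rule sum.reindex_bij_witness[of _ "\<lambda>t. (take t w, w ! t)" "\<lambda>x. length (fst x)"])
    fix x assume "x \<in> {x \<in> words_upto e \<times> UNIV. take (Suc (length (fst x))) w = fst x @ [snd x]}"
    then have x: "take (Suc (length (fst x))) w = fst x @ [snd x]" by simp
    from arg_cong[OF x, of length] have l: "length (fst x) < length w" by simp
    then have e: "take (length (fst x)) w = fst x \<and> w ! length (fst x) = snd x"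
      using x by (simp add: take_Suc_conv_app_nth)
    show "(take (length (fst x)) w, w ! length (fst x)) = x" using e by (simp add: prod_eq_iff)
    show "length (fst x) \<in> {..<length w}" using l by simp
    show "g (take (length (fst x)) w) (w ! length (fst x)) (drop (Suc (length (fst x))) w) =
        g (fst x) (snd x) (drop (Suc (length (fst x))) w)" using e by simp
  next
    fix t assume "t \<in> {..<length w}"
    then show "length (fst (take t w, w ! t)) = t"
      "(take t w, w ! t) \<in> {x \<in> words_upto e \<times> UNIV. take (Suc (length (fst x))) w = fst x @ [snd x]}"
      using assms by (auto simp: words_upto_def take_Suc_conv_app_nth)
  qed
  finally show ?thesis by simp
qed

lemma fpoly_eval_left_quot:
  assumes Z: "Z \<in> mat_tuples m" and r: "d < m" "s < m"
  shows "fpoly_eval m Z (left_quot u p) $$ (d, s) = (\<Sum>w\<in>Poly_Mapping.keys p.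
     if take (length u) (letters w) = u then Poly_Mapping.lookup p w * word_eval m Z (drop (length u) (letters w)) $$ (d, s) else 0)"
proof -
  have "fpoly_eval m Z (fconst c * q) $$ (d, s) = c * fpoly_eval m Z q $$ (d, s)" for c q
    using r by (simp add: fpoly_eval_mult[OF Z] fpoly_eval_fconst[OF Z] mult_smult_assoc_mat[of _ m m _ m])
  then show ?thesis unfolding left_quot_def linext_def
    using r by (simp add: fpoly_eval_sum_index fpoly_eval_fword_poly[OF Z] if_distrib[of "fpoly_eval m Z"]
        if_distrib[of "\<lambda>A. A $$ (d, s)"] if_distrib[of "\<lambda>x. _ * x"] cong: if_cong)
qed

text \<open>
  The polynomial in the left letters behind \<open>corner\<close>: the coefficient of \<open>X\<^sub>u H\<^sub>j\<close> is what
  remains of \<open>p\<close> after the prefix \<open>u j\<close>. \<open>fderiv_expand\<close> is the same expansion for formal letters.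
\<close>

lemma corner_expand:
  fixes p :: "'v::finite fpoly"
  assumes X: "X \<in> mat_tuples n" and Z: "Z \<in> mat_tuples m" and H: "H \<in> rect_tuples n m"
    and r: "r < n" "s < m" and e: "\<And>w. w \<in> Poly_Mapping.keys p \<Longrightarrow> length (letters w) \<le> Suc e"
  shows "corner n m X Z H p $$ (r, s) = (\<Sum>u\<in>words_upto e. \<Sum>j\<in>UNIV. \<Sum>d<m.
     (\<Sum>c<n. word_eval n X u $$ (r, c) * H j $$ (c, d)) * fpoly_eval m Z (left_quot (u @ [j]) p) $$ (d, s))"
proof -
  let ?g = "\<lambda>u j d. \<Sum>c<n. word_eval n X u $$ (r, c) * H j $$ (c, d)"
  let ?l = "Poly_Mapping.lookup p"
  have "corner n m X Z H p $$ (r, s) = (\<Sum>w\<in>Poly_Mapping.keys p. ?l w * (\<Sum>u\<in>words_upto e. \<Sum>j\<in>UNIV.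
      if take (Suc (length u)) (letters w) = u @ [j] then \<Sum>d<m. ?g u j d * word_eval m Z (drop (Suc (length u)) (letters w)) $$ (d, s) else 0))"
    unfolding corner_def using r
    by (simp add: word_corner_expand[OF X Z H] sum_positions[OF e, of _ "\<lambda>u j v. \<Sum>d<m. ?g u j d * word_eval m Z v $$ (d, s)"])
  also have "\<dots> = (\<Sum>w\<in>Poly_Mapping.keys p. \<Sum>u\<in>words_upto e. \<Sum>j\<in>UNIV. \<Sum>d<m. ?g u j d *
      (if take (Suc (length u)) (letters w) = u @ [j] then ?l w * word_eval m Z (drop (Suc (length u)) (letters w)) $$ (d, s) else 0))"
    unfolding sum_distrib_left by (intro sum.cong refl) (auto simp: sum_distrib_left mult_ac)
  also have "\<dots> = (\<Sum>u\<in>words_upto e. \<Sum>j\<in>UNIV. \<Sum>d<m. \<Sum>w\<in>Poly_Mapping.keys p. ?g u j d *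
      (if take (Suc (length u)) (letters w) = u @ [j] then ?l w * word_eval m Z (drop (Suc (length u)) (letters w)) $$ (d, s) else 0))"
    by (subst sum.swap, rule sum.cong[OF refl], subst sum.swap, rule sum.cong[OF refl], subst sum.swap, rule refl)
  also have "\<dots> = (\<Sum>u\<in>words_upto e. \<Sum>j\<in>UNIV. \<Sum>d<m. ?g u j d * fpoly_eval m Z (left_quot (u @ [j]) p) $$ (d, s))"
    using r by (simp add: fpoly_eval_left_quot[OF Z] sum_distrib_left cong: if_cong)
  finally show ?thesis .
qed

lemma fsubst_fword_poly: "fsubst q (fword_poly w) = prod_list (map q w)"
  by (simp add: fsubst_prod_list o_def)

lemma fsubst_linext: "fsubst q (linext f p) = linext (\<lambda>w. fsubst q (f w)) p"
  by (simp add: linext_def fsubst_sum fsubst_mult)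

lemma word_deriv_expand:
  "word_deriv w = (\<Sum>t<length w. prod_list (map xvar (take t w)) * hvar (w ! t) * prod_list (map xvar (drop (Suc t) w)))"
  by (induction w) (simp_all add: sum.lessThan_Suc_shift sum_distrib_left mult.assoc del: sum.lessThan_Suc)

lemma fderiv_expand:
  fixes p :: "'v::finite fpoly"
  assumes e: "\<And>w. w \<in> Poly_Mapping.keys p \<Longrightarrow> length (letters w) \<le> Suc e"
  shows "fderiv p = (\<Sum>u\<in>words_upto e. \<Sum>j\<in>UNIV.
     fsubst xvar (fword_poly u) * hvar j * fsubst xvar (left_quot (u @ [j]) p))"
proof -
  let ?l = "Poly_Mapping.lookup p"
  let ?x = "\<lambda>w. prod_list (map xvar w)"
  have "fderiv p = (\<Sum>w\<in>Poly_Mapping.keys p. \<Sum>u\<in>words_upto e. \<Sum>j\<in>UNIV. ?x u * hvar j *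
     (fconst (?l w) * (if take (Suc (length u)) (letters w) = u @ [j] then ?x (drop (Suc (length u)) (letters w)) else 0)))"
    unfolding fderiv_def linext_def
  proof (rule sum.cong[OF refl])
    fix w assume w: "w \<in> Poly_Mapping.keys p"
    have c: "fconst c * (a * b) = a * (fconst c * b)" for c and a b :: "('v + 'v) fpoly"
      by (metis fconst_commute mult.assoc)
    show "fconst (?l w) * word_deriv (letters w) = (\<Sum>u\<in>words_upto e. \<Sum>j\<in>UNIV. ?x u * hvar j *
     (fconst (?l w) * (if take (Suc (length u)) (letters w) = u @ [j] then ?x (drop (Suc (length u)) (letters w)) else 0)))"
      unfolding word_deriv_expand sum_positions[OF e[OF w], of "\<lambda>u j v. ?x u * hvar j * ?x v"] sum_distrib_left
      by (intro sum.cong refl) (auto simp: c)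
  qed
  also have "\<dots> = (\<Sum>u\<in>words_upto e. \<Sum>j\<in>UNIV. \<Sum>w\<in>Poly_Mapping.keys p. ?x u * hvar j *
     (fconst (?l w) * (if take (Suc (length u)) (letters w) = u @ [j] then ?x (drop (Suc (length u)) (letters w)) else 0)))"
    by (subst sum.swap, rule sum.cong[OF refl], subst sum.swap, rule refl)
  also have "\<dots> = (\<Sum>u\<in>words_upto e. \<Sum>j\<in>UNIV.
     fsubst xvar (fword_poly u) * hvar j * fsubst xvar (left_quot (u @ [j]) p))"
    unfolding left_quot_def fsubst_linext
    by (simp add: linext_def fsubst_fword_poly sum_distrib_left if_distrib[of "fsubst xvar"] cong: if_cong)
  finally show ?thesis .
qed

lemma word_eval_word_deriv:
  assumes X: "X \<in> mat_tuples n" and H: "H \<in> mat_tuples n"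
  shows "fpoly_eval n (case_sum H X) (word_deriv w) = word_corner n n X X H w"
proof (induction w)
  case Nil
  then show ?case by simp
next
  case (Cons i w)
  have Y: "case_sum H X \<in> mat_tuples n"
    using X H by (auto simp: mat_tuples_def split: sum.splits)
  have x: "fpoly_eval n (case_sum H X) (prod_list (map xvar w)) = word_eval n X w"
    by (induction w) (simp_all add: fpoly_eval_mult[OF Y] fpoly_eval_fvar[OF Y] Y)
  have c: "X i * word_corner n n X X H w \<in> carrier_mat n n" "H i * word_eval n X w \<in> carrier_mat n n"
    using mat_tuplesD[OF X, of i] mat_tuplesD[OF H, of i] word_eval_carrier[OF X, of w]
      word_corner_carrier[OF X X, of H w] H
    by (auto simp: rect_tuples_def mat_tuples_def intro!: mult_carrier_mat[of _ n n])
  then show ?case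
    using Cons by (simp add: fpoly_eval_add fpoly_eval_mult[OF Y] fpoly_eval_fvar[OF Y] x comm_add_mat)
qed

lemma fpoly_eval_fderiv:
  assumes X: "X \<in> mat_tuples n" and H: "H \<in> mat_tuples n"
  shows "fpoly_eval n (case_sum H X) (fderiv p) = corner n n X X H p"
proof (rule eq_matI)
  have Y: "case_sum H X \<in> mat_tuples n"
    using X H by (auto simp: mat_tuples_def split: sum.splits)
  fix r s assume "r < dim_row (corner n n X X H p)" "s < dim_col (corner n n X X H p)"
  then have rs: "r < n" "s < n" by (auto simp: corner_def)
  have "fpoly_eval n (case_sum H X) (fconst c * q) $$ (r, s) = c * fpoly_eval n (case_sum H X) q $$ (r, s)" for c q
    using rs by (simp add: fpoly_eval_mult[OF Y] fpoly_eval_fconst[OF Y] mult_smult_assoc_mat[of _ n n _ n])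
  then show "fpoly_eval n (case_sum H X) (fderiv p) $$ (r, s) = corner n n X X H p $$ (r, s)"
    using rs by (simp add: corner_def fderiv_def linext_def fpoly_eval_sum_index word_eval_word_deriv[OF X H])
qed (simp_all add: corner_def)

section \<open>The derivative of a bijective mapping\<close>

lemma Nil_in_words_upto [simp]: "[] \<in> words_upto e"
  by (simp add: words_upto_def)

lemma sum_words_product:
  fixes g :: "'v::finite list \<Rightarrow> 'v list \<Rightarrow> 'a::comm_monoid_add"
  assumes g: "\<And>u w. length u > m \<Longrightarrow> g u w = 0" "\<And>u w. length w > n \<Longrightarrow> g u w = 0"
  shows "(\<Sum>u\<in>words_upto m. \<Sum>w\<in>words_upto n. g u w)
    = (\<Sum>x\<in>words_upto (m + n). \<Sum>t\<le>length x. g (take t x) (drop t x))"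
proof -
  let ?B = "Sigma (words_upto (m + n) :: 'v list set) (\<lambda>x. {..length x})"
  have B: "finite ?B" by (rule finite_SigmaI) auto
  have "(\<Sum>y\<in>words_upto m \<times> words_upto n. g (fst y) (snd y)) = (\<Sum>y\<in>?B. g (take (snd y) (fst y)) (drop (snd y) (fst y)))"
  proof (rule sum.reindex_bij_witness_not_neutral[of "{}" "{y \<in> ?B. snd y > m \<or> length (fst y) - snd y > n}" _
        "\<lambda>y. (take (snd y) (fst y), drop (snd y) (fst y))" "\<lambda>y. (fst y @ snd y, length (fst y))"])
    show "finite {y \<in> ?B. snd y > m \<or> length (fst y) - snd y > n}"
      using B by (rule rev_finite_subset) auto
    show "g (take (snd y) (fst y)) (drop (snd y) (fst y)) = 0"
      if "y \<in> {y \<in> ?B. snd y > m \<or> length (fst y) - snd y > n}" for y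
      using that by (cases "m < snd y") (auto intro: g(1) g(2))
  qed (auto simp: words_upto_def)
  then show ?thesis
    by (simp add: sum.cartesian_product case_prod_unfold sum.Sigma)
qed

text \<open>
  The constant coefficient. It is the homomorphism to \<open>\<complex>\<close> given by evaluation at \<open>0\<close>, the counit of the
  free algebra as a bialgebra.
\<close>

definition counit :: "'v fpoly \<Rightarrow> complex" where
  "counit a = Poly_Mapping.lookup a 0"

lemma counit_add: "counit (a + b) = counit a + counit b"
  by (simp add: counit_def lookup_add)

lemma counit_0 [simp]: "counit 0 = 0"
  by (simp add: counit_def)

lemma counit_1 [simp]: "counit 1 = 1"
  by (simp add: counit_def)

lemma counit_fconst [simp]: "counit (fconst c) = c"
  by (simp add: counit_def fconst_def)

lemma counit_fvar [simp]: "counit (fvar v) = 0"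
  by (simp add: counit_def fvar_def lookup_single when_def zero_fword_def)

lemma counit_sum: "counit (sum f A) = (\<Sum>x\<in>A. counit (f x))"
  by (induction A rule: infinite_finite_induct) (simp_all add: counit_add)

lemma fword_plus_eq_0: "u + v = 0 \<longleftrightarrow> u = 0 \<and> v = (0 :: 'v fword)"
  by (cases u; cases v) (simp add: zero_fword_def plus_fword_def)

lemma counit_mult: "counit (a * b) = counit a * counit b"
proof (induction a rule: fpoly_induct)
  case (single u c)
  show ?case
  proof (induction b rule: fpoly_induct)
    case (single v d)
    show ?case by (simp add: counit_def mult_single lookup_single when_def fword_plus_eq_0)
  next
    case (sum p q)
    then show ?case by (simp add: counit_add distrib_left)
  qed
next
  case (sum p q)
  then show ?case by (simp add: counit_add distrib_right)
qed

lemma left_quot_expand: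
  fixes p :: "'v::finite fpoly"
  assumes e: "\<And>w. w \<in> Poly_Mapping.keys p \<Longrightarrow> length (letters w) \<le> length u + e"
  shows "left_quot u p = (\<Sum>v\<in>words_upto e. fconst (Poly_Mapping.lookup p (FWord (u @ v))) * fword_poly v)"
proof -
  have "left_quot u p = (\<Sum>w\<in>{w \<in> Poly_Mapping.keys p. take (length u) (letters w) = u}.
      fconst (Poly_Mapping.lookup p w) * fword_poly (drop (length u) (letters w)))"
    unfolding left_quot_def linext_def
    by (subst sum.inter_filter) (auto intro!: sum.cong)
  also have "\<dots> = (\<Sum>v\<in>words_upto e. fconst (Poly_Mapping.lookup p (FWord (u @ v))) * fword_poly v)"
  proof (rule sum.reindex_bij_witness_not_neutral[of "{}" "{v \<in> words_upto e. FWord (u @ v) \<notin> Poly_Mapping.keys p}" _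
        "\<lambda>v. FWord (u @ v)" "\<lambda>w. drop (length u) (letters w)"])
    have *: "u @ drop (length u) (letters w) = letters w" if "take (length u) (letters w) = u" for w :: "'v fword"
      using append_take_drop_id[of "length u" "letters w"] that by simp
    fix w assume w: "w \<in> {w \<in> Poly_Mapping.keys p. take (length u) (letters w) = u}"
    show "fconst (Poly_Mapping.lookup p (FWord (u @ drop (length u) (letters w)))) * fword_poly (drop (length u) (letters w))
      = fconst (Poly_Mapping.lookup p w) * fword_poly (drop (length u) (letters w))" using w * by simp
  next
    have *: "u @ drop (length u) (letters w) = letters w" if "take (length u) (letters w) = u" for w :: "'v fword"
      using append_take_drop_id[of "length u" "letters w"] that by simp
    fix w assume w: "w \<in> {w \<in> Poly_Mapping.keys p. take (length u) (letters w) = u} - {}"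
    show "FWord (u @ drop (length u) (letters w)) = w" using w * by simp
    show "drop (length u) (letters w) \<in> words_upto e - {v \<in> words_upto e. FWord (u @ v) \<notin> Poly_Mapping.keys p}"
      using w e[of w] * by (auto simp: words_upto_def)
  qed (auto simp: in_keys_iff)
  finally show ?thesis .
qed

lemma left_quot_eq_0:
  assumes "\<And>w. w \<in> Poly_Mapping.keys p \<Longrightarrow> length (letters w) < length u"
  shows "left_quot u p = 0"
proof -
  have "take (length u) (letters w) \<noteq> u" if "w \<in> Poly_Mapping.keys p" for w
  proof
    assume "take (length u) (letters w) = u"
    then have "min (length (letters w)) (length u) = length u" by (metis length_take)
    then show False using assms[OF that] by simp
  qed
  then show ?thesis by (simp add: left_quot_def linext_def)
qed

lemma ex_degree_bound:
  fixes p :: "'g::finite \<Rightarrow> 'v fpoly"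
  obtains e where "\<And>i w. w \<in> Poly_Mapping.keys (p i) \<Longrightarrow> length (letters w) \<le> e"
proof -
  have "finite (\<Union>i. (\<lambda>w. length (letters w)) ` Poly_Mapping.keys (p i))" by simp
  then obtain e where "\<And>x. x \<in> (\<Union>i. (\<lambda>w. length (letters w)) ` Poly_Mapping.keys (p i)) \<Longrightarrow> x \<le> e"
    by (meson finite_nat_set_iff_bounded_le)
  then show thesis by (intro that[of e]) blast
qed

lemma word_eval_transpose:
  assumes X: "X \<in> mat_tuples n"
  shows "word_eval n (\<lambda>i. transpose_mat (X i)) v = transpose_mat (word_eval n X (rev v))"
proof (induction v)
  case Nil
  then show ?case by simp
next
  case (Cons i v)
  have "word_eval n X (rev (i # v)) = word_eval n X (rev v) * X i"
    using word_eval_append[OF X, of "rev v" "[i]"] mat_tuplesD[OF X, of i] by simp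
  then show ?case using Cons mat_tuplesD[OF X, of i] word_eval_carrier[OF X, of "rev v"]
    by (simp add: transpose_mult[of _ n n _ n])
qed

lemma word_corner_zero_left:
  assumes Z: "Z \<in> mat_tuples m" and H: "H \<in> rect_tuples n m"
  shows "word_corner n m (\<lambda>_. 0\<^sub>m n n) Z H (i # w) = H i * word_eval m Z w"
proof -
  have "(\<lambda>_. 0\<^sub>m n n) \<in> (mat_tuples n :: ('a \<Rightarrow> complex mat) set)" by (simp add: mat_tuples_def)
  from word_corner_carrier[OF this Z H, of w] show ?thesis
    using rect_tuplesD[OF H, of i] word_eval_carrier[OF Z, of w] by simp
qed

text \<open>
  At \<open>X = 0\<close> only the letter at the front of a word is differentiated, so \<open>H\<close> stands to the left of the
  rest of the word.
\<close>

lemma corner_at_0: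
  fixes p :: "'v::finite fpoly"
  assumes Z: "Z \<in> mat_tuples m" and H: "H \<in> rect_tuples 1 m" and s: "s < m"
    and e: "\<And>w. w \<in> Poly_Mapping.keys p \<Longrightarrow> length (letters w) \<le> Suc e"
  shows "corner 1 m (\<lambda>_. 0\<^sub>m 1 1) Z H p $$ (0, s) =
    (\<Sum>l\<in>UNIV. \<Sum>v\<in>words_upto e. Poly_Mapping.lookup p (FWord (l # v)) * (\<Sum>d<m. H l $$ (0, d) * word_eval m Z v $$ (d, s)))"
proof -
  let ?D = "\<lambda>w. word_corner 1 m (\<lambda>_. 0\<^sub>m 1 1) Z H w $$ (0, s)"
  have D: "?D (l # v) = (\<Sum>d<m. H l $$ (0, d) * word_eval m Z v $$ (d, s))" for l v
    unfolding word_corner_zero_left[OF Z H]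
    using rect_tuplesD[OF H, of l] word_eval_carrier[OF Z, of v] s
    by (simp add: scalar_prod_def lessThan_atLeast0)
  have "corner 1 m (\<lambda>_. 0\<^sub>m 1 1) Z H p $$ (0, s) = (\<Sum>w\<in>Poly_Mapping.keys p. Poly_Mapping.lookup p w * ?D (letters w))"
    using s by (simp add: corner_def)
  also have "\<dots> = (\<Sum>w\<in>words_upto (Suc e). Poly_Mapping.lookup p (FWord w) * ?D w)"
    by (rule sum.reindex_bij_witness_not_neutral[of "{}" "{w \<in> words_upto (Suc e). FWord w \<notin> Poly_Mapping.keys p}" _ FWord letters])
       (use e in \<open>auto simp: words_upto_def in_keys_iff intro: finite_subset[OF _ finite_words_upto[of "Suc e"]]\<close>)
  also have "\<dots> = (\<Sum>l\<in>UNIV. \<Sum>v\<in>words_upto e. Poly_Mapping.lookup p (FWord (l # v)) * ?D (l # v))"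
    unfolding sum_words_upto_Suc using s by simp
  finally show ?thesis unfolding D .
qed

locale bijective_map =
  fixes p :: "'g::finite \<Rightarrow> 'g fpoly" and e :: nat
  assumes bij: "free_bijective p"
    and deg: "\<And>i w. w \<in> Poly_Mapping.keys (p i) \<Longrightarrow> length (letters w) \<le> Suc e"
begin

text \<open>
  The coefficient of \<open>x\<^sub>u h\<^sub>j\<close> in the derivative of \<open>p i\<close>.
\<close>

definition jac :: "'g \<Rightarrow> 'g list \<Rightarrow> 'g \<Rightarrow> 'g fpoly" where
  "jac i u j = left_quot (u @ [j]) (p i)"

definition coef :: "'g \<Rightarrow> 'g list \<Rightarrow> complex" where
  "coef i w = Poly_Mapping.lookup (p i) (FWord w)"

lemma coef_eq_0: "length w > Suc e \<Longrightarrow> coef i w = 0"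
  using deg[of "FWord w" i] by (force simp: coef_def in_keys_iff)

lemma jac_eq_0: "length u > e \<Longrightarrow> jac i u j = 0"
  unfolding jac_def by (rule left_quot_eq_0) (use deg in fastforce)

lemma zero_tuple: "(\<lambda>_. 0\<^sub>m n n) \<in> mat_tuples n"
  by (simp add: mat_tuples_def)

text \<open>
  For matrices of size \<open>1\<close> and \<open>X = Z = 0\<close>, the derivative in direction \<open>H\<close> is the linear part of \<open>p\<close>.
\<close>

lemma ex_linear_part_inverse: "\<exists>b. \<forall>j i. (\<Sum>l\<in>UNIV. b j l * coef i [l]) = (if j = i then 1 else 0)"
proof -
  have inj: "h b = 0" if "\<And>a. (\<Sum>b\<in>UNIV. coef a [b] * h b) = 0" for h b
  proof -
    define H where "H = (\<lambda>l. mat 1 1 (\<lambda>_. h l))"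
    have H: "H \<in> rect_tuples 1 1" by (simp add: H_def rect_tuples_def)
    have z: "corner 1 1 (\<lambda>_. 0\<^sub>m 1 1) (\<lambda>_. 0\<^sub>m 1 1) H (p i) $$ (r, s) = 0" if rs: "r < 1" "s < 1" for i r s
    proof -
      have w0: "word_eval 1 (\<lambda>_. 0\<^sub>m 1 1) v $$ (0, 0) = (if v = [] then 1 else 0)" for v :: "'g list"
        using word_eval_carrier[OF zero_tuple, of 1 "tl v"] by (cases v) (auto simp: scalar_prod_def)
      have "corner 1 1 (\<lambda>_. 0\<^sub>m 1 1) (\<lambda>_. 0\<^sub>m 1 1) H (p i) $$ (0, 0)
          = (\<Sum>l\<in>UNIV. coef i [l] * h l)"
      proof (subst corner_at_0[OF zero_tuple H, where e=e])
        have "(\<Sum>v\<in>words_upto e. Poly_Mapping.lookup (p i) (FWord (l # v)) *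
            (\<Sum>d<1. H l $$ (0, d) * word_eval 1 (\<lambda>_. 0\<^sub>m 1 1) v $$ (d, 0)))
          = (\<Sum>v\<in>words_upto e. if v = ([] :: 'g list) then coef i [l] * h l else 0)" for l
          by (rule sum.cong) (auto simp: w0[unfolded One_nat_def] H_def coef_def)
        then show "(\<Sum>l\<in>UNIV. \<Sum>v\<in>words_upto e. Poly_Mapping.lookup (p i) (FWord (l # v)) *
            (\<Sum>d<1. H l $$ (0, d) * word_eval 1 (\<lambda>_. 0\<^sub>m 1 1) v $$ (d, 0))) = (\<Sum>l\<in>UNIV. coef i [l] * h l)"
          by simp
      qed (simp_all add: deg)
      then show ?thesis using rs \<open>\<And>a. (\<Sum>b\<in>UNIV. coef a [b] * h b) = 0\<close> by simp
    qed
    have "H b = 0\<^sub>m 1 1" by (rule corner_kernel[OF bij _ zero_tuple zero_tuple H z]) auto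
    then have "H b $$ (0, 0) = 0" by simp
    then show "h b = 0" by (simp add: H_def)
  qed
  have "\<exists>C. \<forall>a b. (\<Sum>c\<in>UNIV. coef a [c] * C c b) = (if a = b then 1 else 0)"
  proof (rule kernel_trivial_imp_right_inverse[of UNIV "\<lambda>a b. coef a [b]"])
    fix h b assume "\<And>a. a \<in> UNIV \<Longrightarrow> (\<Sum>b\<in>UNIV. coef a [b] * h b) = 0"
    then show "h b = 0" using inj[of h b] by simp
  next
    fix C assume C: "\<And>a b. a \<in> UNIV \<Longrightarrow> b \<in> UNIV \<Longrightarrow> (\<Sum>c\<in>UNIV. coef a [c] * C c b) = (if a = b then 1 else 0)"
    show "\<exists>C. \<forall>a b. (\<Sum>c\<in>UNIV. coef a [c] * C c b) = (if a = b then 1 else 0)"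
      by (intro exI[of _ C] allI C UNIV_I)
  qed simp
  then obtain C where C: "\<And>a b. (\<Sum>c\<in>UNIV. coef a [c] * C c b) = (if a = b then 1 else 0)" by blast
  show ?thesis
  proof (intro exI[of _ "\<lambda>j l. C l j"] allI)
    show "(\<Sum>l\<in>UNIV. C l j * coef i [l]) = (if j = i then 1 else 0)" for j i
      unfolding mult.commute[of "C _ _"] C by auto
  qed
qed

text \<open>
  For \<open>X = 0\<close> the injective map is \<open>H \<mapsto> (\<Sum>\<^sub>l H\<^sub>l Z\<^sub>v \<cdot> (coefficient of l v in p\<^sub>i))\<close>. One row \<open>H\<close> suffices,
  and after transposition the letters \<open>Z\<close> stand to the left of the column \<open>H\<close>: this is a polynomial in
  left letters with scalar coefficients. Its constant coefficient is the linear part of \<open>p\<close>, which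
  \<open>ex_linear_part_inverse\<close> allows to normalise. The inverse is a polynomial, and transposing back, that is
  reversing words, turns it into a left inverse of the constant coefficient of \<open>Dp\<close>.
\<close>

lemma ex_inverse_at_0:
  obtains F0 where "\<And>l i. (\<Sum>j\<in>UNIV. F0 l j * jac i [] j) = (if l = i then 1 else 0)"
proof -
  obtain b where b: "\<And>j i. (\<Sum>l\<in>UNIV. b j l * coef i [l]) = (if j = i then 1 else 0)"
    using ex_linear_part_inverse by blast
  \<comment> \<open>The normalised coefficients; \<open>rev\<close> comes from the transposition.\<close>
  define g where "g = (\<lambda>u j i. \<Sum>l\<in>UNIV. b j l * coef i (l # rev u))"
  define U :: "'g list \<Rightarrow> 'g \<Rightarrow> 'g \<Rightarrow> 'g fpoly" where "U = (\<lambda>u j i. fconst (g u j i))"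
  have g0: "g u j i = 0" if "length u > e" for u j i
    unfolding g_def by (rule sum.neutral) (use that coef_eq_0 in simp)
  have U0: "U [] j i = (if j = i then 1 else 0)" for j i
    by (simp add: U_def g_def b)
  have Ue: "U u j i = 0" if "length u > Suc e" for u j i
    using that g0 by (simp add: U_def)
  obtain F k where Fk: "\<And>w j i. length w \<ge> k \<Longrightarrow> F w j i = 0"
    and F: "\<And>w j i. (\<Sum>t\<le>length w. \<Sum>l\<in>UNIV. F (drop t w) j l * U (take t w) l i) = (if w = [] \<and> j = i then 1 else 0)"
  proof -
    have "\<exists>F k. (\<forall>w j i. length w \<ge> k \<longrightarrow> F w j i = 0) \<and>
      (\<forall>w j i. (\<Sum>t\<le>length w. \<Sum>l\<in>UNIV. F (drop t w) j l * U (take t w) l i) = (if w = [] \<and> j = i then 1 else 0))"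
  proof (rule left_inverse_if_pointwise_injective[of U e, OF U0 Ue])
    fix n m X Z and H :: "'g \<Rightarrow> nat \<Rightarrow> nat \<Rightarrow> complex" and r s j
    assume n: "n \<ge> 1" and m: "m \<ge> 1" and X: "X \<in> mat_tuples n" and Z: "Z \<in> (mat_tuples m :: ('g \<Rightarrow> complex mat) set)"
      and eq: "\<And>r s i. r < n \<Longrightarrow> s < m \<Longrightarrow> (\<Sum>u\<in>words_upto (Suc e). \<Sum>j\<in>UNIV. \<Sum>d<m.
            (\<Sum>c<n. word_eval n X u $$ (r, c) * H j c d) * fpoly_eval m Z (U u j i) $$ (d, s)) = 0"
      and rs: "r < n" "s < m"
    \<comment> \<open>The coefficients are scalars, so each column \<open>s\<close> of \<open>H\<close> satisfies the equation separately.\<close>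
    define h where "h = (\<lambda>l c. \<Sum>j\<in>UNIV. H j c s * b j l)"
    define H' where "H' = (\<lambda>l. mat 1 n (\<lambda>(_, c). h l c))"
    define Z' where "Z' = (\<lambda>i. transpose_mat (X i))"
    have H': "H' \<in> rect_tuples 1 n" by (simp add: H'_def rect_tuples_def)
    have Z': "Z' \<in> mat_tuples n" using X by (simp add: Z'_def mat_tuples_def)
    have ev: "word_eval n Z' v $$ (d, r) = word_eval n X (rev v) $$ (r, d)" if "d < n" "r < n" for v d r
      unfolding Z'_def word_eval_transpose[OF X] using word_eval_carrier[OF X, of "rev v"] that by simp
    have z: "corner 1 n (\<lambda>_. 0\<^sub>m 1 1) Z' H' (p i) $$ (r', r) = 0" if r: "r' < 1" "r < n" for i r' r
    proof -
      have "corner 1 n (\<lambda>_. 0\<^sub>m 1 1) Z' H' (p i) $$ (0, r)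
          = (\<Sum>l\<in>UNIV. \<Sum>v\<in>words_upto e. coef i (l # v) * (\<Sum>d<n. H' l $$ (0, d) * word_eval n Z' v $$ (d, r)))"
        unfolding coef_def by (rule corner_at_0[OF Z' H' r(2)]) (rule deg)
      also have "\<dots> = (\<Sum>l\<in>UNIV. \<Sum>u\<in>words_upto e. coef i (l # rev u) * (\<Sum>d<n. H' l $$ (0, d) * word_eval n Z' (rev u) $$ (d, r)))"
        by (rule sum.cong[OF refl], rule sum.reindex_bij_witness[of _ rev rev]) (auto simp: words_upto_def)
      also have "\<dots> = (\<Sum>l\<in>UNIV. \<Sum>u\<in>words_upto e. \<Sum>d<n. \<Sum>j\<in>UNIV. coef i (l # rev u) * (H j d s * b j l * word_eval n X u $$ (r, d)))"
        using r by (simp add: ev H'_def h_def sum_distrib_left sum_distrib_right)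
      also have "\<dots> = (\<Sum>u\<in>words_upto e. \<Sum>j\<in>UNIV. \<Sum>d<n. \<Sum>l\<in>UNIV. coef i (l # rev u) * (H j d s * b j l * word_eval n X u $$ (r, d)))"
        unfolding sum.cartesian_product
        by (rule sum.reindex_bij_witness[of _ "\<lambda>(u, j, d, l). (l, u, d, j)" "\<lambda>(l, u, d, j). (u, j, d, l)"]) auto
      also have "\<dots> = (\<Sum>u\<in>words_upto e. \<Sum>j\<in>UNIV. (\<Sum>d<n. word_eval n X u $$ (r, d) * H j d s) * g u j i)"
        unfolding g_def by (simp add: sum_distrib_left sum_distrib_right mult_ac)
      also have "\<dots> = (\<Sum>u\<in>words_upto (Suc e). \<Sum>j\<in>UNIV. (\<Sum>d<n. word_eval n X u $$ (r, d) * H j d s) * g u j i)"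
        by (rule sum.mono_neutral_left) (auto simp: words_upto_def g0 finite_words_upto[unfolded words_upto_def])
      also have "\<dots> = (\<Sum>u\<in>words_upto (Suc e). \<Sum>j\<in>UNIV. \<Sum>d<m.
            (\<Sum>c<n. word_eval n X u $$ (r, c) * H j c d) * fpoly_eval m Z (U u j i) $$ (d, s))"
      proof (intro sum.cong refl)
        fix u j
        have "(\<Sum>d<m. (\<Sum>c<n. word_eval n X u $$ (r, c) * H j c d) * fpoly_eval m Z (U u j i) $$ (d, s))
            = (\<Sum>d<m. if d = s then (\<Sum>c<n. word_eval n X u $$ (r, c) * H j c s) * g u j i else 0)"
          by (rule sum.cong) (use rs in \<open>auto simp: U_def fpoly_eval_fconst[OF Z]\<close>)
        then show "(\<Sum>d<n. word_eval n X u $$ (r, d) * H j d s) * g u j i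
          = (\<Sum>d<m. (\<Sum>c<n. word_eval n X u $$ (r, c) * H j c d) * fpoly_eval m Z (U u j i) $$ (d, s))"
          using rs by simp
      qed
      also have "\<dots> = 0" by (rule eq[OF r(2) rs(2)])
      finally show ?thesis using r by simp
    qed
    have H'0: "H' l = 0\<^sub>m 1 n" for l
      by (rule corner_kernel[OF bij _ zero_tuple Z' H' z]) simp_all
    have h0: "h l c = 0" if "c < n" for l c
    proof -
      have "H' l $$ (0, c) = 0" unfolding H'0 using that by simp
      then show ?thesis using that by (simp add: H'_def)
    qed
    have "H i r s = 0" for i
    proof -
      have "0 = (\<Sum>l\<in>UNIV. h l r * coef i [l])" using h0[OF rs(1)] by simp
      also have "\<dots> = (\<Sum>l\<in>UNIV. \<Sum>j\<in>UNIV. H j r s * (b j l * coef i [l]))"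
        by (simp add: h_def sum_distrib_right mult.assoc)
      also have "\<dots> = (\<Sum>j\<in>UNIV. H j r s * (\<Sum>l\<in>UNIV. b j l * coef i [l]))"
        by (subst sum.swap) (simp add: sum_distrib_left)
      finally show ?thesis unfolding b by (simp add: if_distrib[of "\<lambda>x. _ * x"] cong: if_cong)
    qed
    then show "H j r s = 0" .
  qed
  then show thesis using that by blast
  qed
  \<comment> \<open>The inverse that is found has coefficients in the free algebra, while those of \<open>U\<close> are scalars:
      their constant coefficients form an inverse as well.\<close>
  define f where "f = (\<lambda>w j i. counit (F w j i))"
  have fk: "f w j i = 0" if "length w > k" for w j i
    using Fk[of w j i] that by (simp add: f_def)
  have f: "(\<Sum>t\<le>length w. \<Sum>l\<in>UNIV. f (drop t w) j l * g (take t w) l i) = (if w = [] \<and> j = i then 1 else 0)" for w j i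
    using arg_cong[OF F[of w j i], of counit] by (simp add: counit_sum counit_mult U_def f_def if_distrib[of counit] cong: if_cong)
  define F0 where "F0 = (\<lambda>l a. \<Sum>w\<in>words_upto k. \<Sum>j\<in>UNIV. fconst (f w l j * b j a) * fword_poly (rev w))"
  show thesis
  proof (rule that[of F0])
    fix l i
    have cc: "fconst c * x * (fconst d * y) = fconst (c * d) * (x * y)" for c d and x y :: "'g fpoly"
    proof -
      have "x * (fconst d * y) = fconst d * (x * y)"
        by (simp only: mult.assoc[symmetric] fconst_commute[of d x])
      then show ?thesis by (simp only: fconst_mult mult.assoc)
    qed
    have Bexp: "jac i [] a = (\<Sum>u\<in>words_upto e. fconst (coef i (a # rev u)) * fword_poly (rev u))" for a
    proof -
      have "jac i [] a = (\<Sum>v\<in>words_upto e. fconst (coef i (a # v)) * fword_poly v)"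
        unfolding jac_def coef_def by (subst left_quot_expand[where e=e]) (auto dest: deg)
      also have "\<dots> = (\<Sum>u\<in>words_upto e. fconst (coef i (a # rev u)) * fword_poly (rev u))"
        by (rule sum.reindex_bij_witness[of _ rev rev]) (auto simp: words_upto_def)
      finally show ?thesis .
    qed
    have fc: "fconst (sum h A) = (\<Sum>x\<in>A. fconst (h x))" for h :: "'x \<Rightarrow> complex" and A
      by (induction A rule: infinite_finite_induct) (simp_all add: fconst_add)
    have "(\<Sum>a\<in>UNIV. F0 l a * jac i [] a) = (\<Sum>a\<in>UNIV. \<Sum>u\<in>words_upto e. \<Sum>w\<in>words_upto k. \<Sum>j\<in>UNIV.
        fconst (f w l j * (b j a * coef i (a # rev u))) * fword_poly (rev (u @ w)))"
      unfolding F0_def Bexp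
      by (simp add: sum_distrib_left sum_distrib_right cc mult.assoc[where 'a=complex])
    also have "\<dots> = (\<Sum>u\<in>words_upto e. \<Sum>w\<in>words_upto k. \<Sum>j\<in>UNIV. \<Sum>a\<in>UNIV.
        fconst (f w l j * (b j a * coef i (a # rev u))) * fword_poly (rev (u @ w)))"
      unfolding sum.cartesian_product
      by (rule sum.reindex_bij_witness[of _ "\<lambda>(u, w, j, a). (a, u, w, j)" "\<lambda>(a, u, w, j). (u, w, j, a)"]) auto
    also have "\<dots> = (\<Sum>u\<in>words_upto e. \<Sum>w\<in>words_upto k. fconst (\<Sum>j\<in>UNIV. f w l j * g u j i) * fword_poly (rev (u @ w)))"
      unfolding g_def by (simp add: fc sum_distrib_left sum_distrib_right)
    also have "\<dots> = (\<Sum>x\<in>words_upto (e + k). \<Sum>t\<le>length x. fconst (\<Sum>j\<in>UNIV. f (drop t x) l j * g (take t x) j i) * fword_poly (rev (take t x @ drop t x)))"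
      by (rule sum_words_product) (simp_all add: fk g0)
    also have "\<dots> = (\<Sum>x\<in>words_upto (e + k). fconst (\<Sum>t\<le>length x. \<Sum>j\<in>UNIV. f (drop t x) l j * g (take t x) j i) * fword_poly (rev x))"
      by (simp add: fc sum_distrib_right)
    also have "\<dots> = (\<Sum>x\<in>words_upto (e + k). if x = ([] :: 'g list) then (if l = i then 1 else 0) else 0)"
      unfolding f by (rule sum.cong) auto
    also have "\<dots> = (if l = i then 1 else 0)" by simp
    finally show "(\<Sum>j\<in>UNIV. F0 l j * jac i [] j) = (if l = i then 1 else 0)" .
  qed
qed

text \<open>
  Multiplying the coefficients of \<open>Dp\<close> by the left inverse \<open>F0\<close> of the constant one keeps the derivative
  injective at all matrix points: \<open>H\<close> is replaced by \<open>H F0\<close>, and \<open>H F0 = 0\<close> implies \<open>H = 0\<close>.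
\<close>

lemma ex_inverse_series:
  "\<exists>F k. (\<forall>w l i. length w > k \<longrightarrow> F w l i = 0) \<and>
    (\<forall>w l i. (\<Sum>t\<le>length w. \<Sum>j\<in>UNIV. F (drop t w) l j * jac i (take t w) j) = (if w = [] \<and> l = i then 1 else 0))"
proof -
  obtain F0 where F0: "\<And>l i. (\<Sum>j\<in>UNIV. F0 l j * jac i [] j) = (if l = i then 1 else 0)"
    using ex_inverse_at_0 by blast
  define U where "U = (\<lambda>u l i. \<Sum>j\<in>UNIV. F0 l j * jac i u j)"
  have U0: "U [] l i = (if l = i then 1 else 0)" for l i by (simp add: U_def F0)
  have Ue': "U u l i = 0" if "length u > e" for u l i
    unfolding U_def by (rule sum.neutral) (use that jac_eq_0 in simp)
  then have Ue: "U u l i = 0" if "length u > Suc e" for u l i using that by simp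
  have "\<exists>F k. (\<forall>w j i. length w \<ge> k \<longrightarrow> F w j i = 0) \<and>
      (\<forall>w j i. (\<Sum>t\<le>length w. \<Sum>l\<in>UNIV. F (drop t w) j l * U (take t w) l i) = (if w = [] \<and> j = i then 1 else 0))"
  proof (rule left_inverse_if_pointwise_injective[of U e, OF U0 Ue])
    fix n m X Z and H :: "'g \<Rightarrow> nat \<Rightarrow> nat \<Rightarrow> complex" and r s j
    assume n: "n \<ge> 1" and m: "m \<ge> 1" and X: "X \<in> mat_tuples n" and Z: "Z \<in> mat_tuples m"
      and eq: "\<And>r s i. r < n \<Longrightarrow> s < m \<Longrightarrow> (\<Sum>u\<in>words_upto (Suc e). \<Sum>j\<in>UNIV. \<Sum>d<m.
            (\<Sum>c<n. word_eval n X u $$ (r, c) * H j c d) * fpoly_eval m Z (U u j i) $$ (d, s)) = 0"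
      and rs: "r < n" "s < m"
    define H' where "H' = (\<lambda>j. mat n m (\<lambda>(c, d'). \<Sum>l\<in>UNIV. \<Sum>d<m. H l c d * fpoly_eval m Z (F0 l j) $$ (d, d')))"
    have H': "H' \<in> rect_tuples n m" by (simp add: H'_def rect_tuples_def)
    have UZ: "fpoly_eval m Z (U u l i) $$ (d, s) = (\<Sum>j\<in>UNIV. \<Sum>d'<m. fpoly_eval m Z (F0 l j) $$ (d, d') * fpoly_eval m Z (jac i u j) $$ (d', s))"
      if "d < m" "s < m" for u l i d s
      using that by (simp add: U_def fpoly_eval_sum_index fpoly_eval_mult_index[OF Z])
    have z: "corner n m X Z H' (p i) $$ (r, s) = 0" if r: "r < n" "s < m" for i r s
    proof -
      let ?f = "\<lambda>l j d d'. fpoly_eval m Z (F0 l j) $$ (d, d')"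
      let ?b = "\<lambda>u j d'. fpoly_eval m Z (jac i u j) $$ (d', s)"
      let ?x = "\<lambda>u c. word_eval n X u $$ (r, c)"
      have "corner n m X Z H' (p i) $$ (r, s) = (\<Sum>u\<in>words_upto e. \<Sum>j\<in>UNIV. \<Sum>d'<m. (\<Sum>c<n. ?x u c * H' j $$ (c, d')) * ?b u j d')"
        unfolding jac_def by (rule corner_expand[OF X Z H' r]) (rule deg)
      also have "\<dots> = (\<Sum>u\<in>words_upto e. \<Sum>j\<in>UNIV. \<Sum>d'<m. \<Sum>c<n. \<Sum>l\<in>UNIV. \<Sum>d<m. ?x u c * H l c d * (?f l j d d' * ?b u j d'))"
        by (simp add: H'_def sum_distrib_left sum_distrib_right mult.assoc)
      also have "\<dots> = (\<Sum>u\<in>words_upto e. \<Sum>l\<in>UNIV. \<Sum>d<m. \<Sum>j\<in>UNIV. \<Sum>d'<m. \<Sum>c<n. ?x u c * H l c d * (?f l j d d' * ?b u j d'))"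
        unfolding sum.cartesian_product
        by (rule sum.reindex_bij_witness[of _ "\<lambda>(u, l, d, j, d', c). (u, j, d', c, l, d)" "\<lambda>(u, j, d', c, l, d). (u, l, d, j, d', c)"]) auto
      also have "\<dots> = (\<Sum>u\<in>words_upto e. \<Sum>l\<in>UNIV. \<Sum>d<m. (\<Sum>c<n. ?x u c * H l c d) * fpoly_eval m Z (U u l i) $$ (d, s))"
        using r by (simp add: UZ sum_distrib_left sum_distrib_right)
      also have "\<dots> = (\<Sum>u\<in>words_upto (Suc e). \<Sum>l\<in>UNIV. \<Sum>d<m. (\<Sum>c<n. ?x u c * H l c d) * fpoly_eval m Z (U u l i) $$ (d, s))"
        using r by (intro sum.mono_neutral_left) (auto simp: words_upto_def Ue' finite_words_upto[unfolded words_upto_def])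
      also have "\<dots> = 0" by (rule eq[OF r])
      finally show ?thesis .
    qed
    have H'0: "H' l = 0\<^sub>m n m" for l
      by (rule corner_kernel[OF bij n X Z H' z])
    have "H i r s = 0" for i
    proof -
      have "(\<Sum>l\<in>UNIV. \<Sum>d<m. H l r d * fpoly_eval m Z (F0 l j) $$ (d, d')) = 0" if "d' < m" for j d'
      proof -
        have "H' j $$ (r, d') = 0" unfolding H'0 using that rs by simp
        then show ?thesis using that rs by (simp add: H'_def)
      qed
      then have "0 = (\<Sum>j\<in>UNIV. \<Sum>d'<m. (\<Sum>l\<in>UNIV. \<Sum>d<m. H l r d * fpoly_eval m Z (F0 l j) $$ (d, d')) * fpoly_eval m Z (jac i [] j) $$ (d', s))"
        by simp
      also have "\<dots> = (\<Sum>j\<in>UNIV. \<Sum>d'<m. \<Sum>l\<in>UNIV. \<Sum>d<m. H l r d * (fpoly_eval m Z (F0 l j) $$ (d, d') * fpoly_eval m Z (jac i [] j) $$ (d', s)))"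
        by (simp add: sum_distrib_right mult.assoc)
      also have "\<dots> = (\<Sum>l\<in>UNIV. \<Sum>d<m. \<Sum>j\<in>UNIV. \<Sum>d'<m. H l r d * (fpoly_eval m Z (F0 l j) $$ (d, d') * fpoly_eval m Z (jac i [] j) $$ (d', s)))"
        unfolding sum.cartesian_product
        by (rule sum.reindex_bij_witness[of _ "\<lambda>(l, d, j, d'). (j, d', l, d)" "\<lambda>(j, d', l, d). (l, d, j, d')"]) auto
      also have "\<dots> = (\<Sum>l\<in>UNIV. \<Sum>d<m. H l r d * fpoly_eval m Z (U [] l i) $$ (d, s))"
        using rs by (simp add: UZ sum_distrib_left)
      also have "\<dots> = (\<Sum>l\<in>UNIV. if l = i then H i r s else 0)"
      proof (rule sum.cong[OF refl])
        fix l
        have "(\<Sum>d<m. H l r d * fpoly_eval m Z (U [] l i) $$ (d, s)) = (\<Sum>d<m. if d = s then (if l = i then H l r s else 0) else 0)"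
          by (rule sum.cong) (use rs Z in \<open>auto simp: U0\<close>)
        then show "(\<Sum>d<m. H l r d * fpoly_eval m Z (U [] l i) $$ (d, s)) = (if l = i then H i r s else 0)"
          using rs by simp
      qed
      finally show ?thesis by simp
    qed
    then show "H j r s = 0" .
  qed
  then obtain G k where Gk: "\<And>w j i. length w \<ge> k \<Longrightarrow> G w j i = 0"
    and G: "\<And>w j i. (\<Sum>t\<le>length w. \<Sum>l\<in>UNIV. G (drop t w) j l * U (take t w) l i) = (if w = [] \<and> j = i then 1 else 0)"
    by blast
  define F where "F = (\<lambda>w l i. \<Sum>a\<in>UNIV. G w l a * F0 a i)"
  show ?thesis
  proof (intro exI[of _ F] exI[of _ k] conjI allI impI)
    show "F w l i = 0" if "length w > k" for w l i using that Gk by (simp add: F_def)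
    fix w l i
    have "(\<Sum>j\<in>UNIV. F v l j * jac i u j) = (\<Sum>a\<in>UNIV. G v l a * U u a i)" for u v
      unfolding F_def U_def sum_distrib_left sum_distrib_right
      by (subst sum.swap) (simp add: mult.assoc)
    then show "(\<Sum>t\<le>length w. \<Sum>j\<in>UNIV. F (drop t w) l j * jac i (take t w) j) = (if w = [] \<and> l = i then 1 else 0)"
      by (simp add: G)
  qed
qed

text \<open>
  Reading the left inverse \<open>F\<close> as the tensors \<open>\<Sum> x\<^sub>w h\<^sub>l F\<^sub>w\<close> yields the \<open>h\<close>-components of a mapping \<open>Q\<close>
  with \<open>Dp(x)[Q(h, x)] = h\<close>. The other composition is the identity because \<open>H \<mapsto> Dp(X)[H]\<close> is injective
  at all matrix points \<open>X\<close>, and matrix points detect equality of polynomials.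
\<close>

theorem has_polynomial_inverse_deriv_map: "has_polynomial_inverse (deriv_map p)"
proof -
  obtain F k where Fk: "\<And>w l i. length w > k \<Longrightarrow> F w l i = 0"
    and F: "\<And>w l i. (\<Sum>t\<le>length w. \<Sum>j\<in>UNIV. F (drop t w) l j * jac i (take t w) j) = (if w = [] \<and> l = i then 1 else 0)"
    using ex_inverse_series by blast
  let ?\<iota> = "fsubst xvar :: 'g fpoly \<Rightarrow> ('g + 'g) fpoly"
  define Qh where "Qh = (\<lambda>i. \<Sum>w\<in>words_upto k. \<Sum>l\<in>UNIV. ?\<iota> (fword_poly w) * hvar l * ?\<iota> (F w l i))"
  define Q where "Q = case_sum Qh xvar"
  have Q\<iota>: "fsubst Q (?\<iota> f) = ?\<iota> f" for f
    by (simp add: fsubst_fsubst Q_def)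
  have QF: "fsubst Q (fderiv (p i)) = hvar i" for i
  proof -
    have "fsubst Q (fderiv (p i)) = (\<Sum>u\<in>words_upto e. \<Sum>j\<in>UNIV. ?\<iota> (fword_poly u) * Qh j * ?\<iota> (jac i u j))"
      by (subst fderiv_expand[where e=e]) (auto simp: deg jac_def fsubst_sum fsubst_mult Q\<iota>, simp add: Q_def)
    also have "\<dots> = (\<Sum>u\<in>words_upto e. \<Sum>j\<in>UNIV. \<Sum>w\<in>words_upto k. \<Sum>l\<in>UNIV.
        ?\<iota> (fword_poly (u @ w)) * hvar l * ?\<iota> (F w l j * jac i u j))"
      by (simp add: Qh_def sum_distrib_left sum_distrib_right fsubst_mult mult.assoc)
    also have "\<dots> = (\<Sum>u\<in>words_upto e. \<Sum>w\<in>words_upto k. \<Sum>l\<in>UNIV. \<Sum>j\<in>UNIV.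
        ?\<iota> (fword_poly (u @ w)) * hvar l * ?\<iota> (F w l j * jac i u j))"
      unfolding sum.cartesian_product
      by (rule sum.reindex_bij_witness[of _ "\<lambda>(u, w, l, j). (u, j, w, l)" "\<lambda>(u, j, w, l). (u, w, l, j)"]) auto
    also have "\<dots> = (\<Sum>u\<in>words_upto e. \<Sum>w\<in>words_upto k. \<Sum>l\<in>UNIV.
        ?\<iota> (fword_poly (u @ w)) * hvar l * ?\<iota> (\<Sum>j\<in>UNIV. F w l j * jac i u j))"
      by (simp only: fsubst_sum sum_distrib_left)
    also have "\<dots> = (\<Sum>x\<in>words_upto (e + k). \<Sum>t\<le>length x. \<Sum>l\<in>UNIV.
        ?\<iota> (fword_poly (take t x @ drop t x)) * hvar l * ?\<iota> (\<Sum>j\<in>UNIV. F (drop t x) l j * jac i (take t x) j))"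
      by (rule sum_words_product) (simp_all add: Fk jac_eq_0)
    also have "\<dots> = (\<Sum>x\<in>words_upto (e + k). \<Sum>l\<in>UNIV. \<Sum>t\<le>length x.
        ?\<iota> (fword_poly x) * hvar l * ?\<iota> (\<Sum>j\<in>UNIV. F (drop t x) l j * jac i (take t x) j))"
      unfolding append_take_drop_id by (rule sum.cong[OF refl sum.swap])
    also have "\<dots> = (\<Sum>x\<in>words_upto (e + k). \<Sum>l\<in>UNIV.
        ?\<iota> (fword_poly x) * hvar l * ?\<iota> (\<Sum>t\<le>length x. \<Sum>j\<in>UNIV. F (drop t x) l j * jac i (take t x) j))"
      by (simp only: fsubst_sum sum_distrib_left)
    also have "\<dots> = (\<Sum>x\<in>words_upto (e + k). if x = ([] :: 'g list) then (\<Sum>l\<in>UNIV. if l = i then hvar i else 0) else 0)"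
      unfolding F by (intro sum.cong refl) (auto simp: if_distrib[of "fsubst xvar"]
          if_distrib[of "\<lambda>x. _ * x"] cong: if_cong)
    also have "\<dots> = hvar i" by simp
    finally show ?thesis .
  qed
  have FQ: "fsubst (deriv_map p) (Qh i) = hvar i" for i
  proof -
    have "fsubst (deriv_map p) (Qh i) - hvar i = 0"
    proof (rule fpoly_eq_0_if_vanishing)
      fix n and Y :: "'g + 'g \<Rightarrow> complex mat" assume n: "n \<ge> 1" and Y: "Y \<in> mat_tuples n"
      define X H where "X = (\<lambda>i. Y (Inr i))" and "H = (\<lambda>i. Y (Inl i))"
      have X: "X \<in> mat_tuples n" and H: "H \<in> mat_tuples n" using Y by (simp_all add: X_def H_def mat_tuples_def)
      have YHX: "Y = case_sum H X" by (auto simp: X_def H_def split: sum.splits)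
      define K where "K = (\<lambda>i. corner n n X X H (p i))"
      define H' where "H' = (\<lambda>i. fpoly_eval n (case_sum K X) (Qh i))"
      have K: "K \<in> mat_tuples n" and H': "H' \<in> mat_tuples n" by (simp_all add: K_def H'_def mat_tuples_def)
      have KX: "case_sum K X \<in> mat_tuples n" using K X by (auto simp: mat_tuples_def split: sum.splits)
      have "(\<lambda>v. fpoly_eval n (case_sum K X) (Q v)) = case_sum H' X"
        using KX by (auto simp: Q_def H'_def fpoly_eval_fvar split: sum.splits)
      then have "corner n n X X H' (p i) = corner n n X X H (p i)" for i
        using fpoly_eval_fsubst[OF KX, of Q "fderiv (p i)"] KX
        by (simp add: QF fpoly_eval_fderiv[OF X H'] fpoly_eval_fvar K_def)
      then have HH: "H' = H"
        using corner_injective[OF bij n X X, of H' H] H H' by (simp add: mat_tuples_def rect_tuples_def)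
      have "(\<lambda>v. fpoly_eval n Y (deriv_map p v)) = case_sum K X"
        using Y by (auto simp: deriv_map_def YHX fpoly_eval_fderiv[OF X H] K_def fpoly_eval_fvar[OF Y[unfolded YHX]] split: sum.splits)
      then have "fpoly_eval n Y (fsubst (deriv_map p) (Qh i)) = fpoly_eval n Y (hvar i)"
        using fpoly_eval_fsubst[OF Y, of "deriv_map p" "Qh i"] HH Y
        by (simp add: H'_def fpoly_eval_fvar) (metis H_def)
      moreover have "fpoly_eval n Y (fsubst (deriv_map p) (Qh i) - hvar i) + fpoly_eval n Y (hvar i) = fpoly_eval n Y (fsubst (deriv_map p) (Qh i))"
        by (simp flip: fpoly_eval_add)
      ultimately have *: "fpoly_eval n Y (fsubst (deriv_map p) (Qh i) - hvar i) + fpoly_eval n Y (hvar i) = fpoly_eval n Y (hvar i)"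
        by simp
      show "fpoly_eval n Y (fsubst (deriv_map p) (Qh i) - hvar i) = 0\<^sub>m n n"
      proof (rule eq_matI)
        fix r s assume "r < dim_row (0\<^sub>m n n :: complex mat)" "s < dim_col (0\<^sub>m n n :: complex mat)"
        then show "fpoly_eval n Y (fsubst (deriv_map p) (Qh i) - hvar i) $$ (r, s) = 0\<^sub>m n n $$ (r, s)"
          using arg_cong[OF *, of "\<lambda>A. A $$ (r, s)"] by simp
      qed simp_all
    qed
    then show ?thesis by simp
  qed
  show ?thesis
    unfolding has_polynomial_inverse_def
  proof (intro exI[of _ Q] conjI allI)
    show "fsubst Q (deriv_map p v) = fvar v" for v
      by (cases v) (simp_all add: deriv_map_def QF, simp add: Q_def)
    show "fsubst (deriv_map p) (Q v) = fvar v" for v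
      by (cases v) (simp_all add: Q_def FQ, simp add: deriv_map_def)
  qed
qed

end

lemma bijective_imp_deriv_map_invertible:
  fixes p :: "'g::finite \<Rightarrow> 'g fpoly"
  assumes "free_bijective p"
  shows "has_polynomial_inverse (deriv_map p)"
proof -
  obtain e where e: "\<And>i w. w \<in> Poly_Mapping.keys (p i) \<Longrightarrow> length (letters w) \<le> e"
    using ex_degree_bound by blast
  interpret bijective_map p e
    by unfold_locales (use assms e le_SucI in blast)+
  show ?thesis by (rule has_polynomial_inverse_deriv_map)
qed

section \<open>The order filtration\<close>

definition order_ge :: "nat \<Rightarrow> 'v fpoly \<Rightarrow> bool" where
  "order_ge k f \<longleftrightarrow> (\<forall>w\<in>Poly_Mapping.keys f. k \<le> length (letters w))"

lemma order_ge_0 [simp]: "order_ge k 0"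
  by (simp add: order_ge_def)

lemma order_ge_add: "order_ge k f \<Longrightarrow> order_ge k g \<Longrightarrow> order_ge k (f + g)"
  using Poly_Mapping.keys_add[of f g] by (auto simp: order_ge_def)

lemma order_ge_sum: "(\<And>x. x \<in> A \<Longrightarrow> order_ge k (f x)) \<Longrightarrow> order_ge k (sum f A)"
  by (induction A rule: infinite_finite_induct) (auto intro: order_ge_add)

lemma order_ge_uminus: "order_ge k f \<Longrightarrow> order_ge k (- f)"
  by (simp add: order_ge_def)

lemma sum_singles: "(\<Sum>w\<in>Poly_Mapping.keys f. Poly_Mapping.single w (Poly_Mapping.lookup f w)) = (f :: 'v fpoly)"
proof (rule poly_mapping_eqI)
  fix w
  have "Poly_Mapping.lookup (\<Sum>w\<in>Poly_Mapping.keys f. Poly_Mapping.single w (Poly_Mapping.lookup f w)) w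
      = (\<Sum>v\<in>Poly_Mapping.keys f. if v = w then Poly_Mapping.lookup f w else 0)"
    unfolding lookup_sum by (rule sum.cong) (auto simp: lookup_single when_def)
  also have "\<dots> = Poly_Mapping.lookup f w" by (simp add: in_keys_iff)
  finally show "Poly_Mapping.lookup (\<Sum>w\<in>Poly_Mapping.keys f. Poly_Mapping.single w (Poly_Mapping.lookup f w)) w
      = Poly_Mapping.lookup f w" .
qed

lemma order_ge_mult: "order_ge k f \<Longrightarrow> order_ge l g \<Longrightarrow> order_ge (k + l) (f * g)"
proof -
  assume f: "order_ge k f" and g: "order_ge l g"
  have "f * g = (\<Sum>u\<in>Poly_Mapping.keys f. \<Sum>v\<in>Poly_Mapping.keys g.
      Poly_Mapping.single (u + v) (Poly_Mapping.lookup f u * Poly_Mapping.lookup g v))"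
    unfolding mult_single[symmetric] sum_product[symmetric] sum_singles ..
  also have "order_ge (k + l) \<dots>"
    by (intro order_ge_sum) (use f g in \<open>auto simp: order_ge_def intro: add_mono\<close>)
  finally show ?thesis .
qed

lemma order_ge_any [simp]: "order_ge 0 f"
  by (simp add: order_ge_def)

lemma order_ge_mono: "order_ge k f \<Longrightarrow> l \<le> k \<Longrightarrow> order_ge l f"
  by (auto simp: order_ge_def)

lemma order_ge_mult_left: "order_ge k g \<Longrightarrow> order_ge k (f * g)"
  using order_ge_mult[of 0 f k g] by simp

lemma order_ge_mult_right: "order_ge k f \<Longrightarrow> order_ge k (f * g)"
  using order_ge_mult[of k f 0 g] by simp

lemma order_ge_1_iff: "order_ge (Suc 0) f \<longleftrightarrow> counit f = 0"
proof -
  have "0 \<notin> Poly_Mapping.keys f" if "order_ge (Suc 0) f" using that by (force simp: order_ge_def)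
  moreover have "Suc 0 \<le> length (letters w)" if "0 \<notin> Poly_Mapping.keys f" "w \<in> Poly_Mapping.keys f" for w
    using that by (cases w) (auto simp: zero_fword_def Suc_le_eq)
  ultimately show ?thesis by (auto simp: counit_def order_ge_def in_keys_iff)
qed

lemma order_ge_all_imp_0: "(\<And>k. order_ge k f) \<Longrightarrow> f = 0"
proof (rule ccontr)
  assume k: "\<And>k. order_ge k f" and "f \<noteq> 0"
  then obtain w where "w \<in> Poly_Mapping.keys f" by fastforce
  then show False using k[of "Suc (length (letters w))"] by (force simp: order_ge_def)
qed

lemma lookup_left_quot: "Poly_Mapping.lookup (left_quot u f) w = Poly_Mapping.lookup f (FWord (u @ letters w))"
proof (induction f rule: fpoly_induct)
  case (single k c)
  have *: "fconst c * fword_poly v = Poly_Mapping.single (FWord v) c" for v :: "'a list"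
    by (rule single_FWord[symmetric])
  have "left_quot u (Poly_Mapping.single k c) = (if take (length u) (letters k) = u then Poly_Mapping.single (FWord (drop (length u) (letters k))) c else 0)"
    by (simp add: left_quot_def linext_single *)
  moreover have "k = FWord (u @ letters w) \<longleftrightarrow> take (length u) (letters k) = u \<and> FWord (drop (length u) (letters k)) = w"
    by (cases k; cases w) (metis append_eq_conv_conj fword.inject fword.sel)
  ultimately show ?case by (auto simp: lookup_single when_def)
next
  case (sum p q)
  then show ?case by (simp add: left_quot_def linext_add lookup_add)
qed

lemma first_letter_decomp:
  fixes f :: "'v::finite fpoly"
  shows "f = fconst (counit f) + (\<Sum>i\<in>UNIV. fvar i * left_quot [i] f)"
proof (induction f rule: fpoly_word_induct)
  case (add p q)
  have "left_quot u (p + q) = left_quot u p + left_quot u q" for u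
    by (simp add: left_quot_def linext_add)
  then have "fconst (counit (p + q)) + (\<Sum>i\<in>UNIV. fvar i * left_quot [i] (p + q)) =
     (fconst (counit p) + (\<Sum>i\<in>UNIV. fvar i * left_quot [i] p)) + (fconst (counit q) + (\<Sum>i\<in>UNIV. fvar i * left_quot [i] q))"
    by (simp add: counit_add fconst_add distrib_left sum.distrib)
  with add show ?case by simp
next
  case (scale c p)
  have "left_quot u (fconst c * p) = fconst c * left_quot u p" for u
    by (simp add: left_quot_def linext_fconst_mult)
  moreover have "fvar i * (fconst c * g) = fconst c * (fvar i * g)" for i and g :: "'v fpoly"
    by (simp only: mult.assoc[symmetric] fconst_commute[of c "fvar i"])
  ultimately have "fconst (counit (fconst c * p)) + (\<Sum>i\<in>UNIV. fvar i * left_quot [i] (fconst c * p)) =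
     fconst c * (fconst (counit p) + (\<Sum>i\<in>UNIV. fvar i * left_quot [i] p))"
    by (simp add: counit_mult fconst_mult distrib_left sum_distrib_left)
  with scale show ?case by simp
next
  case one
  have "left_quot [i] (1 :: 'v fpoly) = 0" for i
    by (rule left_quot_eq_0) simp
  then show ?case by simp
next
  case (var v p)
  have "left_quot [i] (fvar v * p) = (if i = v then p else 0)" for i
  proof (rule poly_mapping_eqI)
    fix w
    show "Poly_Mapping.lookup (left_quot [i] (fvar v * p)) w = Poly_Mapping.lookup (if i = v then p else 0) w"
    proof (induction p rule: fpoly_induct)
      case (single k c)
      have "FWord (v # letters k) = FWord (i # letters w) \<longleftrightarrow> i = v \<and> k = w"
        by (cases k; cases w) auto
      then show ?case
        unfolding lookup_left_quot by (auto simp: fvar_def mult_single lookup_single when_def plus_fword_def)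
    next
      case (sum p q)
      then show ?case unfolding lookup_left_quot by (auto simp: distrib_left lookup_add)
    qed
  qed
  then show ?case by (simp add: counit_mult if_distrib[of "\<lambda>x. _ * x"] cong: if_cong)
qed

lemma order_ge_left_quot: "order_ge (Suc k) f \<Longrightarrow> order_ge k (left_quot [i] f)"
  unfolding order_ge_def
proof
  fix w assume f: "\<forall>w\<in>Poly_Mapping.keys f. Suc k \<le> length (letters w)"
    and w: "w \<in> Poly_Mapping.keys (left_quot [i] f)"
  then have "FWord (i # letters w) \<in> Poly_Mapping.keys f" by (simp add: in_keys_iff lookup_left_quot)
  with f show "k \<le> length (letters w)" by force
qed

lemma order_ge_fvar: "order_ge (Suc 0) (fvar v)"
  unfolding order_ge_1_iff by simp

section \<open>Contractions of tensors and the transported derivation\<close>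

text \<open>
  A polynomial in \<open>h\<close> and \<open>x\<close> that is linear in \<open>h\<close> stands for tensors: \<open>f h\<^sub>j g\<close> is the element
  \<open>f \<otimes> g\<close> of the \<open>j\<close>-th copy of \<open>A \<otimes> A\<close>. The operations below send \<open>f h\<^sub>j g\<close> to \<open>\<phi>(f) g\<close>
  (\<open>contract_left\<close>), \<open>f \<psi>(g)\<close> (\<open>contract_right\<close>) and \<open>f(0) x\<^sub>j g\<close> (\<open>collapse\<close>). In order to be defined
  everywhere and recursive in words, they use the first \<open>h\<close> of a word as the separator and
  \<open>proj_x\<close>, which sets \<open>h = 0\<close>, for what follows; words without an \<open>h\<close>, or with two, are mapped to \<open>0\<close>.
\<close>

definition proj_x :: "('v + 'v) fpoly \<Rightarrow> 'v fpoly" where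
  "proj_x = fsubst (case_sum (\<lambda>_. 0) fvar)"

lemma proj_x_simps [simp]:
  "proj_x (a + b) = proj_x a + proj_x b" "proj_x (a * b) = proj_x a * proj_x b"
  "proj_x (fconst c) = fconst c" "proj_x 1 = 1" "proj_x 0 = 0"
  "proj_x (hvar i) = 0" "proj_x (xvar i) = fvar i"
  by (simp_all add: proj_x_def fsubst_add fsubst_mult)

abbreviation incl_x :: "'v fpoly \<Rightarrow> ('v + 'v) fpoly" where
  "incl_x \<equiv> fsubst xvar"

lemma proj_incl [simp]: "proj_x (incl_x f) = f"
  by (simp add: proj_x_def fsubst_fsubst)

primrec contract_left_word :: "'v \<Rightarrow> ('v + 'v) list \<Rightarrow> ('v fpoly \<Rightarrow> complex) \<Rightarrow> 'v fpoly" where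
  "contract_left_word j [] \<phi> = 0"
| "contract_left_word j (x # w) \<phi> = (case x of
      Inl k \<Rightarrow> if k = j then fconst (\<phi> 1) * proj_x (fword_poly w) else 0
    | Inr i \<Rightarrow> contract_left_word j w (\<lambda>f. \<phi> (fvar i * f)))"

primrec contract_right_word :: "'v \<Rightarrow> ('v fpoly \<Rightarrow> complex) \<Rightarrow> ('v + 'v) list \<Rightarrow> 'v fpoly" where
  "contract_right_word j \<psi> [] = 0"
| "contract_right_word j \<psi> (x # w) = (case x of
      Inl k \<Rightarrow> if k = j then fconst (\<psi> (proj_x (fword_poly w))) else 0
    | Inr i \<Rightarrow> fvar i * contract_right_word j \<psi> w)"

primrec collapse_word :: "('v + 'v) list \<Rightarrow> 'v fpoly" where
  "collapse_word [] = 0"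
| "collapse_word (x # w) = (case x of Inl k \<Rightarrow> fvar k * proj_x (fword_poly w) | Inr i \<Rightarrow> 0)"

definition contract_left :: "'v \<Rightarrow> ('v fpoly \<Rightarrow> complex) \<Rightarrow> ('v + 'v) fpoly \<Rightarrow> 'v fpoly" where
  "contract_left j \<phi> = linext (\<lambda>w. contract_left_word j (letters w) \<phi>)"

definition contract_right :: "'v \<Rightarrow> ('v fpoly \<Rightarrow> complex) \<Rightarrow> ('v + 'v) fpoly \<Rightarrow> 'v fpoly" where
  "contract_right j \<psi> = linext (\<lambda>w. contract_right_word j \<psi> (letters w))"

definition collapse :: "('v + 'v) fpoly \<Rightarrow> 'v fpoly" where
  "collapse = linext (\<lambda>w. collapse_word (letters w))"

definition flinear :: "('v fpoly \<Rightarrow> complex) \<Rightarrow> bool" where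
  "flinear \<phi> \<longleftrightarrow> (\<forall>a b. \<phi> (a + b) = \<phi> a + \<phi> b) \<and> (\<forall>c a. \<phi> (fconst c * a) = c * \<phi> a)"

lemma flinear_add: "flinear \<phi> \<Longrightarrow> \<phi> (a + b) = \<phi> a + \<phi> b"
  and flinear_scale: "flinear \<phi> \<Longrightarrow> \<phi> (fconst c * a) = c * \<phi> a"
  by (auto simp: flinear_def)

lemma fconst_left_commute: "a * (fconst c * b) = fconst c * (a * b)"
  by (simp only: mult.assoc[symmetric] fconst_commute[of c a])

lemma flinear_mult: "flinear \<phi> \<Longrightarrow> flinear (\<lambda>f. \<phi> (g * f))"
  by (simp add: flinear_def distrib_left fconst_left_commute)

lemma flinear_counit: "flinear counit"
  by (simp add: flinear_def counit_add counit_mult)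

lemma contract_left_add: "contract_left j \<phi> (a + b) = contract_left j \<phi> a + contract_left j \<phi> b"
  and contract_left_scale: "contract_left j \<phi> (fconst c * a) = fconst c * contract_left j \<phi> a"
  and contract_right_add: "contract_right j \<psi> (a + b) = contract_right j \<psi> a + contract_right j \<psi> b"
  and contract_right_scale: "contract_right j \<psi> (fconst c * a) = fconst c * contract_right j \<psi> a"
  and collapse_add: "collapse (a + b) = collapse a + collapse b"
  and collapse_scale: "collapse (fconst c * a) = fconst c * collapse a"
  by (simp_all add: contract_left_def contract_right_def collapse_def linext_add linext_fconst_mult)

lemma linext_0 [simp]: "linext f 0 = 0"
  by (simp add: linext_def)

lemma contract_left_1 [simp]: "contract_left j \<phi> 1 = 0" and contract_right_1 [simp]: "contract_right j \<psi> 1 = 0" and collapse_1 [simp]: "collapse 1 = 0"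
  using linext_single[of "\<lambda>w. contract_left_word j (letters w) \<phi>" 0 1] linext_single[of "\<lambda>w. contract_right_word j \<psi> (letters w)" 0 1]
    linext_single[of "\<lambda>w. collapse_word (letters w)" 0 1]
  by (simp_all add: contract_left_def contract_right_def collapse_def)

lemma contract_left_0 [simp]: "contract_left j \<phi> 0 = 0" and contract_right_0 [simp]: "contract_right j \<psi> 0 = 0" and collapse_0 [simp]: "collapse 0 = 0"
  by (simp_all add: contract_left_def contract_right_def collapse_def)

lemma fvar_mult_single: "fvar x * Poly_Mapping.single (FWord w) c = Poly_Mapping.single (FWord (x # w)) c"
  by (simp add: fvar_def mult_single plus_fword_def)

lemma linext_fvar_mult:
  assumes "\<And>w. f (FWord (x # w)) = g (FWord w)"
  shows "linext f (fvar x * a) = linext g a"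
proof (induction a rule: fpoly_induct)
  case (single k c)
  then show ?case using assms[of "letters k"] fvar_mult_single[of x "letters k" c]
    by (simp add: linext_single)
next
  case (sum p q)
  then show ?case by (simp add: distrib_left linext_add)
qed

lemma proj_x_linext: "proj_x a = linext (\<lambda>w. proj_x (fword_poly (letters w))) a"
proof (induction a rule: fpoly_induct)
  case (single k c)
  have "proj_x (Poly_Mapping.single k c) = fconst c * proj_x (fword_poly (letters k))"
    using single_FWord[of "letters k" c] by simp
  then show ?case by (simp add: linext_single)
next
  case (sum p q)
  then show ?case by (simp add: linext_add)
qed

lemma linext_cmult: "linext (\<lambda>w. b * f w) a = b * linext f a"
  by (simp add: linext_def sum_distrib_left fconst_left_commute)

lemma contract_left_xvar: "contract_left j \<phi> (xvar i * a) = contract_left j (\<lambda>f. \<phi> (fvar i * f)) a"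
  unfolding contract_left_def by (rule linext_fvar_mult) simp

lemma contract_left_hvar: "contract_left j \<phi> (hvar k * a) = (if k = j then fconst (\<phi> 1) * proj_x a else 0)"
proof -
  have "contract_left j \<phi> (hvar k * a) = linext (\<lambda>w. (if k = j then fconst (\<phi> 1) else 0) * proj_x (fword_poly (letters w))) a"
    unfolding contract_left_def by (rule linext_fvar_mult) simp
  then show ?thesis unfolding linext_cmult proj_x_linext[symmetric] by simp
qed

lemma contract_right_xvar: "contract_right j \<psi> (xvar i * a) = fvar i * contract_right j \<psi> a"
proof -
  have "contract_right j \<psi> (xvar i * a) = linext (\<lambda>w. fvar i * contract_right_word j \<psi> (letters w)) a"
    unfolding contract_right_def by (rule linext_fvar_mult) simp
  then show ?thesis by (simp add: linext_cmult contract_right_def)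
qed

lemma contract_right_hvar:
  assumes "flinear \<psi>"
  shows "contract_right j \<psi> (hvar k * a) = (if k = j then fconst (\<psi> (proj_x a)) else 0)"
proof -
  have "contract_right j \<psi> (hvar k * a) = linext (\<lambda>w. if k = j then fconst (\<psi> (proj_x (fword_poly (letters w)))) else 0) a"
    unfolding contract_right_def by (rule linext_fvar_mult) simp
  moreover have "linext (\<lambda>w. fconst (\<psi> (proj_x (fword_poly (letters w))))) a = fconst (\<psi> (proj_x a))"
  proof (induction a rule: fpoly_induct)
    case (single k c)
    have "proj_x (Poly_Mapping.single k c) = fconst c * proj_x (fword_poly (letters k))"
      using single_FWord[of "letters k" c] by simp
    then show ?case using assms by (simp add: linext_single fconst_mult flinear_scale)
  next
    case (sum p q)
    then show ?case using assms by (simp add: linext_add flinear_add fconst_add)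
  qed
  moreover have "linext (\<lambda>w. 0) a = 0" by (simp add: linext_def)
  ultimately show ?thesis by auto
qed

lemma collapse_xvar: "collapse (xvar i * a) = 0"
proof -
  have "collapse (xvar i * a) = linext (\<lambda>w. 0) a"
    unfolding collapse_def by (rule linext_fvar_mult) simp
  then show ?thesis by (simp add: linext_def)
qed

lemma collapse_hvar: "collapse (hvar k * a) = fvar k * proj_x a"
proof -
  have "collapse (hvar k * a) = linext (\<lambda>w. fvar k * proj_x (fword_poly (letters w))) a"
    unfolding collapse_def by (rule linext_fvar_mult) simp
  then show ?thesis unfolding linext_cmult proj_x_linext[symmetric] .
qed

lemma contract_left_functional_add: "contract_left j (\<lambda>f. \<phi> f + \<phi>' f) a = contract_left j \<phi> a + contract_left j \<phi>' a"
proof -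
  have "contract_left_word j w (\<lambda>f. \<phi> f + \<phi>' f) = contract_left_word j w \<phi> + contract_left_word j w \<phi>'" for w
    by (induction w arbitrary: \<phi> \<phi>') (auto split: sum.splits simp: fconst_add distrib_right)
  then show ?thesis by (simp add: contract_left_def linext_def distrib_left sum.distrib)
qed

lemma contract_left_functional_scale: "contract_left j (\<lambda>f. c * \<phi> f) a = fconst c * contract_left j \<phi> a"
proof -
  have "contract_left_word j w (\<lambda>f. c * \<phi> f) = fconst c * contract_left_word j w \<phi>" for w
    by (induction w arbitrary: \<phi>) (auto split: sum.splits simp: fconst_mult mult.assoc)
  then show ?thesis unfolding contract_left_def by (simp add: linext_cmult)
qed

lemma contract_left_functional_0 [simp]: "contract_left j (\<lambda>f. 0) a = 0"
  using contract_left_functional_scale[of j 0 "\<lambda>_. 0" a] by simp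

lemma contract_left_incl_mult:
  assumes "flinear \<phi>"
  shows "contract_left j \<phi> (incl_x f * a) = contract_left j (\<lambda>g. \<phi> (f * g)) a"
  using assms
proof (induction f arbitrary: \<phi> rule: fpoly_word_induct)
  case (add p q)
  then show ?case by (simp add: fsubst_add distrib_right contract_left_add flinear_add contract_left_functional_add)
next
  case (scale c p)
  then show ?case by (simp add: fsubst_mult mult.assoc contract_left_scale flinear_scale contract_left_functional_scale)
next
  case one
  then show ?case by simp
next
  case (var v p)
  then show ?case by (simp add: fsubst_mult mult.assoc contract_left_xvar flinear_mult)
qed

lemma contract_left_incl: "contract_left j \<phi> (incl_x f) = 0"
  by (induction f arbitrary: \<phi> rule: fpoly_word_induct) (simp_all add: fsubst_add fsubst_mult contract_left_add contract_left_scale contract_left_xvar)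

lemma contract_left_mult_incl: "contract_left j \<phi> (a * incl_x f) = contract_left j \<phi> a * f"
proof (induction a arbitrary: \<phi> rule: fpoly_word_induct)
  case (var v p)
  then show ?case by (cases v) (simp_all add: mult.assoc contract_left_xvar contract_left_hvar)
qed (simp_all add: distrib_right contract_left_add contract_left_scale contract_left_incl mult.assoc)

lemma contract_right_incl_mult: "contract_right j \<psi> (incl_x f * a) = f * contract_right j \<psi> a"
  by (induction f rule: fpoly_word_induct) (simp_all add: fsubst_add fsubst_mult distrib_right contract_right_add contract_right_scale contract_right_xvar mult.assoc)

text \<open>
  So \<open>collapse\<close> is a derivation over the homomorphisms \<open>f(0)\<close> on the left and \<open>proj_x\<close> on the right.
\<close>

lemma collapse_mult: "collapse (a * b) = collapse a * proj_x b + fconst (counit (proj_x a)) * collapse b"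
proof (induction a rule: fpoly_word_induct)
  case (var v p)
  then show ?case by (cases v) (simp_all add: mult.assoc collapse_xvar collapse_hvar counit_mult)
qed (simp_all add: distrib_right distrib_left collapse_add collapse_scale mult.assoc counit_add counit_mult fconst_add fconst_mult)

lemma fderiv_fconst [simp]: "fderiv (fconst c) = 0"
  using fderiv_fconst_mult[of c 1] by (simp add: fderiv_1)

lemma proj_fderiv [simp]: "proj_x (fderiv f) = 0"
  by (induction f rule: fpoly_word_induct) (simp_all add: fderiv_add fderiv_fconst_mult fderiv_1 fderiv_mult fderiv_fvar)

text \<open>
  In \<open>D\<close> of a word, only the term that differentiates the first letter survives, and it gives
  back the word.
\<close>

lemma collapse_fderiv: "collapse (fderiv f) = f - fconst (counit f)"
  by (induction f rule: fpoly_word_induct)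
     (simp_all add: fderiv_add fderiv_fconst_mult fderiv_1 fderiv_mult fderiv_fvar collapse_add collapse_scale
       collapse_hvar collapse_xvar counit_add counit_mult fconst_add fconst_mult right_diff_distrib)

text \<open>
  A mapping without constant terms together with the inverse \<open>Q\<close> of its derivative mapping.
\<close>

locale deriv_invertible =
  fixes p :: "'g::finite \<Rightarrow> 'g fpoly" and Q :: "'g + 'g \<Rightarrow> ('g + 'g) fpoly"
  assumes counit_p [simp]: "counit (p i) = 0"
    and QF: "fsubst Q (deriv_map p v) = fvar v"
    and FQ: "fsubst (deriv_map p) (Q v) = fvar v"
begin

lemma Q_Inr: "Q (Inr i) = xvar i"
  using QF[of "Inr i"] by (simp add: deriv_map_def)

lemma Q_incl: "fsubst Q (incl_x f) = incl_x f"
  by (simp add: fsubst_fsubst Q_Inr)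

text \<open>
  The derivation over \<open>A\<close> that is determined by \<open>\<delta> p\<^sub>i = h\<^sub>i\<close>: the derivative with respect to \<open>p\<close>.
\<close>

definition \<delta> :: "'g fpoly \<Rightarrow> ('g + 'g) fpoly" where
  "\<delta> f = fsubst Q (fderiv f)"

lemma \<delta>_add: "\<delta> (f + g) = \<delta> f + \<delta> g"
  and \<delta>_scale: "\<delta> (fconst c * f) = fconst c * \<delta> f"
  and \<delta>_1 [simp]: "\<delta> 1 = 0"
  and \<delta>_mult: "\<delta> (f * g) = \<delta> f * incl_x g + incl_x f * \<delta> g"
  by (simp_all add: \<delta>_def fderiv_add fsubst_add fderiv_fconst_mult fsubst_mult fderiv_1 fderiv_mult Q_incl)

lemma \<delta>_p: "\<delta> (p i) = hvar i"
  using QF[of "Inl i"] by (simp add: \<delta>_def deriv_map_def)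

lemma \<delta>_fvar: "\<delta> (fvar i) = Q (Inl i)"
  by (simp add: \<delta>_def fderiv_fvar)

text \<open>
  Contractions of \<open>\<delta>\<close> by functionals on the left or right tensor factor.
\<close>

definition left_diff :: "'g \<Rightarrow> ('g fpoly \<Rightarrow> complex) \<Rightarrow> 'g fpoly \<Rightarrow> 'g fpoly" where
  "left_diff j \<phi> f = contract_left j \<phi> (\<delta> f)"

definition right_diff :: "'g \<Rightarrow> ('g fpoly \<Rightarrow> complex) \<Rightarrow> 'g fpoly \<Rightarrow> 'g fpoly" where
  "right_diff j \<psi> f = contract_right j \<psi> (\<delta> f)"

lemma left_diff_add: "left_diff j \<phi> (f + g) = left_diff j \<phi> f + left_diff j \<phi> g"
  and left_diff_scale: "left_diff j \<phi> (fconst c * f) = fconst c * left_diff j \<phi> f"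
  and left_diff_1 [simp]: "left_diff j \<phi> 1 = 0"
  and right_diff_add: "right_diff j \<phi> (f + g) = right_diff j \<phi> f + right_diff j \<phi> g"
  and right_diff_scale: "right_diff j \<phi> (fconst c * f) = fconst c * right_diff j \<phi> f"
  and right_diff_1 [simp]: "right_diff j \<phi> 1 = 0"
  by (simp_all add: left_diff_def right_diff_def \<delta>_add \<delta>_scale contract_left_add contract_left_scale contract_right_add contract_right_scale)

lemma left_diff_mult: "flinear \<phi> \<Longrightarrow> left_diff j \<phi> (f * g) = left_diff j \<phi> f * g + left_diff j (\<lambda>h. \<phi> (f * h)) g"
  by (simp add: left_diff_def \<delta>_mult contract_left_add contract_left_mult_incl contract_left_incl_mult)

lemma left_diff_p: "left_diff j \<phi> (p l) = (if l = j then fconst (\<phi> 1) else 0)"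
  using contract_left_hvar[of j \<phi> l 1] by (simp add: left_diff_def \<delta>_p)

lemma right_diff_p_mult: "flinear \<psi> \<Longrightarrow> right_diff j \<psi> (p l * g) = (if l = j then fconst (\<psi> g) else 0) + p l * right_diff j \<psi> g"
  by (simp add: right_diff_def \<delta>_mult \<delta>_p contract_right_add contract_right_incl_mult contract_right_hvar)

text \<open>
  The analogue for \<open>p\<close> of \<open>left_quot [j]\<close>: it removes a factor \<open>p j\<close> at the front.
\<close>

abbreviation shift :: "'g \<Rightarrow> 'g fpoly \<Rightarrow> 'g fpoly" where
  "shift j \<equiv> left_diff j counit"

lemma shift_p_mult: "shift j (p l * g) = (if l = j then g else 0)"
  by (simp add: left_diff_mult[OF flinear_counit] left_diff_p counit_mult) (simp add: left_diff_def)

lemma shift_fvar_mult: "shift j (fvar i * g) = shift j (fvar i) * g"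
  by (simp add: left_diff_mult[OF flinear_counit] counit_mult) (simp add: left_diff_def)

lemma proj_F: "proj_x (fsubst (deriv_map p) G) = proj_x G"
proof -
  have "(\<lambda>v. proj_x (deriv_map p v)) = case_sum (\<lambda>_. 0) fvar"
    by (auto simp: deriv_map_def split: sum.splits)
  then show ?thesis by (simp add: proj_x_def fsubst_fsubst)
qed

text \<open>
  For a tensor \<open>f h\<^sub>j g\<close> the derivative mapping replaces \<open>h\<^sub>j\<close> by \<open>Dp\<^sub>j\<close>, which collapses to \<open>p\<^sub>j\<close>.
\<close>

lemma collapse_F: "collapse (fsubst (deriv_map p) G) = (\<Sum>j\<in>UNIV. p j * contract_left j counit G)"
proof (induction G rule: fpoly_word_induct)
  case (add p q)
  then show ?case by (simp add: fsubst_add collapse_add contract_left_add distrib_left sum.distrib)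
next
  case (scale c p)
  then show ?case by (simp add: fsubst_mult collapse_scale contract_left_scale fconst_left_commute sum_distrib_left)
next
  case one
  then show ?case by simp
next
  case (var v G)
  show ?case
  proof (cases v)
    case (Inl k)
    have "collapse (fsubst (deriv_map p) (hvar k * G)) = collapse (fderiv (p k)) * proj_x G"
      by (simp add: fsubst_mult deriv_map_def[of p] collapse_mult) (simp add: proj_F[unfolded deriv_map_def])
    also have "\<dots> = p k * proj_x G" by (simp add: collapse_fderiv)
    finally show ?thesis using Inl by (simp add: contract_left_hvar if_distrib[of "\<lambda>x. _ * x"] cong: if_cong)
  next
    case (Inr i)
    have "collapse (fsubst (deriv_map p) (xvar i * G)) = 0"
      by (simp add: fsubst_mult deriv_map_def[of p] collapse_xvar)
    then show ?thesis using Inr by (simp add: contract_left_xvar counit_mult)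
  qed
qed

text \<open>
  Applied to \<open>Q\<^sub>i\<close>, which the derivative mapping sends to \<open>h\<^sub>i\<close>, \<open>collapse_F\<close> gives the case of a
  letter: \<open>x\<^sub>i\<close> is a combination of the \<open>p j\<close> with shifts of \<open>x\<^sub>i\<close> as coefficients. Right multiplication
  by \<open>f\<close> then handles \<open>x\<^sub>i f\<close>.
\<close>

lemma decomp: "f = fconst (counit f) + (\<Sum>j\<in>UNIV. p j * shift j f)"
proof (induction f rule: fpoly_word_induct)
  case (add f g)
  have "fconst (counit (f + g)) + (\<Sum>j\<in>UNIV. p j * shift j (f + g))
     = (fconst (counit f) + (\<Sum>j\<in>UNIV. p j * shift j f)) + (fconst (counit g) + (\<Sum>j\<in>UNIV. p j * shift j g))"
    by (simp add: counit_add fconst_add left_diff_add distrib_left sum.distrib)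
  with add show ?case by simp
next
  case (scale c f)
  have "fconst (counit (fconst c * f)) + (\<Sum>j\<in>UNIV. p j * shift j (fconst c * f))
     = fconst c * (fconst (counit f) + (\<Sum>j\<in>UNIV. p j * shift j f))"
    by (simp add: counit_mult fconst_mult left_diff_scale distrib_left sum_distrib_left fconst_left_commute)
  with scale show ?case by simp
next
  case one
  then show ?case by simp
next
  case (var i f)
  have "fvar i = collapse (fsubst (deriv_map p) (Q (Inl i)))"
    using collapse_hvar[of i 1] by (simp add: FQ)
  also have "\<dots> = (\<Sum>j\<in>UNIV. p j * shift j (fvar i))" by (simp add: collapse_F left_diff_def \<delta>_fvar)
  finally have "fvar i * f = (\<Sum>j\<in>UNIV. p j * shift j (fvar i * f))"
    by (simp add: shift_fvar_mult mult.assoc[symmetric] flip: sum_distrib_right)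
  then show ?case by (simp add: counit_mult)
qed

text \<open>
  By the decomposition, constants and the multiples of the \<open>p l\<close> span the algebra.
\<close>

lemma linear_eqI:
  fixes U V :: "'g fpoly \<Rightarrow> 'b::comm_monoid_add"
  assumes "\<And>f g. U (f + g) = U f + U g" "\<And>f g. V (f + g) = V f + V g" "U 0 = 0" "V 0 = 0"
    and "\<And>c. U (fconst c) = V (fconst c)" "\<And>l g. U (p l * g) = V (p l * g)"
  shows "U f = V f"
proof -
  have *: "U (sum h A) = V (sum h A)" if "\<And>x. x \<in> A \<Longrightarrow> U (h x) = V (h x)" for h and A :: "'g set"
    using that assms(1-4) by (induction A rule: infinite_finite_induct) auto
  have "U (fconst (counit f) + (\<Sum>j\<in>UNIV. p j * shift j f)) = V (fconst (counit f) + (\<Sum>j\<in>UNIV. p j * shift j f))"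
    unfolding assms(1,2) using *[of UNIV "\<lambda>j. p j * shift j f"] assms(5,6) by simp
  then show ?thesis unfolding decomp[of f, symmetric] .
qed

lemma left_diff_0 [simp]: "left_diff j \<phi> 0 = 0" and right_diff_0 [simp]: "right_diff j \<phi> 0 = 0"
  using left_diff_scale[of j \<phi> 0 0] right_diff_scale[of j \<phi> 0 0] by simp_all

lemma left_diff_fconst [simp]: "left_diff j \<phi> (fconst c) = 0" and right_diff_fconst [simp]: "right_diff j \<phi> (fconst c) = 0"
  using left_diff_scale[of j \<phi> c 1] right_diff_scale[of j \<phi> c 1] by simp_all

text \<open>
  A form of coassociativity: contracting a shift is contracting \<open>f\<close> itself by another functional.
\<close>

lemma left_diff_shift:
  assumes \<phi>: "flinear \<phi>"
  shows "left_diff j \<phi> (shift i f) = left_diff j (\<lambda>h. \<phi> (shift i h)) f"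
proof (rule linear_eqI[where f=f])
  have lin: "flinear (\<lambda>h. \<phi> (shift i h))" using \<phi> by (simp add: flinear_def left_diff_add left_diff_scale)
  fix l g
  have "left_diff j (\<lambda>h. \<phi> (shift i (p l * h))) g = (if l = i then left_diff j \<phi> g else 0)"
    using \<phi> flinear_scale[OF \<phi>, of 0 0] by (cases "l = i") (simp_all add: shift_p_mult, simp add: left_diff_def)
  then show "left_diff j \<phi> (shift i (p l * g)) = left_diff j (\<lambda>h. \<phi> (shift i h)) (p l * g)"
    using flinear_scale[OF \<phi>, of 0 0] by (simp add: left_diff_mult[OF lin] left_diff_p shift_p_mult)
qed (simp_all add: left_diff_add)

lemma shift_right_diff:
  assumes "flinear \<psi>"
  shows "shift i (right_diff j \<psi> f) = right_diff j \<psi> (shift i f)"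
  by (rule linear_eqI[where f=f]) (simp_all add: left_diff_add right_diff_add right_diff_p_mult[OF assms] shift_p_mult)

lemma counit_right_diff:
  assumes "flinear \<psi>"
  shows "counit (right_diff j \<psi> f) = \<psi> (shift j f)"
  by (rule linear_eqI[where f=f])
     (use flinear_scale[OF assms, of 0 0] in \<open>simp_all add: counit_add right_diff_add right_diff_p_mult[OF assms] shift_p_mult left_diff_add flinear_add[OF assms] counit_mult\<close>)

primrec shifts :: "'g list \<Rightarrow> 'g fpoly \<Rightarrow> 'g fpoly" where
  "shifts [] f = f"
| "shifts (j # u) f = shifts u (shift j f)"

lemma shifts_add: "shifts u (f + g) = shifts u f + shifts u g"
  and shifts_scale: "shifts u (fconst c * f) = fconst c * shifts u f"
  by (induction u arbitrary: f g) (simp_all add: left_diff_add left_diff_scale)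

lemma shifts_snoc: "shifts (u @ [j]) f = shift j (shifts u f)"
  by (induction u arbitrary: f) simp_all

text \<open>
  Every iterated shift of \<open>f\<close> is a contraction of the fixed tensor \<open>\<delta> f\<close>, whatever its length.
\<close>

lemma shift_shifts: "shift j (shifts u f) = left_diff j (\<lambda>h. counit (shifts u h)) f"
proof (induction u arbitrary: f)
  case Nil
  then show ?case by simp
next
  case (Cons i u)
  have "flinear (\<lambda>h. counit (shifts u h))"
    by (simp add: flinear_def shifts_add shifts_scale counit_add counit_mult)
  then show ?case using Cons left_diff_shift by simp
qed

lemma order_ge_shift:
  assumes "order_ge (Suc k) h"
  shows "order_ge k (shift j h)"
proof -
  have "counit h = 0" using assms by (simp add: order_ge_mono flip: order_ge_1_iff)
  then have h: "h = (\<Sum>i\<in>UNIV. fvar i * left_quot [i] h)" using first_letter_decomp[of h] by simp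
  have rsum: "shift j (sum g A) = (\<Sum>x\<in>A. shift j (g x))" for g and A :: "'g set"
    by (induction A rule: infinite_finite_induct) (simp_all add: left_diff_add)
  have "shift j h = (\<Sum>i\<in>UNIV. shift j (fvar i) * left_quot [i] h)"
    by (subst h) (simp add: rsum shift_fvar_mult)
  then show ?thesis using assms by (auto intro!: order_ge_sum order_ge_mult_left order_ge_left_quot)
qed

lemma counit_fsubst_p: "counit (fsubst p f) = counit f"
  by (induction f rule: fpoly_word_induct) (simp_all add: fsubst_add fsubst_mult counit_add counit_mult)

text \<open>
  Substituting \<open>p\<close> turns removing a letter into a shift, and a shift lowers the order by one at most.
  In particular the elements \<open>p j\<close> are free.
\<close>

lemma order_ge_fsubst_p: "order_ge k (fsubst p f) \<Longrightarrow> order_ge k f"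
proof (induction k arbitrary: f)
  case (Suc k)
  have e: "counit f = 0"
    using Suc.prems order_ge_mono[of "Suc k" "fsubst p f" "Suc 0"] by (simp add: order_ge_1_iff counit_fsubst_p)
  then have f: "f = (\<Sum>i\<in>UNIV. fvar i * left_quot [i] f)" using first_letter_decomp[of f] by simp
  have rsum: "shift j (sum g A) = (\<Sum>x\<in>A. shift j (g x))" for j g and A :: "'g set"
    by (induction A rule: infinite_finite_induct) (simp_all add: left_diff_add)
  have "order_ge k (left_quot [i] f)" for i
  proof (rule Suc.IH)
    have "fsubst p f = (\<Sum>j\<in>UNIV. p j * fsubst p (left_quot [j] f))"
      by (subst f) (simp add: fsubst_sum fsubst_mult)
    then have "shift i (fsubst p f) = (\<Sum>j\<in>UNIV. if j = i then fsubst p (left_quot [j] f) else 0)"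
      by (simp add: rsum shift_p_mult)
    then have "fsubst p (left_quot [i] f) = shift i (fsubst p f)" by simp
    then show "order_ge k (fsubst p (left_quot [i] f))" using order_ge_shift[OF Suc.prems] by simp
  qed
  then have "order_ge (Suc 0 + k) (\<Sum>i\<in>UNIV. fvar i * left_quot [i] f)"
    by (intro order_ge_sum order_ge_mult order_ge_fvar)
  then show ?case using f by simp
qed simp

end

section \<open>Finite-dimensional spaces of polynomials\<close>

interpretation fpoly_vs: vector_space "\<lambda>c (f :: 'v fpoly). fconst c * f"
  by unfold_locales (simp_all add: distrib_left distrib_right fconst_add fconst_mult mult.assoc)

text \<open>
  The right tensor factors of the monomials of \<open>G\<close>, and further tails: a finite set that spans all
  contractions of \<open>G\<close> on the left.
\<close>

definition word_tails :: "('v + 'v) fpoly \<Rightarrow> 'v fpoly set" where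
  "word_tails G = (\<Union>w\<in>Poly_Mapping.keys G. (\<lambda>k. proj_x (fword_poly (drop k (letters w)))) ` {..length (letters w)})"

lemma finite_word_tails: "finite (word_tails G)"
  by (simp add: word_tails_def)

lemma contract_left_word_in_span: "contract_left_word j w \<phi> \<in> fpoly_vs.span ((\<lambda>k. proj_x (fword_poly (drop k w))) ` {..length w})"
proof (induction w arbitrary: \<phi>)
  case Nil
  then show ?case by (simp add: fpoly_vs.span_zero)
next
  case (Cons x w)
  have tail: "(\<lambda>k. proj_x (fword_poly (drop k w))) ` {..length w} \<subseteq> (\<lambda>k. proj_x (fword_poly (drop k (x # w)))) ` {..length (x # w)}"
  proof
    fix y assume "y \<in> (\<lambda>k. proj_x (fword_poly (drop k w))) ` {..length w}"
    then obtain k where "k \<le> length w" "y = proj_x (fword_poly (drop k w))" by auto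
    then show "y \<in> (\<lambda>k. proj_x (fword_poly (drop k (x # w)))) ` {..length (x # w)}"
      by (intro image_eqI[of _ _ "Suc k"]) auto
  qed
  have mem: "proj_x (fword_poly w) \<in> (\<lambda>k. proj_x (fword_poly (drop k (x # w)))) ` {..length (x # w)}"
    using tail by (rule subsetD) (auto intro: image_eqI[of _ _ 0])
  note head = fpoly_vs.span_scale[OF fpoly_vs.span_base[OF mem]]
    and rest = subsetD[OF fpoly_vs.span_mono[OF tail] Cons]
  show ?case
    unfolding contract_left_word.simps(2) by (simp only: split: sum.split if_split) (intro conjI allI impI head rest fpoly_vs.span_zero)
qed

lemma contract_left_in_span: "contract_left j \<phi> G \<in> fpoly_vs.span (word_tails G)"
  unfolding contract_left_def linext_def
proof (intro fpoly_vs.span_sum fpoly_vs.span_scale)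
  fix w assume "w \<in> Poly_Mapping.keys G"
  then have "(\<lambda>k. proj_x (fword_poly (drop k (letters w)))) ` {..length (letters w)} \<subseteq> word_tails G"
    unfolding word_tails_def by (rule UN_upper)
  then show "contract_left_word j (letters w) \<phi> \<in> fpoly_vs.span (word_tails G)"
    by (rule subsetD[OF fpoly_vs.span_mono contract_left_word_in_span])
qed

text \<open>
  A basis of the span of \<open>V\<close> inside \<open>V\<close>, with coordinate functionals that are extended to the
  whole algebra by completing the basis.
\<close>

lemma ex_frame:
  assumes T: "finite T" "V \<subseteq> fpoly_vs.span T"
  shows "\<exists>Bs \<psi>. finite Bs \<and> Bs \<subseteq> V \<and> (\<forall>b. flinear (\<psi> b)) \<and>
    (\<forall>f\<in>fpoly_vs.span V. f = (\<Sum>b\<in>Bs. fconst (\<psi> b f) * b))"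
proof -
  obtain Bs where Bs: "Bs \<subseteq> V" "fpoly_vs.independent Bs" "V \<subseteq> fpoly_vs.span Bs"
    by (rule fpoly_vs.maximal_independent_subset)
  have fin: "finite Bs"
    using fpoly_vs.independent_span_bound[OF T(1) Bs(2) subset_trans[OF Bs(1) T(2)]] by (rule conjunct1)
  define E where "E = fpoly_vs.extend_basis Bs"
  have E: "Bs \<subseteq> E" "fpoly_vs.independent E" "fpoly_vs.span E = UNIV"
    unfolding E_def using Bs(2)
    by (rule fpoly_vs.extend_basis_superset, rule fpoly_vs.independent_extend_basis, rule fpoly_vs.span_extend_basis)
  define \<psi> where "\<psi> = (\<lambda>b f. fpoly_vs.representation E f b)"
  have lin: "flinear (\<psi> b)" for b
    unfolding flinear_def \<psi>_def
    using fpoly_vs.representation_add[OF E(2)] fpoly_vs.representation_scale[OF E(2)] E(3) by simp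
  have "f = (\<Sum>b\<in>Bs. fconst (\<psi> b f) * b)" if f: "f \<in> fpoly_vs.span V" for f
  proof -
    have fB: "f \<in> fpoly_vs.span Bs"
      using subsetD[OF fpoly_vs.span_mono[OF Bs(3)] f] by (simp only: fpoly_vs.span_span)
    have "fpoly_vs.representation E f = fpoly_vs.representation Bs f"
      by (rule fpoly_vs.representation_extend[OF E(2) fB E(1)])
    then show ?thesis
      using fpoly_vs.sum_representation_eq[OF Bs(2) fB fin order_refl] by (simp add: \<psi>_def)
  qed
  then show ?thesis using fin Bs(1) lin by blast
qed

section \<open>Evaluation along a line\<close>

text \<open>
  The entries of \<open>f(t Y)\<close> as polynomials in \<open>t\<close>.
\<close>

definition line_eval :: "nat \<Rightarrow> ('v \<Rightarrow> complex mat) \<Rightarrow> 'v fpoly \<Rightarrow> nat \<Rightarrow> nat \<Rightarrow> complex poly" where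
  "line_eval n Y f r s = (\<Sum>w\<in>Poly_Mapping.keys f.
     monom (Poly_Mapping.lookup f w * word_eval n Y (letters w) $$ (r, s)) (length (letters w)))"

lemma word_eval_scaled:
  assumes Y: "Y \<in> mat_tuples n"
  shows "word_eval n (\<lambda>i. t \<cdot>\<^sub>m Y i) w = t ^ length w \<cdot>\<^sub>m word_eval n Y w"
proof (induction w)
  case Nil
  then show ?case by auto
next
  case (Cons i w)
  then show ?case using mat_tuplesD[OF Y, of i] word_eval_carrier[OF Y, of w]
    by (auto simp: mult_smult_assoc_mat[of _ n n _ n] mult_smult_distrib[of _ n n _ n] mult.commute)
qed

lemma poly_line_eval:
  assumes Y: "Y \<in> mat_tuples n" and rs: "r < n" "s < n"
  shows "poly (line_eval n Y f r s) t = fpoly_eval n (\<lambda>i. t \<cdot>\<^sub>m Y i) f $$ (r, s)"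
proof -
  have "dim_row (word_eval n Y w) = n" "dim_col (word_eval n Y w) = n" for w
    using word_eval_carrier[OF Y, of w] by auto
  then show ?thesis
    using rs by (simp add: line_eval_def fpoly_eval_def word_eval_scaled[OF Y] poly_sum poly_monom mult_ac)
qed

lemma scaled_tuple: "Y \<in> mat_tuples n \<Longrightarrow> (\<lambda>i. t \<cdot>\<^sub>m Y i) \<in> mat_tuples n"
  by (simp add: mat_tuples_def)

lemma line_eval_mult:
  assumes Y: "Y \<in> mat_tuples n" and rs: "r < n" "s < n"
  shows "line_eval n Y (f * g) r s = (\<Sum>c<n. line_eval n Y f r c * line_eval n Y g c s)"
  by (rule poly_eq_poly_eq_iff[THEN iffD1], rule ext)
     (use rs in \<open>simp add: poly_line_eval[OF Y] poly_sum fpoly_eval_mult_index[OF scaled_tuple[OF Y]]\<close>)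

lemma line_eval_add:
  assumes Y: "Y \<in> mat_tuples n" and rs: "r < n" "s < n"
  shows "line_eval n Y (f + g) r s = line_eval n Y f r s + line_eval n Y g r s"
  by (rule poly_eq_poly_eq_iff[THEN iffD1], rule ext)
     (use rs in \<open>simp add: poly_line_eval[OF Y] fpoly_eval_add_index\<close>)

lemma line_eval_0 [simp]: "line_eval n Y 0 r s = 0"
  by (simp add: line_eval_def)

lemma line_eval_sum:
  assumes Y: "Y \<in> mat_tuples n" and rs: "r < n" "s < n"
  shows "line_eval n Y (sum f A) r s = (\<Sum>x\<in>A. line_eval n Y (f x) r s)"
  by (induction A rule: infinite_finite_induct) (simp_all add: line_eval_add[OF assms])

lemma line_eval_fconst:
  assumes Y: "Y \<in> mat_tuples n" and rs: "r < n" "s < n"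
  shows "line_eval n Y (fconst c) r s = (if r = s then [:c:] else 0)"
  by (rule poly_eq_poly_eq_iff[THEN iffD1], rule ext)
     (use rs in \<open>simp add: poly_line_eval[OF Y] fpoly_eval_fconst[OF scaled_tuple[OF Y]]\<close>)

lemma line_eval_fvar:
  assumes Y: "Y \<in> mat_tuples n" and rs: "r < n" "s < n"
  shows "line_eval n Y (fvar i) r s = [:0, Y i $$ (r, s):]"
  by (rule poly_eq_poly_eq_iff[THEN iffD1], rule ext)
     (use rs mat_tuplesD[OF Y, of i] in \<open>simp add: poly_line_eval[OF Y] fpoly_eval_fvar[OF scaled_tuple[OF Y]]\<close>)

lemma line_eval_fconst_mult:
  assumes Y: "Y \<in> mat_tuples n" and rs: "r < n" "s < n"
  shows "line_eval n Y (fconst c * f) r s = smult c (line_eval n Y f r s)"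
  by (rule poly_eq_poly_eq_iff[THEN iffD1], rule ext)
     (use rs in \<open>simp add: poly_line_eval[OF Y] fpoly_eval_mult[OF scaled_tuple[OF Y]]
        fpoly_eval_fconst[OF scaled_tuple[OF Y]] mult_smult_assoc_mat[of _ n n _ n]\<close>)

lemma line_eval_dvd:
  assumes "order_ge k f"
  shows "monom 1 k dvd line_eval n Y f r s"
  unfolding line_eval_def
proof (rule dvd_sum)
  fix w assume "w \<in> Poly_Mapping.keys f"
  then have "k \<le> length (letters w)" using assms by (simp add: order_ge_def)
  then have "monom c (length (letters w)) = monom 1 k * monom c (length (letters w) - k)" for c :: complex
    by (simp add: mult_monom)
  then show "monom 1 k dvd monom (Poly_Mapping.lookup f w * word_eval n Y (letters w) $$ (r, s)) (length (letters w))"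
    by (metis dvd_triv_left)
qed

lemma order_ge_fsubst_diff:
  assumes "\<And>v. order_ge k (s v - fvar v)"
  shows "order_ge k (fsubst s f - f)"
proof (induction f rule: fpoly_word_induct)
  case (add p q)
  have eq: "fsubst s (p + q) - (p + q) = (fsubst s p - p) + (fsubst s q - q)" by (simp add: fsubst_add)
  show ?case unfolding eq by (rule order_ge_add[OF add])
next
  case (scale c p)
  have eq: "fsubst s (fconst c * p) - fconst c * p = fconst c * (fsubst s p - p)"
    by (simp add: fsubst_mult right_diff_distrib)
  show ?case unfolding eq by (rule order_ge_mult_left[OF scale])
next
  case one
  then show ?case by simp
next
  case (var v p)
  have eq: "fsubst s (fvar v * p) - fvar v * p = (s v - fvar v) * fsubst s p + fvar v * (fsubst s p - p)"
    by (simp add: fsubst_mult algebra_simps)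
  show ?case unfolding eq by (rule order_ge_add[OF order_ge_mult_right[OF assms] order_ge_mult_left[OF var]])
qed

lemma word_prod_transpose:
  fixes N :: "'l \<Rightarrow> 's \<Rightarrow> 's \<Rightarrow> 'a::comm_ring_1"
  assumes S: "finite S"
  shows "a \<in> S \<Longrightarrow> b \<in> S \<Longrightarrow> word_prod S (\<lambda>i a b. N i b a) w a b = word_prod S N (rev w) b a"
proof (induction w arbitrary: a)
  case (Cons i w)
  have "word_prod S (\<lambda>i a b. N i b a) (i # w) a b = (\<Sum>c\<in>S. word_prod S N (rev w) b c * N i c a)"
    using Cons by (simp add: mult.commute)
  then show ?case using word_prod_snoc[OF S Cons.prems(2,1), of N "rev w" i] by simp
qed auto

section \<open>Polynomiality of the inverse\<close>

context deriv_invertible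
begin

definition orbit :: "'g fpoly set" where
  "orbit = range (\<lambda>(u, i). shifts u (fvar i))"

text \<open>
  Iterated shifts of \<open>x\<^sub>i\<close> are contractions of \<open>\<delta> x\<^sub>i = Q\<^sub>i\<close>, which involves finitely many words. This is
  what makes the inverse of \<open>p\<close> a rational series.
\<close>

lemma orbit_finite_dim: "orbit \<subseteq> fpoly_vs.span (range fvar \<union> (\<Union>i. word_tails (Q (Inl i))))" (is "_ \<subseteq> fpoly_vs.span ?T")
proof
  fix f assume "f \<in> orbit"
  then obtain u i where f: "f = shifts u (fvar i)" by (auto simp: orbit_def)
  show "f \<in> fpoly_vs.span ?T"
  proof (cases u rule: rev_cases)
    case Nil
    then show ?thesis using f by (auto intro: fpoly_vs.span_base)
  next
    case (snoc v j)
    have "f = contract_left j (\<lambda>h. counit (shifts v h)) (Q (Inl i))"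
      unfolding f snoc shifts_snoc shift_shifts by (simp add: left_diff_def \<delta>_fvar)
    then have f': "f \<in> fpoly_vs.span (word_tails (Q (Inl i)))" using contract_left_in_span by simp
    have "word_tails (Q (Inl i)) \<subseteq> ?T" by (intro le_supI2 UN_upper UNIV_I)
    then show ?thesis by (rule subsetD[OF fpoly_vs.span_mono f'])
  qed
qed

lemma shift_span_orbit: "f \<in> fpoly_vs.span orbit \<Longrightarrow> shift j f \<in> fpoly_vs.span orbit"
proof (induction f rule: fpoly_vs.span_induct_alt)
  case base
  then show ?case by (simp add: fpoly_vs.span_zero)
next
  case (step c x y)
  obtain u i where x: "x = shifts u (fvar i)" using step(1) by (auto simp: orbit_def)
  have "shift j x \<in> orbit" unfolding x shifts_snoc[symmetric] by (auto simp: orbit_def)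
  then show ?case
    using step(2) by (auto simp: left_diff_add left_diff_scale intro: fpoly_vs.span_add fpoly_vs.span_scale fpoly_vs.span_base)
qed

end

locale deriv_invertible_frame = deriv_invertible +
  fixes Bs :: "'a fpoly set" and \<psi> :: "'a fpoly \<Rightarrow> 'a fpoly \<Rightarrow> complex"
  assumes finB: "finite Bs" and Bs: "Bs \<subseteq> orbit" and lin\<psi>: "\<And>b. flinear (\<psi> b)"
    and frame: "\<And>f. f \<in> fpoly_vs.span orbit \<Longrightarrow> f = (\<Sum>b\<in>Bs. fconst (\<psi> b f) * b)"
begin

text \<open>
  The matrix of \<open>shift j\<close> on the span of the orbit.
\<close>

definition T :: "'a \<Rightarrow> 'a fpoly \<Rightarrow> 'a fpoly \<Rightarrow> complex" where
  "T j a b = \<psi> b (shift j a)"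

lemma shift_Bs: "a \<in> Bs \<Longrightarrow> shift j a = (\<Sum>b\<in>Bs. fconst (T j a b) * b)"
  unfolding T_def by (rule frame, rule shift_span_orbit) (use Bs in \<open>blast intro: fpoly_vs.span_base\<close>)

text \<open>
  The matrix \<open>1 - \<Sum>\<^sub>j T\<^sub>j p\<^sub>j\<close>. Its inverse is the series \<open>\<Sum>\<^sub>w T\<^sub>w p\<^sub>w\<close> in the elements \<open>p\<^sub>w\<close>, and the
  entries of that series turn out to be elements of the algebra: they are built from the contractions of
  \<open>\<delta>\<close> on the right.
\<close>

definition pencil :: "'a fpoly \<Rightarrow> 'a fpoly \<Rightarrow> 'a fpoly" where
  "pencil a b = (if a = b then 1 else 0) - (\<Sum>j\<in>UNIV. fconst (T j a b) * p j)"

definition pencil_inv :: "'a fpoly \<Rightarrow> 'a fpoly \<Rightarrow> 'a fpoly" where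
  "pencil_inv a b = (if a = b then 1 else 0) + (\<Sum>j\<in>UNIV. right_diff j (\<psi> b) a * p j)"

text \<open>
  The decomposition of \<open>right_diff j (\<psi> b) a\<close>, whose shifts are known as contractions on the right commute
  with those on the left.
\<close>

lemma right_diff_rec:
  assumes a: "a \<in> Bs"
  shows "right_diff j (\<psi> b) a = fconst (T j a b) + (\<Sum>c\<in>Bs. (\<Sum>i\<in>UNIV. fconst (T i a c) * p i) * right_diff j (\<psi> b) c)"
proof -
  have Ssum: "right_diff j (\<psi> b) (sum h A) = (\<Sum>x\<in>A. right_diff j (\<psi> b) (h x))" for h and A :: "'a fpoly set"
    by (induction A rule: infinite_finite_induct) (simp_all add: right_diff_add)
  have "right_diff j (\<psi> b) a = fconst (counit (right_diff j (\<psi> b) a)) + (\<Sum>i\<in>UNIV. p i * shift i (right_diff j (\<psi> b) a))"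
    by (rule decomp)
  also have "counit (right_diff j (\<psi> b) a) = T j a b" by (simp add: counit_right_diff[OF lin\<psi>] T_def)
  also have "(\<Sum>i\<in>UNIV. p i * shift i (right_diff j (\<psi> b) a)) = (\<Sum>i\<in>UNIV. p i * right_diff j (\<psi> b) (\<Sum>c\<in>Bs. fconst (T i a c) * c))"
    by (simp only: shift_right_diff[OF lin\<psi>] shift_Bs[OF a])
  also have "fconst (T j a b) + \<dots> = fconst (T j a b) + (\<Sum>i\<in>UNIV. \<Sum>c\<in>Bs. fconst (T i a c) * p i * right_diff j (\<psi> b) c)"
    by (simp add: Ssum right_diff_scale sum_distrib_left fconst_left_commute mult.assoc)
  also have "\<dots> = fconst (T j a b) + (\<Sum>c\<in>Bs. (\<Sum>i\<in>UNIV. fconst (T i a c) * p i) * right_diff j (\<psi> b) c)"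
    by (subst sum.swap) (simp add: sum_distrib_right)
  finally show ?thesis .
qed

lemma pencil_inverse:
  assumes ab: "a \<in> Bs" "b \<in> Bs"
  shows "(\<Sum>c\<in>Bs. pencil a c * pencil_inv c b) = (if a = b then 1 else 0)"
proof -
  let ?t = "\<lambda>a b. \<Sum>i\<in>UNIV. fconst (T i a b) * p i"
  have d: "(\<Sum>c\<in>Bs. (if a = c then 1 else 0) * f c) = f a" "(\<Sum>c\<in>Bs. f c * (if c = b then 1 else 0)) = f b"
    for f :: "'a fpoly \<Rightarrow> 'a fpoly"
    using ab finB by (simp_all add: if_distrib[of "\<lambda>x. _ * x"] if_distrib[of "\<lambda>x. x * _"] cong: if_cong)
  have "(\<Sum>c\<in>Bs. pencil a c * pencil_inv c b) = pencil_inv a b - (\<Sum>c\<in>Bs. ?t a c * pencil_inv c b)"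
    unfolding pencil_def left_diff_distrib sum_subtractf d ..
  also have "(\<Sum>c\<in>Bs. ?t a c * pencil_inv c b) = ?t a b + (\<Sum>c\<in>Bs. ?t a c * (\<Sum>j\<in>UNIV. right_diff j (\<psi> b) c * p j))"
    unfolding pencil_inv_def distrib_left sum.distrib d ..
  also have "(\<Sum>c\<in>Bs. ?t a c * (\<Sum>j\<in>UNIV. right_diff j (\<psi> b) c * p j)) = (\<Sum>j\<in>UNIV. (\<Sum>c\<in>Bs. ?t a c * right_diff j (\<psi> b) c) * p j)"
    by (subst sum_distrib_left, subst sum.swap) (simp add: sum_distrib_right mult.assoc)
  also have "?t a b + \<dots> = (\<Sum>j\<in>UNIV. right_diff j (\<psi> b) a * p j)"
    by (subst right_diff_rec[OF ab(1)]) (simp add: distrib_right sum.distrib)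
  finally show ?thesis by (simp add: pencil_inv_def)
qed

text \<open>
  The coefficient of \<open>y\<^sub>w\<close> in \<open>a\<close> written as a power series in \<open>y = p(x)\<close>; \<open>inv_trunc k\<close> is the
  inverse series of \<open>p\<close> up to degree \<open>k\<close>.
\<close>

definition ycoeff :: "'a list \<Rightarrow> 'a fpoly \<Rightarrow> complex" where
  "ycoeff w a = (\<Sum>b\<in>Bs. word_prod Bs T w a b * counit b)"

lemma fconst_sum: "fconst (sum f A) = (\<Sum>x\<in>A. fconst (f x))"
  by (induction A rule: infinite_finite_induct) (simp_all add: fconst_add)

text \<open>
  The decomposition \<open>decomp\<close> iterated \<open>k + 1\<close> times, where the shifts act by the matrices \<open>T j\<close>.
\<close>

lemma expansion:
  assumes "a \<in> Bs"
  shows "a = (\<Sum>w\<in>words_upto k. fconst (ycoeff w a) * prod_list (map p w)) +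
     (\<Sum>w | length w = Suc k. \<Sum>b\<in>Bs. fconst (word_prod Bs T w a b) * prod_list (map p w) * b)"
proof -
  have step: "a = fconst (counit a) + (\<Sum>j\<in>UNIV. p j * (\<Sum>b\<in>Bs. fconst (T j a b) * b))" if "a \<in> Bs" for a
    using decomp[of a] shift_Bs[OF that] by simp
  have cf0: "ycoeff [] a = counit a" if "a \<in> Bs" for a
  proof -
    have "ycoeff [] a = (\<Sum>b\<in>Bs. if a = b then counit a else 0)"
      unfolding ycoeff_def by (rule sum.cong) auto
    then show ?thesis using that finB by simp
  qed
  have cfc: "ycoeff (j # w) a = (\<Sum>b\<in>Bs. T j a b * ycoeff w b)" for j w a
    unfolding ycoeff_def by (simp add: sum_distrib_left sum_distrib_right mult.assoc) (rule sum.swap)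
  have comm: "fconst x * (y * (fconst z * w)) = fconst (x * z) * (y * w)" for x z and y w :: "'a fpoly"
    by (simp only: fconst_left_commute[of y] fconst_mult mult.assoc)
  show ?thesis using assms
  proof (induction k arbitrary: a)
    case 0
    have w0: "words_upto 0 = {[] :: 'a list}" by (auto simp: words_upto_def)
    have tail: "(\<Sum>w | length w = Suc 0. \<Sum>b\<in>Bs. fconst (word_prod Bs T w a b) * prod_list (map p w) * b)
        = (\<Sum>j\<in>UNIV. \<Sum>b\<in>Bs. fconst (T j a b) * p j * b)"
    proof -
      have e: "{w :: 'a list. length w = 0} = {[]}" by auto
      have one: "(\<Sum>c\<in>Bs. T j a c * (if c = b then 1 else 0)) = T j a b" if "b \<in> Bs" for j b
        using that finB by (simp add: if_distrib[of "\<lambda>x. _ * x"] cong: if_cong)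
      show ?thesis unfolding sum_words_Suc e
        by (intro sum.cong refl) (simp add: one)
    qed
    show ?case
      unfolding tail w0 using step[OF 0] cf0[OF 0]
      by (simp add: sum_distrib_left fconst_left_commute mult.assoc)
  next
    case (Suc k)
    let ?W = "\<lambda>w. prod_list (map p w)"
    have "a = fconst (counit a) + (\<Sum>j\<in>UNIV. \<Sum>b\<in>Bs. fconst (T j a b) * (p j * b))"
      using step[OF Suc.prems] by (simp add: sum_distrib_left fconst_left_commute)
    also have "(\<Sum>j\<in>UNIV. \<Sum>b\<in>Bs. fconst (T j a b) * (p j * b)) = (\<Sum>j\<in>UNIV. \<Sum>b\<in>Bs. fconst (T j a b) * (p j *
       ((\<Sum>w\<in>words_upto k. fconst (ycoeff w b) * ?W w) + (\<Sum>w | length w = Suc k. \<Sum>c\<in>Bs. fconst (word_prod Bs T w b c) * ?W w * c))))"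
      by (intro sum.cong refl arg_cong2[where f="(*)"] Suc.IH)
    also have "\<dots> = (\<Sum>j\<in>UNIV. \<Sum>b\<in>Bs. \<Sum>w\<in>words_upto k. fconst (T j a b * ycoeff w b) * (p j * ?W w))
        + (\<Sum>j\<in>UNIV. \<Sum>b\<in>Bs. \<Sum>w | length w = Suc k. \<Sum>c\<in>Bs. fconst (T j a b * word_prod Bs T w b c) * (p j * (?W w * c)))"
      by (simp only: distrib_left sum.distrib sum_distrib_left mult.assoc comm)
    also have "(\<Sum>j\<in>UNIV. \<Sum>b\<in>Bs. \<Sum>w\<in>words_upto k. fconst (T j a b * ycoeff w b) * (p j * ?W w))
        = (\<Sum>j\<in>UNIV. \<Sum>w\<in>words_upto k. fconst (ycoeff (j # w) a) * ?W (j # w))"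
      by (rule sum.cong[OF refl], subst sum.swap) (simp add: cfc fconst_sum sum_distrib_right)
    also have "(\<Sum>j\<in>UNIV. \<Sum>b\<in>Bs. \<Sum>w | length w = Suc k. \<Sum>c\<in>Bs. fconst (T j a b * word_prod Bs T w b c) * (p j * (?W w * c)))
        = (\<Sum>j\<in>UNIV. \<Sum>w | length w = Suc k. \<Sum>c\<in>Bs. \<Sum>b\<in>Bs. fconst (T j a b * word_prod Bs T w b c) * (p j * (?W w * c)))"
      by (rule sum.cong[OF refl], subst sum.swap, rule sum.cong[OF refl], rule sum.swap)
    also have "\<dots> = (\<Sum>w | length w = Suc (Suc k). \<Sum>c\<in>Bs. fconst (word_prod Bs T w a c) * ?W w * c)"
      unfolding sum_words_Suc[of _ "Suc k"]
      by (simp only: gen_word_prod.simps fconst_sum sum_distrib_right list.map prod_list.Cons mult.assoc)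
    finally show ?case
      unfolding sum_words_upto_Suc using cf0[OF Suc.prems] by (simp add: add.assoc)
  qed
qed

definition inv_trunc :: "nat \<Rightarrow> 'a \<Rightarrow> 'a fpoly" where
  "inv_trunc k i = (\<Sum>b\<in>Bs. fconst (\<psi> b (fvar i)) * (\<Sum>w\<in>words_upto k. fconst (ycoeff w b) * fword_poly w))"

lemma fsubst_p_inv_trunc:
  "fvar i = fsubst p (inv_trunc k i) + (\<Sum>a\<in>Bs. fconst (\<psi> a (fvar i)) *
     (\<Sum>w | length w = Suc k. \<Sum>b\<in>Bs. fconst (word_prod Bs T w a b) * prod_list (map p w) * b))"
proof -
  have "fvar i \<in> orbit" unfolding orbit_def by (rule image_eqI[of _ _ "([], i)"]) auto
  then have "fvar i = (\<Sum>b\<in>Bs. fconst (\<psi> b (fvar i)) * b)"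
    by (intro frame fpoly_vs.span_base)
  also have "\<dots> = (\<Sum>a\<in>Bs. fconst (\<psi> a (fvar i)) * ((\<Sum>w\<in>words_upto k. fconst (ycoeff w a) * prod_list (map p w)) +
     (\<Sum>w | length w = Suc k. \<Sum>b\<in>Bs. fconst (word_prod Bs T w a b) * prod_list (map p w) * b)))"
    by (intro sum.cong refl arg_cong2[where f="(*)"] expansion)
  also have "\<dots> = fsubst p (inv_trunc k i) + (\<Sum>a\<in>Bs. fconst (\<psi> a (fvar i)) *
     (\<Sum>w | length w = Suc k. \<Sum>b\<in>Bs. fconst (word_prod Bs T w a b) * prod_list (map p w) * b))"
    by (simp only: inv_trunc_def fsubst_sum fsubst_mult fsubst_fconst fsubst_fword_poly distrib_left sum.distrib)
  finally show ?thesis .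
qed

lemma order_ge_prod_p: "order_ge (length w) (prod_list (map p w))"
proof (induction w)
  case (Cons j w)
  have "order_ge (Suc 0 + length w) (p j * prod_list (map p w))"
    by (rule order_ge_mult) (use Cons in \<open>simp_all add: order_ge_1_iff\<close>)
  then show ?case by simp
qed simp

lemma order_ge_fsubst_p_inv_trunc: "order_ge (Suc k) (fsubst p (inv_trunc k i) - fvar i)"
proof -
  have "order_ge (Suc k) (\<Sum>a\<in>Bs. fconst (\<psi> a (fvar i)) *
     (\<Sum>w | length w = Suc k. \<Sum>b\<in>Bs. fconst (word_prod Bs T w a b) * prod_list (map p w) * b))" (is "order_ge _ ?r")
  proof (rule order_ge_sum, rule order_ge_mult_left, rule order_ge_sum, rule order_ge_sum)
    fix w :: "'a list" and c :: complex and b assume "w \<in> {w. length w = Suc k}"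
    then have "order_ge (Suc k) (prod_list (map p w))" using order_ge_prod_p[of w] by simp
    then show "order_ge (Suc k) (fconst c * prod_list (map p w) * b)"
      by (rule order_ge_mult_right[OF order_ge_mult_left])
  qed
  then have "order_ge (Suc k) (- ?r)" by (rule order_ge_uminus)
  moreover have "fsubst p (inv_trunc k i) - fvar i = - ?r"
  proof -
    have "y - x = - z" if "x = y + z" for x y z :: "'a fpoly" using that by simp
    from this[OF fsubst_p_inv_trunc] show ?thesis .
  qed
  ultimately show ?thesis by simp
qed

text \<open>
  A left inverse modulo high order is also a right inverse: after the substitution of \<open>p\<close>, which
  preserves and detects the order, both become the same statement.
\<close>

lemma order_ge_fsubst_inv_trunc: "order_ge (Suc k) (fsubst (inv_trunc k) (p i) - fvar i)"
proof (rule order_ge_fsubst_p)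
  have "order_ge (Suc k) (fsubst (\<lambda>v. fsubst p (inv_trunc k v)) (p i) - p i)"
    by (rule order_ge_fsubst_diff) (rule order_ge_fsubst_p_inv_trunc)
  then show "order_ge (Suc k) (fsubst p (fsubst (inv_trunc k) (p i) - fvar i))"
    by (simp add: fsubst_diff fsubst_fsubst)
qed

text \<open>
  Substituting \<open>inv_trunc K\<close> for \<open>x\<close> in the invertible matrix \<open>1 - \<Sum>\<^sub>j T\<^sub>j p\<^sub>j\<close> replaces \<open>p\<^sub>j\<close> by \<open>y\<^sub>j\<close>
  modulo order \<open>K + 1\<close>. On the line \<open>t Y\<close> this is an invertible polynomial matrix congruent to
  \<open>1 - t \<Sum>\<^sub>j T\<^sub>j \<otimes> Y\<^sub>j\<close> modulo \<open>t\<^sup>K\<^sup>+\<^sup>1\<close>.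
\<close>

lemma T_pencil_injective:
  assumes Y: "Y \<in> mat_tuples n"
    and h: "\<And>a ra. a \<in> Bs \<Longrightarrow> ra < n \<Longrightarrow> h a ra = (\<Sum>b\<in>Bs. \<Sum>s<n. (\<Sum>i\<in>UNIV. T i a b * Y i $$ (ra, s)) * h b s)"
    and a: "a \<in> Bs" "ra < n"
  shows "h a ra = 0"
proof -
  let ?S = "Bs \<times> {..<n}"
  define N where "N = (\<lambda>(a, ra) (b, s). \<Sum>i\<in>UNIV. T i a b * Y i $$ (ra, s))"
  have "(\<lambda>(a, ra). h a ra) (a, ra) = 0"
  proof (rule pencil_injective_if_locally_invertible[where S="?S" and N=N])
    show "finite ?S" using finB by simp
    fix K
    define P where "P = (\<lambda>(a, ra) (b, s). line_eval n Y (fsubst (inv_trunc K) (pencil a b)) ra s)"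
    define R' where "R' = (\<lambda>(a, ra) (b, s). line_eval n Y (fsubst (inv_trunc K) (pencil_inv a b)) ra s)"
    define er where "er = (\<lambda>i. fsubst (inv_trunc K) (p i) - fvar i)"
    have P: "\<exists>G. P x y = (if x = y then 1 else 0) - [:0, N x y:] + monom 1 (Suc K) * G" if xy: "x \<in> ?S" "y \<in> ?S" for x y
    proof -
      obtain a ra b s where x [simp]: "x = (a, ra)" and y [simp]: "y = (b, s)" by (cases x, cases y)
      have rs: "ra < n" "s < n" using xy by auto
      have Leq: "fsubst (inv_trunc K) (pencil a b) = fconst (if a = b then 1 else 0) + (\<Sum>i\<in>UNIV. fconst (- T i a b) * fvar i)
          + (\<Sum>i\<in>UNIV. fconst (- T i a b) * er i)"
      proof -
        have "fconst (- c) * g = - (fconst c * g)" for c and g :: "'a fpoly"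
          using fconst_mult[of "-1" c] fconst_add[of 1 "-1"] by (simp add: eq_neg_iff_add_eq_0 flip: distrib_right fconst_add)
        then show ?thesis
          by (simp add: pencil_def er_def fsubst_diff fsubst_sum fsubst_mult right_diff_distrib sum_subtractf sum_negf)
      qed
      have "P x y = (if ra = s then [:if a = b then 1 else 0:] else 0) + (\<Sum>i\<in>UNIV. smult (- T i a b) [:0, Y i $$ (ra, s):])
          + (\<Sum>i\<in>UNIV. smult (- T i a b) (line_eval n Y (er i) ra s))"
        by (simp only: x y P_def prod.case Leq line_eval_add[OF Y rs] line_eval_sum[OF Y rs]
            line_eval_fconst_mult[OF Y rs] line_eval_fvar[OF Y rs] line_eval_fconst[OF Y rs])
      also have "(if ra = s then [:if a = b then 1 else 0:] else 0) = (if x = y then 1 else 0 :: complex poly)"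
        by (simp add: one_pCons)
      also have "(\<Sum>i\<in>UNIV. smult (- T i a b) [:0, Y i $$ (ra, s):]) = - [:0, N x y:]"
      proof -
        have "(\<Sum>i\<in>A. smult (- T i a b) [:0, Y i $$ (ra, s):]) = - [:0, \<Sum>i\<in>A. T i a b * Y i $$ (ra, s):]" for A
          by (induction A rule: infinite_finite_induct) simp_all
        then show ?thesis by (simp add: N_def)
      qed
      finally have eq: "P x y = (if x = y then 1 else 0) + - [:0, N x y:] + (\<Sum>i\<in>UNIV. smult (- T i a b) (line_eval n Y (er i) ra s))" .
      have "monom 1 (Suc K) dvd (\<Sum>i\<in>UNIV. smult (- T i a b) (line_eval n Y (er i) ra s))"
        by (intro dvd_sum dvd_smult line_eval_dvd) (simp add: er_def order_ge_fsubst_inv_trunc)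
      then obtain G where "(\<Sum>i\<in>UNIV. smult (- T i a b) (line_eval n Y (er i) ra s)) = monom 1 (Suc K) * G"
        by (elim dvdE)
      then show ?thesis using eq by (intro exI[of _ G]) simp
    qed
    then obtain G where G: "\<And>x y. x \<in> ?S \<Longrightarrow> y \<in> ?S \<Longrightarrow> P x y = (if x = y then 1 else 0) - [:0, N x y:] + monom 1 (Suc K) * G x y"
      by metis
    have PR: "(\<Sum>c\<in>?S. P x c * R' c y) = (if x = y then 1 else 0)" if xy: "x \<in> ?S" "y \<in> ?S" for x y
    proof -
      obtain a ra b s where [simp]: "x = (a, ra)" "y = (b, s)" by (cases x, cases y)
      have rs: "ra < n" "s < n" and ab: "a \<in> Bs" "b \<in> Bs" using xy by auto
      have "(\<Sum>c\<in>?S. P x c * R' c y) = (\<Sum>c\<in>Bs. \<Sum>t<n. line_eval n Y (fsubst (inv_trunc K) (pencil a c)) ra t * line_eval n Y (fsubst (inv_trunc K) (pencil_inv c b)) t s)"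
        by (simp add: sum.cartesian_product' P_def R'_def)
      also have "\<dots> = line_eval n Y (fsubst (inv_trunc K) (\<Sum>c\<in>Bs. pencil a c * pencil_inv c b)) ra s"
        by (simp add: fsubst_sum fsubst_mult line_eval_sum[OF Y rs] line_eval_mult[OF Y rs])
      also have "\<dots> = (if x = y then 1 else 0)"
        unfolding pencil_inverse[OF ab]
        by (cases "ra = s") (use line_eval_fconst[OF Y rs, of 1] in \<open>auto simp: one_pCons\<close>)
      finally show ?thesis .
    qed
    show "\<exists>P R0 G. (\<forall>a\<in>?S. \<forall>b\<in>?S. (\<Sum>c\<in>?S. P a c * R0 c b) = (if a = b then 1 else 0 :: complex poly)) \<and>
        (\<forall>a\<in>?S. \<forall>b\<in>?S. P a b = (if a = b then 1 else 0) - [:0, N a b:] + monom 1 (Suc K) * G a b)"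
      by (intro exI[of _ P] exI[of _ R'] exI[of _ G] conjI ballI) (rule PR, assumption+, rule G)
  next
    fix x assume "x \<in> ?S"
    then obtain a ra where [simp]: "x = (a, ra)" and "a \<in> Bs" "ra < n" by auto
    then show "(\<lambda>(a, ra). h a ra) x = (\<Sum>y\<in>?S. N x y * (\<lambda>(a, ra). h a ra) y)"
      using h[of a ra] by (simp add: sum.cartesian_product' N_def)
  qed (use a in simp)
  then show ?thesis by simp
qed

text \<open>
  The injectivity just obtained is the assumption of \<open>jointly_nilpotent_if_pencil_injective\<close> for the
  transposed matrices, if \<open>X\<close> is taken for \<open>Y\<close>.
\<close>

lemma T_nilpotent:
  assumes "card Bs * card Bs \<le> length w" "a \<in> Bs" "b \<in> Bs"
  shows "word_prod Bs T w a b = 0"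
proof -
  have "word_prod Bs (\<lambda>i a b. T i b a) (rev w) b a = 0"
  proof (rule jointly_nilpotent_if_pencil_injective[OF finB])
    fix X H a b
    assume eq: "\<And>a b. a \<in> Bs \<Longrightarrow> b \<in> Bs \<Longrightarrow> H a b = (\<Sum>i\<in>UNIV. \<Sum>c\<in>Bs. \<Sum>d\<in>Bs. X i a c * H c d * T i b d)"
      and ab: "a \<in> Bs" "b \<in> Bs"
    define n where "n = card Bs"
    obtain e where e: "bij_betw e {0..<n} Bs" using ex_enum[OF finB] n_def by blast
    obtain ra where ra: "ra < n" "a = e ra" by (rule enum_surjD[OF e ab(1)])
    have "(\<lambda>b ra. H (e ra) b) b ra = 0"
    proof (rule T_pencil_injective[of "\<lambda>i. enum_mat n e (X i)" n, OF _ _ ab(2) ra(1)])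
      show "(\<lambda>i. enum_mat n e (X i)) \<in> mat_tuples n" by (simp add: mat_tuples_def)
      fix b ra assume b: "b \<in> Bs" and ra: "ra < n"
      have "H (e ra) b = (\<Sum>i\<in>UNIV. \<Sum>c\<in>Bs. \<Sum>d\<in>Bs. X i (e ra) c * H c d * T i b d)"
        by (rule eq[OF enum_in[OF e ra] b])
      also have "\<dots> = (\<Sum>i\<in>UNIV. \<Sum>c<n. \<Sum>d\<in>Bs. X i (e ra) (e c) * H (e c) d * T i b d)"
        unfolding lessThan_atLeast0 by (rule sum.cong[OF refl], rule sum.reindex_bij_betw[OF e, symmetric])
      also have "\<dots> = (\<Sum>d\<in>Bs. \<Sum>c<n. \<Sum>i\<in>UNIV. X i (e ra) (e c) * H (e c) d * T i b d)"
        unfolding sum.cartesian_product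
        by (rule sum.reindex_bij_witness[of _ "\<lambda>(d, c, i). (i, c, d)" "\<lambda>(i, c, d). (d, c, i)"]) auto
      also have "\<dots> = (\<Sum>d\<in>Bs. \<Sum>c<n. (\<Sum>i\<in>UNIV. T i b d * enum_mat n e (X i) $$ (ra, c)) * H (e c) d)"
        using ra by (simp add: sum_distrib_left sum_distrib_right mult_ac)
      finally show "H (e ra) b = \<dots>" .
    qed
    then show "H a b = 0" using ra by simp
  qed (use assms in auto)
  then show ?thesis using word_prod_transpose[OF finB assms(3,2), of T "rev w"] by simp
qed

text \<open>
  The remainder of the expansion of \<open>x\<^sub>i\<close> has the factors \<open>T\<^sub>w\<close> with \<open>w\<close> long and vanishes. So \<open>p\<close> has an
  inverse on one side, and on the other side as well because substitution by \<open>p\<close> is injective.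
\<close>

lemma polynomial_inverse:
  "\<exists>g. (\<forall>i. fsubst p (g i) = fvar i) \<and> (\<forall>i. fsubst g (p i) = fvar i)"
proof (intro exI conjI allI)
  let ?k = "card Bs * card Bs"
  show left: "fsubst p (inv_trunc ?k i) = fvar i" for i
    using fsubst_p_inv_trunc[of i ?k] by (simp add: T_nilpotent)
  show "fsubst (inv_trunc ?k) (p i) = fvar i" for i
  proof -
    have z: "fsubst p (fsubst (inv_trunc ?k) (p i) - fvar i) = 0"
      by (simp add: fsubst_diff fsubst_fsubst left)
    have "order_ge k (fsubst (inv_trunc ?k) (p i) - fvar i)" for k
      by (rule order_ge_fsubst_p) (simp only: z order_ge_0)
    then have "fsubst (inv_trunc ?k) (p i) - fvar i = 0" by (rule order_ge_all_imp_0)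
    then show ?thesis by simp
  qed
qed

end

lemma (in deriv_invertible) ex_polynomial_inverse:
  "\<exists>g. (\<forall>i. fsubst p (g i) = fvar i) \<and> (\<forall>i. fsubst g (p i) = fvar i)"
proof -
  have "finite (range fvar \<union> (\<Union>i. word_tails (Q (Inl i))))"
    by (simp add: finite_word_tails)
  from ex_frame[OF this orbit_finite_dim] obtain Bs \<psi> where f: "finite Bs" "Bs \<subseteq> orbit" "\<And>b. flinear (\<psi> b)"
    "\<And>f. f \<in> fpoly_vs.span orbit \<Longrightarrow> f = (\<Sum>b\<in>Bs. fconst (\<psi> b f) * b)"
    by blast
  interpret deriv_invertible_frame p Q Bs \<psi>
    by unfold_locales (rule f; assumption)+
  show ?thesis by (rule polynomial_inverse)
qed

section \<open>Bijectivity and the derivative\<close>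

lemma free_bijective_if_inverse:
  fixes p g :: "'g \<Rightarrow> 'g fpoly"
  assumes "\<And>i. fsubst p (g i) = fvar i" "\<And>i. fsubst g (p i) = fvar i"
  shows "free_bijective p"
  unfolding free_bijective_def
proof (intro allI impI)
  fix n :: nat
  have *: "map_eval b n (map_eval a n X) = X" if "\<And>i. fsubst a (b i) = fvar i" "X \<in> mat_tuples n"
    for a b :: "'g \<Rightarrow> 'g fpoly" and X
  proof -
    have "fpoly_eval n (\<lambda>v. fpoly_eval n X (a v)) (b i) = X i" for i
      using fpoly_eval_fsubst[OF that(2), of a "b i"] that by (simp add: fpoly_eval_fvar)
    then show ?thesis by (simp add: map_eval_def)
  qed
  have c: "map_eval a n ` mat_tuples n \<subseteq> mat_tuples n" for a :: "'g \<Rightarrow> 'g fpoly"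
    by (auto simp: map_eval_def mat_tuples_def)
  show "bij_betw (map_eval p n) (mat_tuples n) (mat_tuples n)"
    by (rule bij_betw_byWitness[where f'="map_eval g n"]) (use * assms c in auto)
qed

text \<open>
  Subtracting the constant terms \<open>c\<close> from \<open>p\<close> does not change the derivative; the inverse of \<open>p\<close> is that of
  \<open>p - c\<close> after a translation by \<open>- c\<close>.
\<close>

lemma deriv_map_invertible_imp_bijective:
  fixes p :: "'g::finite \<Rightarrow> 'g fpoly"
  assumes "has_polynomial_inverse (deriv_map p)"
  shows "free_bijective p"
proof -
  define c where "c = (\<lambda>i. counit (p i))"
  define p' where "p' = (\<lambda>i. p i - fconst (c i))"
  have fd: "fderiv (f - g) = fderiv f - fderiv g" for f g :: "'g fpoly"
    using fderiv_add[of "f - g" g] by simp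
  have dm: "deriv_map p' = deriv_map p"
    by (rule ext) (simp add: deriv_map_def p'_def fd split: sum.splits)
  have eps': "counit (p' i) = 0" for i
    using counit_add[of "p' i" "fconst (c i)"] by (simp add: p'_def c_def)
  obtain Q where Q: "\<And>v. fsubst Q (deriv_map p' v) = fvar v" "\<And>v. fsubst (deriv_map p') (Q v) = fvar v"
    using assms unfolding has_polynomial_inverse_def dm by blast
  interpret deriv_invertible p' Q by unfold_locales (rule eps' Q)+
  obtain g where g: "\<And>i. fsubst p' (g i) = fvar i" "\<And>i. fsubst g (p' i) = fvar i"
    using ex_polynomial_inverse by blast
  define sh where "sh = (\<lambda>j. fvar j - fconst (c j))"
  show ?thesis
  proof (rule free_bijective_if_inverse[of p "\<lambda>i. fsubst sh (g i)"])
    show "fsubst p (fsubst sh (g i)) = fvar i" for i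
      using g(1)[of i] by (simp add: fsubst_fsubst sh_def fsubst_diff p'_def)
    show "fsubst (\<lambda>i. fsubst sh (g i)) (p i) = fvar i" for i
    proof -
      have "fsubst (\<lambda>i. fsubst sh (g i)) (p' i) = fsubst sh (fvar i)"
        unfolding fsubst_fsubst[symmetric] g(2) ..
      then show ?thesis by (simp add: p'_def sh_def fsubst_diff)
    qed
  qed
qed

theorem corollary6p14:
  fixes p :: "'g::finite \<Rightarrow> 'g fpoly"
  shows "free_bijective p \<longleftrightarrow> has_polynomial_inverse (deriv_map p)"
  using bijective_imp_deriv_map_invertible deriv_map_invertible_imp_bijective by blast

end
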